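(* Let $\delta\in[0,1)$, $\theta\in(0,1)$, $f\in\mathcal{F}_\delta$, and let $X_1,\dots,X_n$ be i.i.d. observations. When $\delta=0$, any estimator sequence $\hat\theta_n$ has infinite quadratic risk, namely $$\sup_{E_0}\ \liminf_{n\to\infty}\ \sup_{g\in E_0}\ \mathbb{E}_{P_{1/\sqrt n,g}}\big[\sqrt n\big(\hat\theta_n-\psi(P_{1/\sqrt n,g})\big)\big]^2=+\infty ,$$ where the first supremum is over all finite subsets $E_0$ of the tangent set $\dot{\mathcal{P}}_0$. When $\delta>0$: (i) for any estimator sequence $\hat\theta_n$, $$\sup_{E_\delta}\ \liminf_{n\to\infty}\ \sup_{g\in E_\delta}\ \mathbb{E}_{P_{1/\sqrt n,g}}\big[\sqrt n\big(\hat\theta_n-\psi(P_{1/\sqrt n,g})\big)\big]^2\ \ge\ \theta\Big(\frac1\delta-\theta\Big),$$ where the first supremum is over all finite subsets $E_\delta$ of the tangent set $\dot{\mathcal{P}}_\delta$; (ii) a sequence of estimators $\hat\theta_n$ is asymptotically efficient at $\mathbb{P}_{\theta,f}$ in the sense of the convolution theorem (best regular estimator) if and only if $$\hat\theta_n=\frac1n\sum_{i=1}^n\frac1\delta\mathbf{1}_{\{X_i\in[1-\delta,1]\}}+o_{\mathbb{P}_{\theta,f}}(n^{-1/2}).$$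
   Context: For $\delta\in[0,1)$, $\mathcal{F}_\delta$ is the set of continuous non-increasing probability densities $f:[0,1]\to\mathbb{R}^+$ that are positive on $[0,1-\delta)$ and vanish on $[1-\delta,1]$. $\mathbb{P}_{\theta,f}$ is the probability on $[0,1]$ with density $\theta+(1-\theta)f$, and $\psi(\mathbb{P}_{\theta,f})=\theta$. An estimator sequence is a sequence of measurable functions $\hat\theta_n=\hat\theta_n(X_1,\dots,X_n)$. Paths and tangent set. Fix $(\theta,f)$. For a continuous non-increasing function $h_0$ on $[0,1-\delta)$ with $\int fh_0=0$ and $h=\frac{(1-\theta)fh_0}{\theta+(1-\theta)f}\in\mathbb{L}_2(\mathbb{P}_{\theta,f})$ (with $fh_0:=0$ on $[1-\delta,1]$), let, for $t\ge0$, $f_t=k(th_0)f\big/\int k(th_0(u))f(u)\,du$ on $[0,1-\delta)$ and $f_t=0$ on $[1-\delta,1]$, where $k(u)=2(1+e^{-2u})^{-1}$; then $f_t\in\mathcal{F}_\delta$. The set of such $h$ is denoted ${}_f\dot{\mathcal{P}}_\delta$. For $a\in\mathbb{R}$, the path $t\mapsto\mathbb{P}_{\theta+ta,f_t}$ (defined for small $t\ge 0$) has score function $g=a\,\dot l_{\theta,f}+h$, where $\dot l_{\theta,f}=\frac{1-f}{\theta+(1-\theta)f}$. An element $g$ of the tangent set $\dot{\mathcal{P}}_\delta$ is always taken together with such a path, i.e. with a pair $(a,h_0)$; one writes $P_{t,g}=\mathbb{P}_{\theta+ta,f_t}$, so that $\psi(P_{1/\sqrt n,g})=\theta+a/\sqrt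 n$. Thus a finite subset $E_\delta$ amounts to a finite set of such paths (pairs $(a,h_0)$). $\mathbb{E}_{P_{1/\sqrt n,g}}$ is expectation when $X_1,\dots,X_n$ are i.i.d. with law $P_{1/\sqrt n,g}$ (defined for $n$ large). Efficiency (for $\delta>0$). $\hat\theta_n$ is regular at $\mathbb{P}_{\theta,f}$ if there is a probability measure $L$ such that for every path $t\mapsto P_{t,g}=\mathbb{P}_{\theta+ta,f_t}$, where $a\in\mathbb{R}$ and $f_t$ is built from a continuous non-increasing function $h_0$ on $[0,1-\delta)$ with $\int fh_0=0$ and $h=\frac{(1-\theta)fh_0}{\theta+(1-\theta)f}\in\mathbb{L}_2(\mathbb{P}_{\theta,f})$, so that the score function is $g=a\,\dot l_{\theta,f}+h$, the sequence $\sqrt n(\hat\theta_n-\psi(P_{1/\sqrt n,g}))$ converges in distribution to $L$ under $P_{1/\sqrt n,g}$. It is asymptotically efficient at $\mathbb{P}_{\theta,f}$ if it is regular with $L=N\big(0,\int\tilde\psi_{\theta,f}^2\,d\mathbb{P}_{\theta,f}\big)$, where the efficient influence function $\tilde\psi_{\theta,f}$ is the unique element of the closed linear span in $\mathbb{L}_2(\mathbb{P}_{\theta,f})$ of $\{a\dot l_{\theta,f}+h: a\in\mathbb{R},h\in{}_f\dot{\mathcal{P}}_\delta\}$ satisfying $a=\int\tilde\psi_{\theta,f}(a\dot l_{\theta,f}+h)\,d\mathbb{P}_{\theta,f}$ for all $a\in\mathbb{R}$, $h\in{}_f\dot{\mathcal{P}}_\delta$. *)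

theory Defs
  imports "HOL-Probability.Probability"
begin

section \<open>The model\<close>

definition dens_class :: "real \<Rightarrow> (real \<Rightarrow> real) set" where
  "dens_class \<delta> = {f. continuous_on {0..1} f \<and> antimono_on {0..1} f \<and> (\<forall>x\<in>{0..1}. 0 \<le> f x) \<and>
     (LBINT x:{0..1}. f x) = 1 \<and> (\<forall>x\<in>{0..<1-\<delta>}. 0 < f x) \<and> (\<forall>x\<in>{1-\<delta>..1}. f x = 0)}"

definition mix_dens :: "real \<Rightarrow> (real \<Rightarrow> real) \<Rightarrow> real \<Rightarrow> real" where
  "mix_dens \<theta> f x = \<theta> + (1 - \<theta>) * f x"

definition mix :: "real \<Rightarrow> (real \<Rightarrow> real) \<Rightarrow> real measure" where
  "mix \<theta> f = density (restrict_space lborel {0..1}) (\<lambda>x. ennreal (mix_dens \<theta> f x))"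

text \<open>The parameter is a functional of the law: the density of the law is continuous and takes
  the value \<open>\<theta>\<close> at 1, so \<open>\<theta>\<close> is identified (lemma \<open>psi_mix\<close> below).\<close>

definition psi :: "real measure \<Rightarrow> real" where
  "psi P = (THE \<theta>. \<theta> \<in> {0..1} \<and> (\<exists>\<delta>\<in>{0..<1}. \<exists>f\<in>dens_class \<delta>. P = mix \<theta> f))"

definition sample_law :: "nat \<Rightarrow> real measure \<Rightarrow> (nat \<Rightarrow> real) measure" where
  "sample_law n P = (\<Pi>\<^sub>M i\<in>{..<n}. P)"

definition estimator_seq :: "(nat \<Rightarrow> (nat \<Rightarrow> real) \<Rightarrow> real) \<Rightarrow> bool" where
  "estimator_seq T \<longleftrightarrow>
     (\<forall>n. T n \<in> borel_measurable (\<Pi>\<^sub>M i\<in>{..<n}. restrict_space borel {0..1::real}))"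


section \<open>Square-integrable functions\<close>

definition L2 :: "'a measure \<Rightarrow> ('a \<Rightarrow> real) set" where
  "L2 M = {g \<in> borel_measurable M. integrable M (\<lambda>x. (g x)\<^sup>2)}"

definition lin_span :: "('a \<Rightarrow> real) set \<Rightarrow> ('a \<Rightarrow> real) set" where
  "lin_span S = {g. \<exists>(m::nat) c s. (\<forall>i<m. s i \<in> S) \<and> g = (\<lambda>x. \<Sum>i<m. c i * s i x)}"

definition closed_lin_span :: "'a measure \<Rightarrow> ('a \<Rightarrow> real) set \<Rightarrow> ('a \<Rightarrow> real) set" where
  "closed_lin_span M S =
     {g \<in> L2 M. \<forall>\<epsilon>>0. \<exists>s\<in>lin_span S. (\<integral>\<^sup>+x. ennreal ((g x - s x)\<^sup>2) \<partial>M) < ennreal \<epsilon>}"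


section \<open>Paths and scores\<close>

definition kfun :: "real \<Rightarrow> real" where
  "kfun u = 2 / (1 + exp (- 2 * u))"

definition f_path :: "real \<Rightarrow> (real \<Rightarrow> real) \<Rightarrow> (real \<Rightarrow> real) \<Rightarrow> real \<Rightarrow> real \<Rightarrow> real" where
  "f_path \<delta> f h0 t x =
     (if x < 1 - \<delta>
      then kfun (t * h0 x) * f x / (LBINT u:{0..<1-\<delta>}. kfun (t * h0 u) * f u) else 0)"

definition score_theta :: "real \<Rightarrow> (real \<Rightarrow> real) \<Rightarrow> real \<Rightarrow> real" where
  "score_theta \<theta> f x = (1 - f x) / mix_dens \<theta> f x"

definition score_f :: "real \<Rightarrow> real \<Rightarrow> (real \<Rightarrow> real) \<Rightarrow> (real \<Rightarrow> real) \<Rightarrow> real \<Rightarrow> real" where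
  "score_f \<delta> \<theta> f h0 x = (if x < 1 - \<delta> then (1 - \<theta>) * (f x * h0 x) / mix_dens \<theta> f x else 0)"

text \<open>A path is represented by its pair \<open>(a, h0)\<close>; values of \<open>h0\<close> outside \<open>[0,1-\<delta>)\<close> are never
  used. The square-integrability condition makes \<open>f * h0\<close> integrable on \<open>[0,1-\<delta>)\<close> when
  \<open>0 < \<theta> < 1\<close>, so the vanishing integral is a genuine one.\<close>

definition paths :: "real \<Rightarrow> real \<Rightarrow> (real \<Rightarrow> real) \<Rightarrow> (real \<times> (real \<Rightarrow> real)) set" where
  "paths \<delta> \<theta> f = {(a, h0). continuous_on {0..<1-\<delta>} h0 \<and> antimono_on {0..<1-\<delta>} h0 \<and>
     (LBINT x:{0..<1-\<delta>}. f x * h0 x) = 0 \<and> score_f \<delta> \<theta> f h0 \<in> L2 (mix \<theta> f)}"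

definition path_score ::
    "real \<Rightarrow> real \<Rightarrow> (real \<Rightarrow> real) \<Rightarrow> real \<times> (real \<Rightarrow> real) \<Rightarrow> real \<Rightarrow> real" where
  "path_score \<delta> \<theta> f p x = fst p * score_theta \<theta> f x + score_f \<delta> \<theta> f (snd p) x"

text \<open>For a path with \<open>\<theta> + t * a\<close> outside \<open>[0,1]\<close> the following is a junk value; along
  \<open>t = 1 / sqrt n\<close> this only affects finitely many \<open>n\<close>.\<close>

definition path_law ::
    "real \<Rightarrow> real \<Rightarrow> (real \<Rightarrow> real) \<Rightarrow> real \<times> (real \<Rightarrow> real) \<Rightarrow> real \<Rightarrow> real measure" where
  "path_law \<delta> \<theta> f p t = mix (\<theta> + t * fst p) (f_path \<delta> f (snd p) t)"


section \<open>Risk, regularity and efficiency\<close>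

definition quad_risk :: "(nat \<Rightarrow> (nat \<Rightarrow> real) \<Rightarrow> real) \<Rightarrow> nat \<Rightarrow> real measure \<Rightarrow> ennreal" where
  "quad_risk T n P = (\<integral>\<^sup>+x. ennreal ((sqrt n * (T n x - psi P))\<^sup>2) \<partial>sample_law n P)"

definition local_minimax_risk ::
    "real \<Rightarrow> real \<Rightarrow> (real \<Rightarrow> real) \<Rightarrow> (nat \<Rightarrow> (nat \<Rightarrow> real) \<Rightarrow> real) \<Rightarrow> ennreal" where
  "local_minimax_risk \<delta> \<theta> f T =
     (SUP E\<in>{E. finite E \<and> E \<subseteq> paths \<delta> \<theta> f}.
        liminf (\<lambda>n. SUP g\<in>E. quad_risk T n (path_law \<delta> \<theta> f g (1 / sqrt n))))"

definition regular_with_limit ::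
    "real \<Rightarrow> real \<Rightarrow> (real \<Rightarrow> real) \<Rightarrow> (nat \<Rightarrow> (nat \<Rightarrow> real) \<Rightarrow> real) \<Rightarrow> real measure \<Rightarrow> bool" where
  "regular_with_limit \<delta> \<theta> f T L \<longleftrightarrow> real_distribution L \<and>
     (\<forall>g\<in>paths \<delta> \<theta> f.
        weak_conv_m
          (\<lambda>n. let P = path_law \<delta> \<theta> f g (1 / sqrt n)
               in distr (sample_law n P) borel (\<lambda>x. sqrt n * (T n x - psi P))) L)"

text \<open>The efficient influence function is unique only up to null sets of \<open>mix \<theta> f\<close>, hence a
  predicate.\<close>

definition efficient_influence ::
    "real \<Rightarrow> real \<Rightarrow> (real \<Rightarrow> real) \<Rightarrow> (real \<Rightarrow> real) \<Rightarrow> bool" where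
  "efficient_influence \<delta> \<theta> f \<phi> \<longleftrightarrow>
     \<phi> \<in> closed_lin_span (mix \<theta> f) (path_score \<delta> \<theta> f ` paths \<delta> \<theta> f) \<and>
     (\<forall>g\<in>paths \<delta> \<theta> f. (\<integral>x. \<phi> x * path_score \<delta> \<theta> f g x \<partial>mix \<theta> f) = fst g)"

definition asymptotically_efficient ::
    "real \<Rightarrow> real \<Rightarrow> (real \<Rightarrow> real) \<Rightarrow> (nat \<Rightarrow> (nat \<Rightarrow> real) \<Rightarrow> real) \<Rightarrow> bool" where
  "asymptotically_efficient \<delta> \<theta> f T \<longleftrightarrow>
     (\<exists>\<phi>. efficient_influence \<delta> \<theta> f \<phi> \<and>
        regular_with_limit \<delta> \<theta> f T
          (density lborel (normal_density 0 (sqrt (\<integral>x. (\<phi> x)\<^sup>2 \<partial>mix \<theta> f)))))"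

text \<open>\<open>T n = S n + o\<^sub>P (r n)\<close> for i.i.d. samples from \<open>P\<close>\<close>

definition equal_up_to_oP ::
    "real measure \<Rightarrow> (nat \<Rightarrow> real) \<Rightarrow> (nat \<Rightarrow> (nat \<Rightarrow> real) \<Rightarrow> real) \<Rightarrow>
     (nat \<Rightarrow> (nat \<Rightarrow> real) \<Rightarrow> real) \<Rightarrow> bool" where
  "equal_up_to_oP P r T S \<longleftrightarrow>
     (\<forall>\<epsilon>>0. (\<lambda>n. measure (sample_law n P)
        {x \<in> space (sample_law n P). \<bar>T n x - S n x\<bar> > \<epsilon> * r n}) \<longlonglongrightarrow> 0)"


section \<open>Identifiability\<close>

lemma dens_class_measurable:
  assumes "f \<in> dens_class \<delta>"
  shows "(\<lambda>x. mix_dens \<theta> f x) \<in> borel_measurable (restrict_space lborel {0..1})"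
proof -
  have "continuous_on {0..1} (\<lambda>x. mix_dens \<theta> f x)"
    using assms unfolding mix_dens_def dens_class_def by (auto intro!: continuous_intros)
  then have "(\<lambda>x. mix_dens \<theta> f x) \<in> borel_measurable (restrict_space borel {0..1})"
    by (rule borel_measurable_continuous_on_restrict)
  then show ?thesis
    by (simp cong: measurable_cong_sets add: sets_restrict_space)
qed

lemma mix_ident:
  assumes "\<theta> \<in> {0..1}" "\<theta>' \<in> {0..1}" "\<delta> \<in> {0..<1}" "\<delta>' \<in> {0..<1}"
    and f: "f \<in> dens_class \<delta>" and f': "f' \<in> dens_class \<delta>'" and eq: "mix \<theta> f = mix \<theta>' f'"
  shows "\<theta> = \<theta>'"
proof (rule ccontr)
  assume ne: "\<theta> \<noteq> \<theta>'"
  let ?R = "restrict_space lborel {0..1::real}"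
  interpret R: finite_measure ?R
    by (rule finite_measureI) (simp add: emeasure_restrict_space space_restrict_space)
  have "AE x in ?R. ennreal (mix_dens \<theta> f x) = ennreal (mix_dens \<theta>' f' x)"
    using eq dens_class_measurable[OF f, of \<theta>] dens_class_measurable[OF f', of \<theta>']
    unfolding mix_def by (subst (asm) R.density_unique_iff) auto
  then have ae: "AE x in lborel. x \<in> {0..1} \<longrightarrow>
      ennreal (mix_dens \<theta> f x) = ennreal (mix_dens \<theta>' f' x)"
    by (subst (asm) AE_restrict_space_iff) auto
  define d where "d x = mix_dens \<theta> f x - mix_dens \<theta>' f' x" for x
  have cont: "continuous_on {0..1} d"
    using f f' unfolding d_def mix_dens_def dens_class_def by (auto intro!: continuous_intros)
  have "f 1 = 0" "f' 1 = 0"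
    using f f' assms(3,4) by (auto simp: dens_class_def)
  then have d1: "d 1 \<noteq> 0" using ne by (simp add: d_def mix_dens_def)
  have "(d \<longlongrightarrow> d 1) (at 1 within {0..1})"
    using cont by (auto simp: continuous_on_def)
  then have "\<forall>\<^sub>F x in at 1 within {0..1}. d x \<noteq> 0"
    using d1 by (rule tendsto_imp_eventually_ne)
  then obtain e where e: "e > 0" and nz: "\<And>x. x \<in> {0..1} \<Longrightarrow> x \<noteq> 1 \<Longrightarrow> dist x 1 < e \<Longrightarrow> d x \<noteq> 0"
    by (auto simp: eventually_at)
  have "AE x in lborel. \<not> (x \<in> {max 0 (1 - e)<..<1})"
    using ae
  proof eventually_elim
    case (elim x)
    show ?case
    proof
      assume x: "x \<in> {max 0 (1 - e)<..<1}"
      then have "x \<in> {0..1}" by auto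
      moreover have "f x \<ge> 0" "f' x \<ge> 0" using f f' \<open>x \<in> {0..1}\<close> by (auto simp: dens_class_def)
      ultimately have "d x = 0"
        using elim assms(1,2) by (simp add: d_def mix_dens_def flip: ennreal_plus)
      moreover have "d x \<noteq> 0" using x by (intro nz) (auto simp: dist_real_def)
      ultimately show False by simp
    qed
  qed
  then have "emeasure lborel {max 0 (1 - e)<..<1} = 0"
    by (subst (asm) AE_iff_measurable[of "{max 0 (1 - e)<..<1}"]) auto
  then show False using e by (simp add: max_def split: if_splits)
qed

lemma psi_mix:
  assumes "\<theta> \<in> {0..1}" "\<delta> \<in> {0..<1}" "f \<in> dens_class \<delta>"
  shows "psi (mix \<theta> f) = \<theta>"
  unfolding psi_def using assms mix_ident by (intro the_equality) blast+

end

theory Submission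
  imports Defs
begin

text \<open>For two paths the chi-square divergence between the laws of one observation, multiplied by
  \<open>n\<close>, converges to the squared distance of the scores. Hence the likelihood ratios of the samples
  are bounded in \<open>L\<^sup>2\<close>, and this second-moment information replaces local asymptotic normality
  throughout.

  Moving along a path from \<open>j * s\<close> to \<open>(j + 1) * s\<close> changes the mean of the rescaled
  estimator by at most the Hammersley--Chapman--Robbins bound. If the risk is at most \<open>r\<close> on a long
  grid, the mean must nevertheless travel the distance \<open>m * s * \<bar>a\<bar>\<close> up to two biases of size
  \<open>sqrt r\<close>; letting \<open>m \<rightarrow> \<infinity>\<close> and then \<open>s \<rightarrow> 0\<close> gives \<open>r \<ge> a\<^sup>2 / \<parallel>g\<parallel>\<^sup>2\<close>.
  For \<open>\<delta> > 0\<close> the centred estimator \<open>1 / \<delta> * indicator {1-\<delta>..1} - \<theta>\<close> is itself the score of a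
  path, since \<open>- 1 / f\<close> is non-increasing; for \<open>\<delta> = 0\<close> there are paths with \<open>a = 1\<close> and
  arbitrarily small scores.

  An efficient estimator is tested against the paths \<open>c * (a, h0)\<close> with this score: as \<open>c \<rightarrow> 0\<close>,
  the shift of its mean under \<open>c\<close> determines its covariance with the tail frequency. The covariance
  equals both variances, so the two estimators agree to first order.\<close>

section \<open>Second moments of likelihood ratios\<close>

text \<open>Why a grid: a comparison of just two laws would lose the sharp constant, because the
  estimator may be biased by up to \<open>sqrt r\<close> at either end, as much as the shift to be
  detected. Along a grid the two end biases are paid once, while the required shift grows with the
  number of steps. The paths form a cone only, since \<open>h0\<close> has to stay non-increasing.
  Rescaled paths are therefore always taken with nonnegative factors, and neighbouring grid points
  are compared with each other: their scores differ by \<open>s\<close> times the score of the ray.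
  The obstacle in the efficiency part is that convergence in law controls no moments of the
  estimator. A bounded sine truncation replaces it; its first two moments are values of
  characteristic functions, which regularity does provide. Throughout, the product
  \<open>f * h0\<close> is estimated instead of \<open>h0\<close>, since the least favourable
  \<open>h0\<close> is unbounded near \<open>1-\<delta>\<close> when
  \<open>\<delta> > 0\<close>.\<close>

lemma integrable_mult_L2:
  fixes X Y :: "'a \<Rightarrow> real"
  assumes [measurable]: "X \<in> borel_measurable M" "Y \<in> borel_measurable M"
    and X: "integrable M (\<lambda>x. (X x)\<^sup>2)" and Y: "integrable M (\<lambda>x. (Y x)\<^sup>2)"
  shows "integrable M (\<lambda>x. X x * Y x)"
proof (rule Bochner_Integration.integrable_bound[OF Bochner_Integration.integrable_add[OF X Y]])
  show "AE x in M. norm (X x * Y x) \<le> norm ((X x)\<^sup>2 + (Y x)\<^sup>2)"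
  proof (rule AE_I2)
    fix x
    have "2 * (\<bar>X x\<bar> * \<bar>Y x\<bar>) \<le> (X x)\<^sup>2 + (Y x)\<^sup>2"
      using sum_squares_bound[of "\<bar>X x\<bar>" "\<bar>Y x\<bar>"] by simp
    moreover have "0 \<le> \<bar>X x\<bar> * \<bar>Y x\<bar>" by simp
    ultimately show "norm (X x * Y x) \<le> norm ((X x)\<^sup>2 + (Y x)\<^sup>2)"
      unfolding real_norm_def abs_mult by linarith
  qed
qed simp

lemma integrable_diff_L2:
  fixes X Y :: "'a \<Rightarrow> real"
  assumes [measurable]: "X \<in> borel_measurable M" "Y \<in> borel_measurable M"
    and X: "integrable M (\<lambda>x. (X x)\<^sup>2)" and Y: "integrable M (\<lambda>x. (Y x)\<^sup>2)"
  shows "integrable M (\<lambda>x. (X x - Y x)\<^sup>2)"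
  unfolding power2_diff mult.assoc
  by (intro Bochner_Integration.integrable_add Bochner_Integration.integrable_diff integrable_mult_right
      integrable_mult_L2 assms)

lemma Cauchy_Schwarz_integral:
  fixes X Y :: "'a \<Rightarrow> real"
  assumes [measurable]: "X \<in> borel_measurable M" "Y \<in> borel_measurable M"
    and X: "integrable M (\<lambda>x. (X x)\<^sup>2)" and Y: "integrable M (\<lambda>x. (Y x)\<^sup>2)"
  shows "\<bar>\<integral>x. X x * Y x \<partial>M\<bar> \<le> sqrt (\<integral>x. (X x)\<^sup>2 \<partial>M) * sqrt (\<integral>x. (Y x)\<^sup>2 \<partial>M)"
proof -
  define a b c where "a = (\<integral>x. (X x)\<^sup>2 \<partial>M)" and "b = (\<integral>x. X x * Y x \<partial>M)"
    and "c = (\<integral>x. (Y x)\<^sup>2 \<partial>M)"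
  note XY = integrable_mult_L2[OF assms]
  \<comment> \<open>The second moment of \<open>X - l * Y\<close> is nonnegative for every
    \<open>l\<close>. For \<open>c > 0\<close> the minimiser \<open>l = b / c\<close> gives the
    inequality; for \<open>c = 0\<close> the expression is affine in \<open>l\<close>, so
    \<open>b\<close> must vanish.\<close>
  have quad: "0 \<le> a - 2 * l * b + l\<^sup>2 * c" for l
  proof -
    have "0 \<le> (\<integral>x. (X x - l * Y x)\<^sup>2 \<partial>M)" by simp
    also have "\<dots> = (\<integral>x. (X x)\<^sup>2 - 2 * l * (X x * Y x) + l\<^sup>2 * (Y x)\<^sup>2 \<partial>M)"
      by (simp add: power2_diff algebra_simps)
    also have "\<dots> = a - 2 * l * b + l\<^sup>2 * c"
      using X Y XY by (simp add: a_def b_def c_def)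
    finally show ?thesis .
  qed
  have "c \<ge> 0" by (simp add: c_def)
  have "b\<^sup>2 \<le> a * c"
  proof (cases "c = 0")
    case True
    have "b = 0"
    proof (rule ccontr)
      assume "b \<noteq> 0"
      then show False using quad[of "(a + 1) / (2 * b)"] True by simp
    qed
    then show ?thesis using True by simp
  next
    case False
    with \<open>c \<ge> 0\<close> quad[of "b / c"] show ?thesis
      by (simp add: power2_eq_square field_simps)
  qed
  then have "\<bar>b\<bar> \<le> sqrt (a * c)" by (rule real_le_rsqrt[OF order_eq_refl[THEN order_trans], rotated]) simp
  then show ?thesis by (simp add: a_def b_def c_def real_sqrt_mult)
qed

locale likelihood_ratio = prob_space M for M :: "'a measure" +
  fixes r :: "'a \<Rightarrow> real"
  assumes r_measurable [measurable]: "r \<in> borel_measurable M"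
    and r_nonneg: "x \<in> space M \<Longrightarrow> 0 \<le> r x"
    and r_integral: "(\<integral>x. r x \<partial>M) = 1"
    and r_L2: "integrable M (\<lambda>x. (r x)\<^sup>2)"
begin

text \<open>The chi-square divergence of the law with density \<open>r\<close> from
  \<open>M\<close>. It is chosen because it behaves well under products: \<open>1 + chi2\<close> is
  multiplicative.\<close>

definition chi2 :: real where
  "chi2 = (\<integral>x. (r x - 1)\<^sup>2 \<partial>M)"

lemma chi2_nonneg: "0 \<le> chi2"
  by (simp add: chi2_def)

text \<open>The Bochner integral of a non-integrable function is 0 by convention, so the value 1
  already forces integrability.\<close>

lemma r_integrable: "integrable M r"
  using r_integral not_integrable_integral_eq by fastforce

lemma second_moment_eq: "(\<integral>x. (r x)\<^sup>2 \<partial>M) = 1 + chi2"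
  unfolding chi2_def power2_diff using r_L2 r_integrable r_integral prob_space by simp

lemma prob_space_density: "prob_space (density M (\<lambda>x. ennreal (r x)))"
proof (rule prob_spaceI)
  have "emeasure (density M (\<lambda>x. ennreal (r x))) (space M) = (\<integral>\<^sup>+x. ennreal (r x) \<partial>M)"
    by (subst emeasure_density) (auto intro!: nn_integral_cong)
  also have "\<dots> = 1"
    using nn_integral_eq_integral[OF r_integrable] r_nonneg r_integral by simp
  finally show "emeasure (density M (\<lambda>x. ennreal (r x))) (space (density M (\<lambda>x. ennreal (r x)))) = 1"
    by simp
qed

lemma integral_density_eq:
  assumes [measurable]: "X \<in> borel_measurable M"
  shows "(\<integral>x. X x \<partial>density M (\<lambda>x. ennreal (r x))) = (\<integral>x. r x * (X x :: real) \<partial>M)"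
  using r_nonneg by (subst integral_density) auto

text \<open>The Hammersley--Chapman--Robbins inequality. The centring \<open>m\<close> is free, so that a quadratic risk
  can take the place of the variance.\<close>

lemma mean_shift_le:
  assumes X[measurable]: "X \<in> borel_measurable M" and X2: "integrable M (\<lambda>x. (X x - m)\<^sup>2)"
  shows "\<bar>(\<integral>x. X x \<partial>density M (\<lambda>x. ennreal (r x))) - (\<integral>x. X x \<partial>M)\<bar>
    \<le> sqrt (\<integral>x. (X x - m)\<^sup>2 \<partial>M) * sqrt chi2"
proof -
  have Xm: "integrable M (\<lambda>x. X x - m)"
    by (rule square_integrable_imp_integrable[OF _ X2]) simp
  have X1: "integrable M X"
    using Bochner_Integration.integrable_add[OF Xm, of "\<lambda>_. m"] by simp
  have rXm: "integrable M (\<lambda>x. r x * (X x - m))"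
    by (rule integrable_mult_L2[OF _ _ r_L2 X2]) simp_all
  have rX: "integrable M (\<lambda>x. r x * X x)"
    using Bochner_Integration.integrable_add[OF rXm integrable_mult_left[OF r_integrable, of m]]
    by (simp add: algebra_simps)
  \<comment> \<open>Since \<open>r - 1\<close> has mean 0 under \<open>M\<close>, the centring
    \<open>m\<close> drops out, and the covariance of \<open>X\<close> with \<open>r - 1\<close> is
    exactly the shift of the mean.\<close>
  have "(\<integral>x. (X x - m) * (r x - 1) \<partial>M) = (\<integral>x. r x * X x - X x - m * r x + m \<partial>M)"
    by (simp add: algebra_simps)
  also have "\<dots> = (\<integral>x. r x * X x \<partial>M) - (\<integral>x. X x \<partial>M)"
    using rX X1 r_integrable r_integral prob_space by simp
  also have "(\<integral>x. r x * X x \<partial>M) = (\<integral>x. X x \<partial>density M (\<lambda>x. ennreal (r x)))"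
    by (simp add: integral_density_eq)
  finally show ?thesis
    using Cauchy_Schwarz_integral[of "\<lambda>x. X x - m" M "\<lambda>x. r x - 1"] X2
      integrable_diff_L2[of r M "\<lambda>_. 1"] r_L2
    by (simp add: chi2_def)
qed

text \<open>Contiguity in quantitative form, from the mean shift of an indicator, whose second
  moment about 0 is \<open>measure M A\<close>. While \<open>chi2\<close> stays bounded, events that
  become negligible under \<open>M\<close> become negligible under the tilted law.\<close>

lemma measure_density_le:
  assumes [measurable]: "A \<in> sets M"
  shows "measure (density M (\<lambda>x. ennreal (r x))) A \<le> measure M A + sqrt (measure M A) * sqrt chi2"
proof -
  have "integrable M (\<lambda>x. (indicator A x - 0 :: real)\<^sup>2)"
    by (rule integrable_const_bound[where B = 1]) (auto split: split_indicator)
  moreover have "(\<integral>x. (indicator A x - 0 :: real)\<^sup>2 \<partial>M) = measure M A"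
    by (subst Bochner_Integration.integral_cong[OF refl, of _ _ "indicator A"])
      (auto split: split_indicator simp: sets.Int_space_eq2)
  ultimately show ?thesis
    using mean_shift_le[of "indicator A" 0] prob_space_density by simp
qed

lemma PiM_density:
  assumes "finite I"
  shows "(\<Pi>\<^sub>M i\<in>I. density M (\<lambda>x. ennreal (r x)))
    = density (\<Pi>\<^sub>M i\<in>I. M) (\<lambda>x. ennreal (\<Prod>i\<in>I. r (x i)))"
proof -
  interpret D: product_sigma_finite "\<lambda>_. density M (\<lambda>x. ennreal (r x))"
    unfolding product_sigma_finite_def
    using prob_space_density by (simp add: prob_space_imp_sigma_finite)
  interpret P: product_sigma_finite "\<lambda>_. M"
    unfolding product_sigma_finite_def by (simp add: sigma_finite_measure_axioms)
  show ?thesis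
  proof (rule D.PiM_eqI[OF assms, symmetric])
    show "sets (density (\<Pi>\<^sub>M i\<in>I. M) (\<lambda>x. ennreal (\<Prod>i\<in>I. r (x i))))
        = sets (\<Pi>\<^sub>M i\<in>I. density M (\<lambda>x. ennreal (r x)))"
      by (simp cong: sets_PiM_cong)
    fix A assume "\<And>i. i \<in> I \<Longrightarrow> A i \<in> sets (density M (\<lambda>x. ennreal (r x)))"
    then have A[measurable]: "i \<in> I \<Longrightarrow> A i \<in> sets M" for i by simp
    have "Pi\<^sub>E I A \<in> sets (\<Pi>\<^sub>M i\<in>I. M)"
      using assms A by (intro sets_PiM_I_finite) auto
    then have "emeasure (density (\<Pi>\<^sub>M i\<in>I. M) (\<lambda>x. ennreal (\<Prod>i\<in>I. r (x i)))) (Pi\<^sub>E I A)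
      = (\<integral>\<^sup>+x. ennreal (\<Prod>i\<in>I. r (x i)) * indicator (Pi\<^sub>E I A) x \<partial>(\<Pi>\<^sub>M i\<in>I. M))"
      using assms by (subst emeasure_density) auto
    also have "\<dots> = (\<integral>\<^sup>+x. (\<Prod>i\<in>I. ennreal (r (x i)) * indicator (A i) (x i)) \<partial>(\<Pi>\<^sub>M i\<in>I. M))"
    proof (rule nn_integral_cong)
      fix x assume x: "x \<in> space (\<Pi>\<^sub>M i\<in>I. M)"
      then have nn: "0 \<le> r (x i)" if "i \<in> I" for i
        using that r_nonneg by (auto simp: space_PiM)
      have "indicator (Pi\<^sub>E I A) x = (\<Prod>i\<in>I. indicator (A i) (x i) :: ennreal)"
        using x assms by (auto simp: space_PiM indicator_def PiE_iff prod_zero_iff)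
      then show "ennreal (\<Prod>i\<in>I. r (x i)) * indicator (Pi\<^sub>E I A) x
          = (\<Prod>i\<in>I. ennreal (r (x i)) * indicator (A i) (x i))"
        using nn by (simp add: prod.distrib prod_ennreal)
    qed
    also have "\<dots> = (\<Prod>i\<in>I. \<integral>\<^sup>+x. ennreal (r x) * indicator (A i) x \<partial>M)"
      using assms A by (intro P.product_nn_integral_prod) auto
    also have "\<dots> = (\<Prod>i\<in>I. emeasure (density M (\<lambda>x. ennreal (r x))) (A i))"
      using A by (intro prod.cong) (auto simp: emeasure_density)
    finally show "emeasure (density (\<Pi>\<^sub>M i\<in>I. M) (\<lambda>x. ennreal (\<Prod>i\<in>I. r (x i)))) (Pi\<^sub>E I A)
      = (\<Prod>i\<in>I. emeasure (density M (\<lambda>x. ennreal (r x))) (A i))" .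
  qed
qed

lemma likelihood_ratio_PiM:
  assumes "finite I"
  shows "likelihood_ratio (\<Pi>\<^sub>M i\<in>I. M) (\<lambda>x. \<Prod>i\<in>I. r (x i))"
proof -
  interpret P: product_sigma_finite "\<lambda>_. M"
    unfolding product_sigma_finite_def by (simp add: sigma_finite_measure_axioms)
  have "prob_space (\<Pi>\<^sub>M i\<in>I. M)" by (rule prob_space_PiM) (rule prob_space_axioms)
  moreover have "(\<integral>x. (\<Prod>i\<in>I. r (x i)) \<partial>(\<Pi>\<^sub>M i\<in>I. M)) = 1"
    using assms r_integrable r_integral by (subst P.product_integral_prod) auto
  moreover have "integrable (\<Pi>\<^sub>M i\<in>I. M) (\<lambda>x. (\<Prod>i\<in>I. r (x i))\<^sup>2)"
    unfolding prod_power_distrib using assms r_L2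
    by (intro P.product_integrable_prod) auto
  ultimately show ?thesis
    using assms r_nonneg
    by (auto simp: likelihood_ratio_def likelihood_ratio_axioms_def space_PiM intro!: prod_nonneg)
qed

text \<open>By independence the second moment of the product is \<open>(1 + chi2) ^ card I\<close>,
  and \<open>1 + y \<le> exp y\<close>. When one observation has divergence of order 1/n, the bound
  stays finite for samples of size n.\<close>

lemma chi2_PiM_le:
  assumes "finite I"
  shows "likelihood_ratio.chi2 (\<Pi>\<^sub>M i\<in>I. M) (\<lambda>x. \<Prod>i\<in>I. r (x i)) \<le> exp (card I * chi2) - 1"
proof -
  interpret P: product_sigma_finite "\<lambda>_. M"
    unfolding product_sigma_finite_def by (simp add: sigma_finite_measure_axioms)
  interpret L: likelihood_ratio "\<Pi>\<^sub>M i\<in>I. M" "\<lambda>x. \<Prod>i\<in>I. r (x i)"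
    by (rule likelihood_ratio_PiM[OF assms])
  have "1 + L.chi2 = (\<integral>x. (\<Prod>i\<in>I. (r (x i))\<^sup>2) \<partial>(\<Pi>\<^sub>M i\<in>I. M))"
    by (simp add: L.second_moment_eq[symmetric] prod_power_distrib)
  also have "\<dots> = (1 + chi2) ^ card I"
    using assms r_L2 by (subst P.product_integral_prod) (auto simp: second_moment_eq)
  also have "\<dots> \<le> exp chi2 ^ card I"
    using chi2_nonneg exp_ge_add_one_self[of chi2] by (intro power_mono) auto
  finally show ?thesis by (simp add: exp_of_nat_mult)
qed

end

section \<open>The mixture model and its paths\<close>

abbreviation unit_lborel :: "real measure" where
  "unit_lborel \<equiv> restrict_space lborel {0..1}"

lemma space_unit_lborel [simp]: "space unit_lborel = {0..1}"
  by (simp add: space_restrict_space)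

lemma prob_space_unit_lborel: "prob_space unit_lborel"
  by (rule prob_spaceI) (simp add: emeasure_restrict_space space_restrict_space)

interpretation unit_lborel: prob_space unit_lborel
  by (rule prob_space_unit_lborel)

lemma integral_unit_lborel: "(LBINT x:{0..1}. g x) = (\<integral>x. g x \<partial>unit_lborel)" for g :: "real \<Rightarrow> real"
  by (simp add: set_lebesgue_integral_def integral_restrict_space)

lemma integrable_bounded_square:
  assumes [measurable]: "g \<in> borel_measurable unit_lborel" and bound: "\<And>x. x \<in> {0..1} \<Longrightarrow> \<bar>g x\<bar> \<le> C"
  shows "integrable unit_lborel (\<lambda>x. (g x :: real)\<^sup>2)"
proof (rule unit_lborel.integrable_const_bound[where B = "C\<^sup>2"])
  show "AE x in unit_lborel. norm ((g x)\<^sup>2) \<le> C\<^sup>2"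
  proof (rule AE_I2)
    fix x assume "x \<in> space unit_lborel"
    then have "\<bar>g x\<bar> \<le> C" using bound by simp
    from power_mono[OF this, of 2] show "norm ((g x)\<^sup>2) \<le> C\<^sup>2" by simp
  qed
qed measurable

lemma sets_mix [measurable_cong]: "sets (mix \<theta> f) = sets unit_lborel"
  by (simp add: mix_def)

lemma space_mix [simp]: "space (mix \<theta> f) = {0..1}"
  by (simp add: mix_def)

lemma
  assumes "f \<in> dens_class \<delta>"
  shows dens_class_borel: "f \<in> borel_measurable unit_lborel"
    and dens_class_integrable: "integrable unit_lborel f"
    and dens_class_integral: "(\<integral>x. f x \<partial>unit_lborel) = 1"
    and dens_class_nonneg: "x \<in> {0..1} \<Longrightarrow> 0 \<le> f x"
    and dens_class_le: "x \<in> {0..1} \<Longrightarrow> f x \<le> f 0"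
    and dens_class_pos: "x \<in> {0..<1-\<delta>} \<Longrightarrow> 0 < f x"
    and dens_class_zero: "x \<in> {1-\<delta>..1} \<Longrightarrow> f x = 0"
    and dens_class_continuous: "continuous_on {0..1} f"
    and dens_class_antimono: "antimono_on {0..1} f"
proof -
  have f: "continuous_on {0..1} f" "antimono_on {0..1} f" "\<And>x. x \<in> {0..1} \<Longrightarrow> 0 \<le> f x"
    "(LBINT x:{0..1}. f x) = 1" "\<And>x. x \<in> {0..<1-\<delta>} \<Longrightarrow> 0 < f x" "\<And>x. x \<in> {1-\<delta>..1} \<Longrightarrow> f x = 0"
    using assms by (auto simp: dens_class_def)
  from f(1) have "f \<in> borel_measurable (restrict_space borel {0..1})"
    by (rule borel_measurable_continuous_on_restrict)
  then show "f \<in> borel_measurable unit_lborel"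
    by (simp cong: measurable_cong_sets add: sets_restrict_space)
  show "(\<integral>x. f x \<partial>unit_lborel) = 1" using f(4) by (simp add: integral_unit_lborel)
  then show "integrable unit_lborel f"
    using not_integrable_integral_eq by fastforce
  show "x \<in> {0..1} \<Longrightarrow> 0 \<le> f x" "x \<in> {0..<1-\<delta>} \<Longrightarrow> 0 < f x" "x \<in> {1-\<delta>..1} \<Longrightarrow> f x = 0"
    by (fact f)+
  show "x \<in> {0..1} \<Longrightarrow> f x \<le> f 0" using f(2) by (auto simp: monotone_on_def)
  show "continuous_on {0..1} f" "antimono_on {0..1} f" by (fact f)+
qed

lemma mix_dens_ge:
  assumes "f \<in> dens_class \<delta>" "\<theta> \<in> {0..1}" "x \<in> {0..1}"
  shows "\<theta> \<le> mix_dens \<theta> f x"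
  using dens_class_nonneg[OF assms(1,3)] assms(2) by (simp add: mix_dens_def)

lemma mix_dens_borel:
  assumes "f \<in> dens_class \<delta>"
  shows "mix_dens \<theta> f \<in> borel_measurable unit_lborel"
  using dens_class_measurable[OF assms] .

lemma mix_dens_integral:
  assumes "f \<in> dens_class \<delta>"
  shows "(\<integral>x. mix_dens \<theta> f x \<partial>unit_lborel) = 1"
  using dens_class_integrable[OF assms] dens_class_integral[OF assms] unit_lborel.prob_space
  by (simp add: mix_dens_def)

lemma mix_dens_integrable:
  assumes "f \<in> dens_class \<delta>"
  shows "integrable unit_lborel (mix_dens \<theta> f)"
  using mix_dens_integral[OF assms, of \<theta>] not_integrable_integral_eq by fastforce

lemma prob_space_mix:
  assumes "f \<in> dens_class \<delta>" "\<theta> \<in> {0..1}"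
  shows "prob_space (mix \<theta> f)"
proof (rule prob_spaceI)
  note [measurable] = mix_dens_borel[OF assms(1)]
  have nn: "0 \<le> mix_dens \<theta> f x" if "x \<in> {0..1}" for x
    using mix_dens_ge[OF assms that] assms(2) by simp
  have "emeasure (mix \<theta> f) (space (mix \<theta> f)) = (\<integral>\<^sup>+x. ennreal (mix_dens \<theta> f x) \<partial>unit_lborel)"
    unfolding mix_def space_density
    using sets.top[of unit_lborel] by (subst emeasure_density) (auto intro!: nn_integral_cong)
  also have "\<dots> = 1"
    using nn_integral_eq_integral[OF mix_dens_integrable[OF assms(1), of \<theta>] AE_I2] nn
      mix_dens_integral[OF assms(1), of \<theta>] by simp
  finally show "emeasure (mix \<theta> f) (space (mix \<theta> f)) = 1" .
qed

lemma
  assumes "f \<in> dens_class \<delta>" "\<theta> \<in> {0..1}" and g[measurable]: "g \<in> borel_measurable unit_lborel"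
  shows integral_mix: "(\<integral>x. g x \<partial>mix \<theta> f) = (\<integral>x. mix_dens \<theta> f x * (g x :: real) \<partial>unit_lborel)"
    and integrable_mix: "integrable (mix \<theta> f) g \<longleftrightarrow> integrable unit_lborel (\<lambda>x. mix_dens \<theta> f x * g x)"
proof -
  note [measurable] = mix_dens_borel[OF assms(1)]
  have nn: "0 \<le> mix_dens \<theta> f x" if "x \<in> {0..1}" for x
    using mix_dens_ge[OF assms(1,2) that] assms(2) by simp
  show "(\<integral>x. g x \<partial>mix \<theta> f) = (\<integral>x. mix_dens \<theta> f x * g x \<partial>unit_lborel)"
    unfolding mix_def using nn by (subst integral_density) auto
  show "integrable (mix \<theta> f) g \<longleftrightarrow> integrable unit_lborel (\<lambda>x. mix_dens \<theta> f x * g x)"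
    unfolding mix_def using nn by (subst integrable_density) auto
qed

lemma mix_eq_density:
  assumes f: "f \<in> dens_class \<delta>" and f': "f' \<in> dens_class \<delta>'" and "\<theta> \<in> {0<..1}" "\<theta>' \<in> {0..1}"
  shows "mix \<theta>' f' = density (mix \<theta> f) (\<lambda>x. ennreal (mix_dens \<theta>' f' x / mix_dens \<theta> f x))"
proof -
  note [measurable] = mix_dens_borel[OF f] mix_dens_borel[OF f']
  have p: "0 < mix_dens \<theta> f x" "0 \<le> mix_dens \<theta>' f' x" if "x \<in> {0..1}" for x
    using mix_dens_ge[OF f _ that, of \<theta>] mix_dens_ge[OF f' _ that, of \<theta>'] assms(3,4) by auto
  have "density (mix \<theta> f) (\<lambda>x. ennreal (mix_dens \<theta>' f' x / mix_dens \<theta> f x))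
      = density unit_lborel (\<lambda>x. ennreal (mix_dens \<theta> f x) * ennreal (mix_dens \<theta>' f' x / mix_dens \<theta> f x))"
    unfolding mix_def by (rule density_density_eq) measurable
  also have "\<dots> = mix \<theta>' f'"
    unfolding mix_def
  proof (rule density_cong)
    show "AE x in unit_lborel. ennreal (mix_dens \<theta> f x) * ennreal (mix_dens \<theta>' f' x / mix_dens \<theta> f x)
        = ennreal (mix_dens \<theta>' f' x)"
    proof (rule AE_I2)
      fix x assume "x \<in> space unit_lborel"
      then show "ennreal (mix_dens \<theta> f x) * ennreal (mix_dens \<theta>' f' x / mix_dens \<theta> f x)
        = ennreal (mix_dens \<theta>' f' x)"
        using p[of x] by (simp flip: ennreal_mult)
    qed
  qed measurable
  finally show ?thesis ..
qed

text \<open>The base density is at least \<open>\<theta> > 0\<close> and the other one at most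
  \<open>1 + f' 0\<close>, so the ratio is bounded and hence square integrable. The second part
  writes the divergence as a Lebesgue integral, the form to which dominated convergence is
  applied.\<close>

lemma mix_likelihood_ratio:
  assumes f: "f \<in> dens_class \<delta>" and f': "f' \<in> dens_class \<delta>'" and "\<theta> \<in> {0<..1}" "\<theta>' \<in> {0..1}"
  shows "likelihood_ratio (mix \<theta> f) (\<lambda>x. mix_dens \<theta>' f' x / mix_dens \<theta> f x)"
    and "likelihood_ratio.chi2 (mix \<theta> f) (\<lambda>x. mix_dens \<theta>' f' x / mix_dens \<theta> f x)
      = (\<integral>x. (mix_dens \<theta>' f' x - mix_dens \<theta> f x)\<^sup>2 / mix_dens \<theta> f x \<partial>unit_lborel)"
proof -
  note [measurable] = mix_dens_borel[OF f] mix_dens_borel[OF f']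
  have \<theta>: "\<theta> \<in> {0..1}" "0 < \<theta>" using assms(3) by auto
  have p: "0 < mix_dens \<theta> f x" "0 \<le> mix_dens \<theta>' f' x" "\<theta> \<le> mix_dens \<theta> f x" if "x \<in> {0..1}" for x
    using mix_dens_ge[OF f _ that, of \<theta>] mix_dens_ge[OF f' _ that, of \<theta>'] assms(3,4) by auto
  have b: "mix_dens \<theta>' f' x \<le> 1 + f' 0" if "x \<in> {0..1}" for x
  proof -
    have "(1 - \<theta>') * f' x \<le> 1 * f' x"
      using assms(4) dens_class_nonneg[OF f' that] by (intro mult_right_mono) auto
    then show ?thesis
      using dens_class_le[OF f' that] assms(4) by (simp add: mix_dens_def)
  qed
  show L: "likelihood_ratio (mix \<theta> f) (\<lambda>x. mix_dens \<theta>' f' x / mix_dens \<theta> f x)"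
    unfolding likelihood_ratio_def likelihood_ratio_axioms_def
  proof (intro conjI allI impI)
    interpret prob_space "mix \<theta> f" by (rule prob_space_mix[OF f \<theta>(1)])
    show "prob_space (mix \<theta> f)" by (rule prob_space_axioms)
    show "(\<lambda>x. mix_dens \<theta>' f' x / mix_dens \<theta> f x) \<in> borel_measurable (mix \<theta> f)" by measurable
    show "0 \<le> mix_dens \<theta>' f' x / mix_dens \<theta> f x" if "x \<in> space (mix \<theta> f)" for x
      using p[of x] that by simp
    have "(\<integral>x. mix_dens \<theta>' f' x / mix_dens \<theta> f x \<partial>mix \<theta> f) = (\<integral>x. mix_dens \<theta>' f' x \<partial>unit_lborel)"
      using p by (subst integral_mix[OF f \<theta>(1)])
        (auto intro!: Bochner_Integration.integral_cong simp: less_le)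
    then show "(\<integral>x. mix_dens \<theta>' f' x / mix_dens \<theta> f x \<partial>mix \<theta> f) = 1"
      by (simp add: mix_dens_integral[OF f'])
    show "integrable (mix \<theta> f) (\<lambda>x. (mix_dens \<theta>' f' x / mix_dens \<theta> f x)\<^sup>2)"
    proof (rule integrable_const_bound[where B = "((1 + f' 0) / \<theta>)\<^sup>2"])
      show "AE x in mix \<theta> f. norm ((mix_dens \<theta>' f' x / mix_dens \<theta> f x)\<^sup>2) \<le> ((1 + f' 0) / \<theta>)\<^sup>2"
      proof (rule AE_I2)
        fix x assume "x \<in> space (mix \<theta> f)"
        then have x: "x \<in> {0..1}" by simp
        have "(mix_dens \<theta>' f' x / mix_dens \<theta> f x)\<^sup>2 \<le> ((1 + f' 0) / \<theta>)\<^sup>2"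
          using p[OF x] b[OF x] \<theta>(2) by (intro power_mono frac_le) auto
        then show "norm ((mix_dens \<theta>' f' x / mix_dens \<theta> f x)\<^sup>2) \<le> ((1 + f' 0) / \<theta>)\<^sup>2" by simp
      qed
    qed measurable
  qed
  show "likelihood_ratio.chi2 (mix \<theta> f) (\<lambda>x. mix_dens \<theta>' f' x / mix_dens \<theta> f x)
      = (\<integral>x. (mix_dens \<theta>' f' x - mix_dens \<theta> f x)\<^sup>2 / mix_dens \<theta> f x \<partial>unit_lborel)"
    unfolding likelihood_ratio.chi2_def[OF L]
  proof (subst integral_mix[OF f \<theta>(1)])
    show "(\<integral>x. mix_dens \<theta> f x * (mix_dens \<theta>' f' x / mix_dens \<theta> f x - 1)\<^sup>2 \<partial>unit_lborel)
      = (\<integral>x. (mix_dens \<theta>' f' x - mix_dens \<theta> f x)\<^sup>2 / mix_dens \<theta> f x \<partial>unit_lborel)"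
    proof (rule Bochner_Integration.integral_cong[OF refl])
      fix x assume "x \<in> space unit_lborel"
      then have "mix_dens \<theta> f x \<noteq> 0" using p[of x] by auto
      then show "mix_dens \<theta> f x * (mix_dens \<theta>' f' x / mix_dens \<theta> f x - 1)\<^sup>2
          = (mix_dens \<theta>' f' x - mix_dens \<theta> f x)\<^sup>2 / mix_dens \<theta> f x"
        by (simp add: power2_eq_square field_simps)
    qed
  qed measurable
qed

section \<open>The tilting function \<open>kfun\<close>, which is \<open>1 + tanh\<close>\<close>

lemma kfun_pos: "0 < kfun u"
  by (simp add: kfun_def add_pos_pos)

lemma kfun_le: "kfun u \<le> 2"
  by (simp add: kfun_def divide_le_eq add_pos_pos)

lemma kfun_mono: "u \<le> v \<Longrightarrow> kfun u \<le> kfun v"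
  by (simp add: kfun_def frac_le add_pos_pos)

lemma kfun_0 [simp]: "kfun 0 = 1"
  by (simp add: kfun_def)

lemma kfun_deriv: "(kfun has_field_derivative 4 * exp (- 2 * u) / (1 + exp (- 2 * u))\<^sup>2) (at u)"
proof -
  have "1 + exp (- 2 * u) \<noteq> 0" using exp_gt_zero[of "- 2 * u"] by linarith
  then have "((\<lambda>u. 2 / (1 + exp (- 2 * u))) has_field_derivative
      4 * exp (- 2 * u) / (1 + exp (- 2 * u))\<^sup>2) (at u)"
    by (auto intro!: derivative_eq_intros simp: power2_eq_square)
  then show ?thesis by (simp add: kfun_def[abs_def])
qed

lemma continuous_on_kfun [continuous_intros]:
  "continuous_on S g \<Longrightarrow> continuous_on S (\<lambda>x. kfun (g x))"
  by (rule continuous_on_compose2[of UNIV kfun])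
    (auto intro!: DERIV_continuous_on DERIV_subset[OF kfun_deriv])

text \<open>The derivative is at most 1 because \<open>4 * y \<le> (1 + y)\<^sup>2\<close> for
  \<open>y = exp (- 2 * u)\<close>. This global bound controls a tilt by \<open>f * h0\<close> even
  where \<open>h0\<close> is unbounded.\<close>

lemma kfun_Lipschitz: "\<bar>kfun u - 1\<bar> \<le> \<bar>u\<bar>"
proof -
  have "norm (kfun u - kfun 0) \<le> 1 * norm (u - 0)"
  proof (rule field_differentiable_bound[where S = UNIV and f = kfun])
    show "(kfun has_field_derivative 4 * exp (- 2 * u) / (1 + exp (- 2 * u))\<^sup>2) (at u within UNIV)" for u
      using kfun_deriv by simp
    show "norm (4 * exp (- 2 * u) / (1 + exp (- 2 * u))\<^sup>2) \<le> 1" for u :: real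
    proof -
      have "4 * exp (- 2 * u) \<le> (1 + exp (- 2 * u))\<^sup>2"
        using zero_le_power2[of "1 - exp (- 2 * u)"]
        by (simp add: power2_eq_square algebra_simps)
      moreover have "0 < (1 + exp (- 2 * u))\<^sup>2"
        using exp_gt_zero[of "- 2 * u"] by (intro zero_less_power) linarith
      ultimately show ?thesis by (simp add: divide_le_eq)
    qed
  qed auto
  then show ?thesis by simp
qed

text \<open>The derivative of \<open>kfun\<close> at 0 is \<open>4 / (1 + 1)\<^sup>2 = 1\<close>, so
  \<open>h0\<close> itself is the first-order effect of the tilt at time
  \<open>1 / sqrt n\<close>.\<close>

lemma kfun_difference_quotient:
  "(\<lambda>n. sqrt n * (kfun (1 / sqrt (real n) * b) - 1)) \<longlonglongrightarrow> b"
proof -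
  have "((\<lambda>t. kfun (t * b)) has_field_derivative 1 * b) (at 0)"
    by (rule DERIV_chain2[where f = kfun]) (use kfun_deriv[of 0] in \<open>auto intro!: derivative_eq_intros\<close>)
  then have D: "(\<lambda>h. (kfun (h * b) - 1) / h) \<midarrow>0\<rightarrow> b"
    by (simp add: DERIV_def)
  have "filterlim (\<lambda>n. 1 / sqrt (real n)) (at 0) sequentially"
    unfolding filterlim_at
    by (auto intro!: eventually_sequentiallyI[of 1] tendsto_divide_0 sqrt_at_top[THEN filterlim_compose]
        filterlim_at_top_imp_at_infinity filterlim_real_sequentially)
  from filterlim_compose[OF D this] show ?thesis
    by (simp add: field_simps)
qed

lemma measurable_kfun [measurable]: "kfun \<in> borel_measurable borel"
  by (intro borel_measurable_continuous_onI) (auto intro!: continuous_intros)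

locale mixture_model =
  fixes \<delta> \<theta> :: real and f :: "real \<Rightarrow> real"
  assumes delta: "\<delta> \<in> {0..<1}" and theta: "\<theta> \<in> {0<..<1}" and f_dens: "f \<in> dens_class \<delta>"
begin

abbreviation P :: "real measure" where "P \<equiv> mix \<theta> f"

abbreviation p :: "real \<Rightarrow> real" where "p \<equiv> mix_dens \<theta> f"

abbreviation path_set :: "(real \<times> (real \<Rightarrow> real)) set" where "path_set \<equiv> paths \<delta> \<theta> f"

abbreviation score :: "real \<times> (real \<Rightarrow> real) \<Rightarrow> real \<Rightarrow> real" where "score \<equiv> path_score \<delta> \<theta> f"

text \<open>The score contains \<open>h0\<close> only through \<open>f * h0\<close>. This product is
  square integrable for every path, whereas \<open>h0\<close> may diverge at the right end of
  \<open>[0,1-\<delta>)\<close>.\<close>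

definition tilt :: "(real \<Rightarrow> real) \<Rightarrow> real \<Rightarrow> real" where
  "tilt h0 x = (if x < 1 - \<delta> then f x * h0 x else 0)"

definition path_dens :: "real \<times> (real \<Rightarrow> real) \<Rightarrow> nat \<Rightarrow> real \<Rightarrow> real" where
  "path_dens g n = mix_dens (\<theta> + 1 / sqrt n * fst g) (f_path \<delta> f (snd g) (1 / sqrt n))"

lemmas f_borel [measurable] = dens_class_borel[OF f_dens]
lemmas f_integrable = dens_class_integrable[OF f_dens]
lemmas f_integral = dens_class_integral[OF f_dens]
lemmas f_nonneg = dens_class_nonneg[OF f_dens]
lemmas f_le = dens_class_le[OF f_dens]
lemmas f_pos = dens_class_pos[OF f_dens]
lemmas f_zero = dens_class_zero[OF f_dens]
lemmas p_borel [measurable] = mix_dens_borel[OF f_dens]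

lemma theta01: "\<theta> \<in> {0..1}" "\<theta> \<in> {0<..1}" using theta by auto

lemma p_ge: "x \<in> {0..1} \<Longrightarrow> \<theta> \<le> p x"
  by (rule mix_dens_ge[OF f_dens theta01(1)])

lemma p_pos: "x \<in> {0..1} \<Longrightarrow> 0 < p x"
  using p_ge[of x] theta by auto

lemma p_le: "x \<in> {0..1} \<Longrightarrow> p x \<le> 1 + f 0"
proof -
  assume x: "x \<in> {0..1}"
  have "(1 - \<theta>) * f x \<le> 1 * f x" using theta f_nonneg[OF x] by (intro mult_right_mono) auto
  then show ?thesis using f_le[OF x] theta by (simp add: mix_dens_def)
qed

lemma set_integral_eq:
  "(LBINT x:{0..<1-\<delta>}. g x) = (\<integral>x. (if x < 1 - \<delta> then g x else 0) \<partial>unit_lborel)"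
  for g :: "real \<Rightarrow> real"
proof -
  have "(\<integral>x. (if x < 1 - \<delta> then g x else 0) \<partial>unit_lborel)
      = (\<integral>x. indicator {0..1} x *\<^sub>R (if x < 1 - \<delta> then g x else 0) \<partial>lborel)"
    by (rule integral_restrict_space) simp
  also have "\<dots> = (LBINT x:{0..<1-\<delta>}. g x)"
    unfolding set_lebesgue_integral_def using delta
    by (intro Bochner_Integration.integral_cong) (auto split: split_indicator)
  finally show ?thesis ..
qed

lemma score_f_eq: "score_f \<delta> \<theta> f h0 x = (1 - \<theta>) * tilt h0 x / p x"
  by (simp add: score_f_def tilt_def)

lemma path_score_eq: "score g x = (fst g * (1 - f x) + (1 - \<theta>) * tilt (snd g) x) / p x"
  by (simp add: path_score_def score_f_eq score_theta_def add_divide_distrib)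

text \<open>Since \<open>(1 - \<theta>) * tilt h0 = p * score_f\<close> on \<open>[0,1]\<close> and
  \<open>p\<close> is bounded by \<open>1 + f 0\<close>, measurability and square integrability pass
  from the score under \<open>P\<close> to \<open>tilt h0\<close> under Lebesgue measure.\<close>

lemma
  assumes "(a, h0) \<in> path_set"
  shows tilt_borel: "tilt h0 \<in> borel_measurable unit_lborel"
    and tilt_L2: "integrable unit_lborel (\<lambda>x. (tilt h0 x)\<^sup>2)"
    and tilt_integrable: "integrable unit_lborel (tilt h0)"
    and tilt_integral: "(\<integral>x. tilt h0 x \<partial>unit_lborel) = 0"
    and path_continuous: "continuous_on {0..<1-\<delta>} h0"
    and path_antimono: "antimono_on {0..<1-\<delta>} h0"
proof -
  have h: "continuous_on {0..<1-\<delta>} h0" "antimono_on {0..<1-\<delta>} h0"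
    "(LBINT x:{0..<1-\<delta>}. f x * h0 x) = 0" "score_f \<delta> \<theta> f h0 \<in> L2 P"
    using assms by (auto simp: paths_def)
  show "continuous_on {0..<1-\<delta>} h0" "antimono_on {0..<1-\<delta>} h0" by (fact h)+
  have [measurable]: "score_f \<delta> \<theta> f h0 \<in> borel_measurable unit_lborel"
    using h(4) by (simp add: L2_def cong: measurable_cong_sets add: sets_mix)
  have eq: "score_f \<delta> \<theta> f h0 x * p x / (1 - \<theta>) = tilt h0 x" if "x \<in> {0..1}" for x
    using p_pos[OF that] theta by (simp add: score_f_eq)
  have "(\<lambda>x. score_f \<delta> \<theta> f h0 x * p x / (1 - \<theta>)) \<in> borel_measurable unit_lborel"
    by measurable
  then show tb[measurable]: "tilt h0 \<in> borel_measurable unit_lborel"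
    by (rule measurable_cong[THEN iffD1, rotated]) (use eq in auto)
  have "integrable unit_lborel (\<lambda>x. p x * (score_f \<delta> \<theta> f h0 x)\<^sup>2)"
    using h(4) integrable_mix[OF f_dens theta01(1), of "\<lambda>x. (score_f \<delta> \<theta> f h0 x)\<^sup>2"]
    by (simp add: L2_def)
  then have i: "integrable unit_lborel (\<lambda>x. (1 + f 0) / (1 - \<theta>)\<^sup>2 * (p x * (score_f \<delta> \<theta> f h0 x)\<^sup>2))"
    by simp
  show t2: "integrable unit_lborel (\<lambda>x. (tilt h0 x)\<^sup>2)"
  proof (rule Bochner_Integration.integrable_bound[OF i])
    show "AE x in unit_lborel. norm ((tilt h0 x)\<^sup>2)
        \<le> norm ((1 + f 0) / (1 - \<theta>)\<^sup>2 * (p x * (score_f \<delta> \<theta> f h0 x)\<^sup>2))"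
    proof (rule AE_I2)
      fix x assume "x \<in> space unit_lborel"
      then have x: "x \<in> {0..1}" by simp
      have "(tilt h0 x)\<^sup>2 = p x * (p x * (score_f \<delta> \<theta> f h0 x)\<^sup>2) / (1 - \<theta>)\<^sup>2"
        by (simp add: eq[OF x, symmetric] power2_eq_square)
      also have "\<dots> \<le> (1 + f 0) * (p x * (score_f \<delta> \<theta> f h0 x)\<^sup>2) / (1 - \<theta>)\<^sup>2"
        using p_le[OF x] p_pos[OF x] by (intro divide_right_mono mult_right_mono) auto
      finally have "(tilt h0 x)\<^sup>2 \<le> (1 + f 0) / (1 - \<theta>)\<^sup>2 * (p x * (score_f \<delta> \<theta> f h0 x)\<^sup>2)"
        by simp
      also note abs_ge_self
      finally show "norm ((tilt h0 x)\<^sup>2) \<le> norm ((1 + f 0) / (1 - \<theta>)\<^sup>2 * (p x * (score_f \<delta> \<theta> f h0 x)\<^sup>2))"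
        by simp
    qed
  qed measurable
  show "integrable unit_lborel (tilt h0)"
    by (rule unit_lborel.square_integrable_imp_integrable[OF _ t2]) simp
  show "(\<integral>x. tilt h0 x \<partial>unit_lborel) = 0"
    using h(3) by (simp add: set_integral_eq tilt_def[abs_def])
qed

text \<open>The way back from Lebesgue measure to \<open>P\<close>, now by the lower bound
  \<open>\<theta> \<le> p x\<close>.\<close>

lemma pathsI:
  assumes "continuous_on {0..<1-\<delta>} h0" "antimono_on {0..<1-\<delta>} h0"
    and [measurable]: "tilt h0 \<in> borel_measurable unit_lborel"
    and t2: "integrable unit_lborel (\<lambda>x. (tilt h0 x)\<^sup>2)"
    and "(\<integral>x. tilt h0 x \<partial>unit_lborel) = 0"
  shows "(a, h0) \<in> path_set"
proof -
  have m: "score_f \<delta> \<theta> f h0 \<in> borel_measurable unit_lborel"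
    unfolding score_f_eq[abs_def] by measurable
  from t2 have i: "integrable unit_lborel (\<lambda>x. (1 - \<theta>)\<^sup>2 / \<theta> * (tilt h0 x)\<^sup>2)" by simp
  have "integrable unit_lborel (\<lambda>x. p x * (score_f \<delta> \<theta> f h0 x)\<^sup>2)"
  proof (rule Bochner_Integration.integrable_bound[OF i])
    show "AE x in unit_lborel. norm (p x * (score_f \<delta> \<theta> f h0 x)\<^sup>2)
        \<le> norm ((1 - \<theta>)\<^sup>2 / \<theta> * (tilt h0 x)\<^sup>2)"
    proof (rule AE_I2)
      fix x assume "x \<in> space unit_lborel"
      then have x: "x \<in> {0..1}" by simp
      have "p x * (score_f \<delta> \<theta> f h0 x)\<^sup>2 = (1 - \<theta>)\<^sup>2 * (tilt h0 x)\<^sup>2 / p x"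
        using p_pos[OF x] by (simp add: score_f_eq power2_eq_square)
      also have "\<dots> \<le> (1 - \<theta>)\<^sup>2 * (tilt h0 x)\<^sup>2 / \<theta>"
        using p_ge[OF x] theta by (intro divide_left_mono) auto
      finally show "norm (p x * (score_f \<delta> \<theta> f h0 x)\<^sup>2) \<le> norm ((1 - \<theta>)\<^sup>2 / \<theta> * (tilt h0 x)\<^sup>2)"
        using p_pos[OF x] theta by simp
    qed
  qed (use m in measurable)
  then have "score_f \<delta> \<theta> f h0 \<in> L2 P"
    using m integrable_mix[OF f_dens theta01(1), of "\<lambda>x. (score_f \<delta> \<theta> f h0 x)\<^sup>2"]
    by (simp add: L2_def cong: measurable_cong_sets add: sets_mix)
  then show ?thesis
    using assms by (simp add: paths_def set_integral_eq tilt_def[abs_def])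
qed

text \<open>A negative factor would make \<open>h0\<close> increasing: the tangent set is a cone,
  and rescaling moves along a ray.\<close>

lemma paths_scale:
  assumes g: "(a, h0) \<in> path_set" and "0 \<le> c"
  shows "(c * a, \<lambda>x. c * h0 x) \<in> path_set"
proof -
  have t: "tilt (\<lambda>x. c * h0 x) = (\<lambda>x. c * tilt h0 x)" by (auto simp: tilt_def)
  note [measurable] = tilt_borel[OF g]
  show ?thesis
  proof (rule pathsI)
    show "continuous_on {0..<1-\<delta>} (\<lambda>x. c * h0 x)"
      using path_continuous[OF g] by (intro continuous_intros)
    show "antimono_on {0..<1-\<delta>} (\<lambda>x. c * h0 x)"
      using path_antimono[OF g] \<open>0 \<le> c\<close> by (auto simp: monotone_on_def intro!: mult_left_mono)
  qed (use tilt_L2[OF g] tilt_integral[OF g] in \<open>auto simp: t power_mult_distrib\<close>)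
qed

lemma path_score_scale:
  "score (c * a, \<lambda>x. c * h0 x) x = c * score (a, h0) x"
  by (simp add: path_score_eq tilt_def algebra_simps add_divide_distrib)

definition ktilt :: "(real \<Rightarrow> real) \<Rightarrow> real \<Rightarrow> real \<Rightarrow> real" where
  "ktilt h0 t x = (if x < 1 - \<delta> then kfun (t * h0 x) * f x else 0)"

lemma f_path_eq: "f_path \<delta> f h0 t x = ktilt h0 t x / (\<integral>u. ktilt h0 t u \<partial>unit_lborel)"
  by (simp add: f_path_def ktilt_def[abs_def] set_integral_eq)

lemma ktilt_bounds:
  assumes "x \<in> {0..1}"
  shows "0 \<le> ktilt h0 t x" "ktilt h0 t x \<le> 2 * f x" "\<bar>ktilt h0 t x - f x\<bar> \<le> \<bar>t\<bar> * \<bar>tilt h0 x\<bar>"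
proof -
  have "\<bar>kfun (t * h0 x) * f x - f x\<bar> = f x * \<bar>kfun (t * h0 x) - 1\<bar>"
    using f_nonneg[OF assms] abs_mult[of "f x" "kfun (t * h0 x) - 1"] by (simp add: algebra_simps)
  also have "\<dots> \<le> f x * \<bar>t * h0 x\<bar>"
    using f_nonneg[OF assms] by (intro mult_left_mono kfun_Lipschitz)
  finally show "\<bar>ktilt h0 t x - f x\<bar> \<le> \<bar>t\<bar> * \<bar>tilt h0 x\<bar>"
    using f_nonneg[OF assms] f_zero[of x] assms by (auto simp: ktilt_def tilt_def abs_mult mult_ac)
qed (use f_nonneg[OF assms] kfun_pos[of "t * h0 x"] kfun_le[of "t * h0 x"] in
      \<open>auto simp: ktilt_def mult_right_mono less_imp_le\<close>)

lemma
  assumes g: "(a, h0) \<in> path_set"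
  shows ktilt_borel: "ktilt h0 t \<in> borel_measurable unit_lborel"
    and ktilt_integrable: "integrable unit_lborel (ktilt h0 t)"
    and ktilt_integral_pos: "0 < (\<integral>x. ktilt h0 t x \<partial>unit_lborel)"
proof -
  note [measurable] = tilt_borel[OF g]
  \<comment> \<open>Measurability is known for \<open>tilt h0\<close> only. The quotient
    \<open>tilt h0 x / f x\<close> recovers \<open>h0 x\<close> where \<open>f\<close> is positive,
    and where \<open>f\<close> vanishes the outer factor \<open>f x\<close> makes the value
    0.\<close>
  have "(\<lambda>x. kfun (t * (tilt h0 x / f x)) * f x) \<in> borel_measurable unit_lborel"
    by measurable
  then show [measurable]: "ktilt h0 t \<in> borel_measurable unit_lborel"
  proof (rule measurable_cong[THEN iffD1, rotated])
    fix x assume "x \<in> space unit_lborel"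
    then show "kfun (t * (tilt h0 x / f x)) * f x = ktilt h0 t x"
      using f_pos[of x] f_zero[of x] by (cases "x < 1 - \<delta>") (auto simp: ktilt_def tilt_def)
  qed
  have "integrable unit_lborel (\<lambda>x. 2 * f x)" using f_integrable by simp
  then show i: "integrable unit_lborel (ktilt h0 t)"
  proof (rule Bochner_Integration.integrable_bound)
    show "AE x in unit_lborel. norm (ktilt h0 t x) \<le> norm (2 * f x)"
    proof (rule AE_I2)
      fix x assume "x \<in> space unit_lborel"
      then show "norm (ktilt h0 t x) \<le> norm (2 * f x)"
        using ktilt_bounds(1,2)[of x h0 t] by simp
    qed
  qed measurable
  have nn: "AE x in unit_lborel. 0 \<le> ktilt h0 t x" using ktilt_bounds(1) by (intro AE_I2) simp
  have "(\<integral>x. ktilt h0 t x \<partial>unit_lborel) \<noteq> 0"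
  proof
    assume "(\<integral>x. ktilt h0 t x \<partial>unit_lborel) = 0"
    then have "AE x in unit_lborel. ktilt h0 t x = 0"
      using integral_nonneg_eq_0_iff_AE[OF i nn] by simp
    then have "AE x in unit_lborel. f x = 0"
    proof (rule AE_mp, intro AE_I2 impI)
      fix x assume "x \<in> space unit_lborel" "ktilt h0 t x = 0"
      then show "f x = 0"
        using f_zero[of x] kfun_pos[of "t * h0 x"] by (auto simp: ktilt_def split: if_splits)
    qed
    then have "(\<integral>x. f x \<partial>unit_lborel) = 0" by (simp add: integral_eq_zero_AE)
    then show False using f_integral by simp
  qed
  moreover have "0 \<le> (\<integral>x. ktilt h0 t x \<partial>unit_lborel)"
    using nn by (rule integral_nonneg_AE)
  ultimately show "0 < (\<integral>x. ktilt h0 t x \<partial>unit_lborel)" by simp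
qed

lemma f_path_dens_class:
  assumes g: "(a, h0) \<in> path_set" and "0 \<le> t"
  shows "f_path \<delta> f h0 t \<in> dens_class \<delta>"
proof -
  define c where "c = (\<integral>u. ktilt h0 t u \<partial>unit_lborel)"
  have c: "0 < c" using ktilt_integral_pos[OF g] by (simp add: c_def)
  have F: "f_path \<delta> f h0 t x = ktilt h0 t x / c" for x by (simp add: f_path_eq c_def)
  have bound: "\<bar>f_path \<delta> f h0 t x\<bar> \<le> 2 * f x / c" if "x \<in> {0..1}" for x
    using ktilt_bounds[OF that, of h0 t] c by (simp add: F divide_right_mono)
  have "continuous_on {0..1} (f_path \<delta> f h0 t)"
    unfolding continuous_on_def
  proof
    fix x :: real assume x: "x \<in> {0..1}"
    show "(f_path \<delta> f h0 t \<longlongrightarrow> f_path \<delta> f h0 t x) (at x within {0..1})"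
    proof (cases "x < 1 - \<delta>")
      case True
      let ?G = "\<lambda>x. kfun (t * h0 x) * f x / c"
      have "{0..<1-\<delta>} \<subseteq> {0..1}" using delta by auto
      from continuous_on_subset[OF dens_class_continuous[OF f_dens] this]
      have "continuous_on {0..<1-\<delta>} ?G"
        using c path_continuous[OF g]
        by (intro continuous_intros) auto
      then have "(?G \<longlongrightarrow> ?G x) (at x within {0..<1-\<delta>})"
        using x True by (auto simp: continuous_on_def)
      moreover have "\<forall>\<^sub>F y in at x within {0..<1-\<delta>}. ?G y = f_path \<delta> f h0 t y"
        by (auto simp: eventually_at_filter F ktilt_def)
      moreover have "?G x = f_path \<delta> f h0 t x" using True by (simp add: F ktilt_def)
      ultimately have "(f_path \<delta> f h0 t \<longlongrightarrow> f_path \<delta> f h0 t x) (at x within {0..<1-\<delta>})"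
        using Lim_transform_eventually by fastforce
      moreover have "at x within {0..<1-\<delta>} = at x within {0..1}"
        using True delta by (intro at_within_nhd[of x "{..<1-\<delta>}"]) auto
      ultimately show ?thesis by simp
    next
      case False
      \<comment> \<open>From \<open>1-\<delta>\<close> on, continuity cannot come from
        \<open>h0\<close>, which may diverge there. As \<open>kfun\<close> is at most 2, the path
        density is squeezed between 0 and \<open>2 * f / c\<close>, which tends to 0.\<close>
      have "((\<lambda>y. 2 * f y / c) \<longlongrightarrow> 2 * f x / c) (at x within {0..1})"
        using dens_class_continuous[OF f_dens] x c by (auto simp: continuous_on_def intro!: tendsto_intros)
      then have "((\<lambda>y. 2 * f y / c) \<longlongrightarrow> 0) (at x within {0..1})"
        using f_zero[of x] x False by simp
      then have "(f_path \<delta> f h0 t \<longlongrightarrow> 0) (at x within {0..1})"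
        by (rule Lim_null_comparison[rotated]) (use bound in \<open>auto simp: eventually_at_filter\<close>)
      then show ?thesis using False by (simp add: F ktilt_def)
    qed
  qed
  moreover have "antimono_on {0..1} (f_path \<delta> f h0 t)"
  proof (rule monotone_onI)
    fix x y :: real assume x: "x \<in> {0..1}" and y: "y \<in> {0..1}" and "x \<le> y"
    show "f_path \<delta> f h0 t y \<le> f_path \<delta> f h0 t x"
    proof (cases "y < 1 - \<delta>")
      case True
      then have "h0 y \<le> h0 x"
        using path_antimono[OF g] x y \<open>x \<le> y\<close> by (auto simp: monotone_on_def)
      then have "kfun (t * h0 y) * f y \<le> kfun (t * h0 x) * f x"
        using dens_class_antimono[OF f_dens] x y \<open>x \<le> y\<close> f_nonneg[OF y] \<open>0 \<le> t\<close> kfun_pos[of "t * h0 x"]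
        by (intro mult_mono kfun_mono mult_left_mono) (auto simp: monotone_on_def)
      then show ?thesis using True \<open>x \<le> y\<close> c by (simp add: F ktilt_def divide_right_mono)
    next
      case False
      then show ?thesis using ktilt_bounds(1)[OF x, of h0 t] c by (simp add: F) (simp add: ktilt_def)
    qed
  qed
  moreover have "(LBINT x:{0..1}. f_path \<delta> f h0 t x) = 1"
    using c by (simp add: integral_unit_lborel F c_def[symmetric])
  moreover have "0 \<le> f_path \<delta> f h0 t x" if "x \<in> {0..1}" for x
    using c ktilt_bounds(1)[OF that, of h0 t] by (simp add: F)
  moreover have "0 < f_path \<delta> f h0 t x" if "x \<in> {0..<1-\<delta>}" for x
    using c kfun_pos f_pos[OF that] that by (simp add: F ktilt_def)
  moreover have "f_path \<delta> f h0 t x = 0" if "x \<in> {1-\<delta>..1}" for x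
    using that by (simp add: F ktilt_def)
  ultimately show ?thesis by (simp add: dens_class_def)
qed

end

section \<open>Asymptotics of the densities along a path\<close>

lemma inverse_sqrt_tendsto_0: "(\<lambda>n. 1 / sqrt (real n)) \<longlonglongrightarrow> 0"
  by (auto intro!: tendsto_divide_0 sqrt_at_top[THEN filterlim_compose]
      filterlim_at_top_imp_at_infinity filterlim_real_sequentially)

context mixture_model
begin

lemma eventually_theta_path:
  assumes "0 < e" shows "\<forall>\<^sub>F n in sequentially. \<bar>1 / sqrt (real n) * a\<bar> < e"
proof -
  have "(\<lambda>n. 1 / sqrt (real n) * a) \<longlonglongrightarrow> 0 * a"
    by (intro tendsto_intros inverse_sqrt_tendsto_0)
  then have "(\<lambda>n. 1 / sqrt (real n) * a) \<longlonglongrightarrow> 0" by simp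
  from tendstoD[OF this assms] show ?thesis by (simp add: dist_real_def)
qed

lemma eventually_theta_path_bounds:
  "\<forall>\<^sub>F n in sequentially. \<theta> / 2 \<le> \<theta> + 1 / sqrt n * a \<and> \<theta> + 1 / sqrt n * a \<in> {0<..1}"
proof -
  have "0 < min (\<theta> / 2) (1 - \<theta>)" using theta by auto
  from eventually_theta_path[OF this, of a] show ?thesis
  proof eventually_elim
    case (elim n)
    define y where "y = 1 / sqrt (real n) * a"
    have "\<bar>y\<bar> < \<theta> / 2" "\<bar>y\<bar> < 1 - \<theta>" using elim by (auto simp: y_def)
    then have "\<theta> / 2 \<le> \<theta> + y \<and> \<theta> + y \<in> {0<..1}" using theta by (auto simp: abs_less_iff)
    then show ?case by (simp only: y_def)
  qed
qed

lemma path_law_eq: "path_law \<delta> \<theta> f g (1 / sqrt (real n)) =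
    mix (\<theta> + 1 / sqrt (real n) * fst g) (f_path \<delta> f (snd g) (1 / sqrt (real n)))"
  by (simp add: path_law_def)

lemma eventually_psi_path_law:
  assumes "g \<in> path_set"
  shows "\<forall>\<^sub>F n in sequentially. psi (path_law \<delta> \<theta> f g (1 / sqrt n)) = \<theta> + fst g / sqrt n"
  using eventually_theta_path_bounds[of "fst g"]
proof eventually_elim
  case (elim n)
  then show ?case
    unfolding path_law_eq using f_path_dens_class[of "fst g" "snd g" "1 / sqrt (real n)"] assms delta
    by (subst psi_mix) auto
qed

lemma path_dens_borel:
  assumes "g \<in> path_set"
  shows "path_dens g n \<in> borel_measurable unit_lborel"
  unfolding path_dens_def
  by (intro mix_dens_borel[OF f_path_dens_class[of "fst g"]]) (use assms in auto)

text \<open>Keeps the denominators of the chi-square integrals away from 0, uniformly in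
  \<open>x\<close> and in large \<open>n\<close>.\<close>

lemma eventually_path_dens_ge:
  assumes "g \<in> path_set"
  shows "\<forall>\<^sub>F n in sequentially. \<forall>x\<in>{0..1}. \<theta> / 2 \<le> path_dens g n x"
  using eventually_theta_path_bounds[of "fst g"]
proof (eventually_elim, intro ballI)
  fix n x assume n: "\<theta> / 2 \<le> \<theta> + 1 / sqrt (real n) * fst g \<and> \<theta> + 1 / sqrt (real n) * fst g \<in> {0<..1}"
    and x: "x \<in> {0..1::real}"
  have "f_path \<delta> f (snd g) (1 / sqrt (real n)) \<in> dens_class \<delta>"
    using f_path_dens_class[of "fst g" "snd g"] assms by simp
  from mix_dens_ge[OF this _ x, of "\<theta> + 1 / sqrt (real n) * fst g"] n
  have "\<theta> + 1 / sqrt (real n) * fst g \<le> path_dens g n x"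
    unfolding path_dens_def by (simp del: mult_1 times_divide_eq_left)
  with n show "\<theta> / 2 \<le> path_dens g n x" by linarith
qed

text \<open>Differentiability of the path densities at rate \<open>1 / sqrt n\<close>, pointwise but
  with a square integrable envelope \<open>G\<close>. The envelope is what turns the pointwise
  limits into a limit of chi-square divergences.\<close>

lemma path_dens_expansion:
  assumes g: "g \<in> path_set"
  obtains G where "G \<in> borel_measurable unit_lborel" "integrable unit_lborel (\<lambda>x. (G x)\<^sup>2)"
    "\<forall>\<^sub>F n in sequentially. \<forall>x\<in>{0..1}. \<bar>sqrt n * (path_dens g n x - p x)\<bar> \<le> G x"
    "\<And>x. x \<in> {0..1} \<Longrightarrow> (\<lambda>n. sqrt n * (path_dens g n x - p x)) \<longlonglongrightarrow> score g x * p x"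
proof -
  obtain a h0 where g_eq: "g = (a, h0)" by (cases g)
  note g' = g[unfolded g_eq]
  note [measurable] = tilt_borel[OF g'] ktilt_borel[OF g']
  define t where "t n = 1 / sqrt (real n)" for n
  define c where "c n = (\<integral>x. ktilt h0 (t n) x \<partial>unit_lborel)" for n
  define F where "F n = f_path \<delta> f h0 (t n)" for n
  define W where "W = (\<integral>x. \<bar>tilt h0 x\<bar> \<partial>unit_lborel)"
  have W: "0 \<le> W" by (simp add: W_def)
  have f0: "0 \<le> f 0" using f_nonneg[of 0] by simp
  have kb: "\<bar>sqrt n * (ktilt h0 (t n) x - f x)\<bar> \<le> \<bar>tilt h0 x\<bar>" if "x \<in> {0..1}" for n :: nat and x
  proof (cases "n = 0")
    case False
    then have "sqrt n * \<bar>ktilt h0 (t n) x - f x\<bar> \<le> sqrt n * (t n * \<bar>tilt h0 x\<bar>)"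
      using ktilt_bounds(3)[OF that, of h0 "t n"] by (intro mult_left_mono) (auto simp: t_def)
    then show ?thesis using False by (simp add: t_def abs_mult)
  qed simp
  have kl: "(\<lambda>n. sqrt n * (ktilt h0 (t n) x - f x)) \<longlonglongrightarrow> tilt h0 x" if "x \<in> {0..1}" for x
  proof (cases "x < 1 - \<delta>")
    case True
    have "(\<lambda>n. f x * (sqrt n * (kfun (1 / sqrt (real n) * h0 x) - 1))) \<longlonglongrightarrow> f x * h0 x"
      by (intro tendsto_intros kfun_difference_quotient)
    then show ?thesis using True by (simp add: ktilt_def tilt_def t_def algebra_simps)
  next
    case False
    then show ?thesis using f_zero[of x] that by (simp add: ktilt_def tilt_def)
  qed
  have cq: "(\<integral>x. sqrt n * (ktilt h0 (t n) x - f x) \<partial>unit_lborel) = sqrt n * (c n - 1)" for n :: nat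
    using ktilt_integrable[OF g'] f_integrable f_integral by (simp add: c_def)
  \<comment> \<open>The tilt has mean 0, so the normalising constant \<open>c n\<close> differs from
    1 by \<open>o(1 / sqrt n)\<close> and leaves no trace in the score.\<close>
  have cl: "(\<lambda>n. sqrt n * (c n - 1)) \<longlonglongrightarrow> 0"
  proof -
    have "(\<lambda>n. \<integral>x. sqrt n * (ktilt h0 (t n) x - f x) \<partial>unit_lborel)
        \<longlonglongrightarrow> (\<integral>x. tilt h0 x \<partial>unit_lborel)"
      using kl kb tilt_integrable[OF g']
      by (intro integral_dominated_convergence[where w = "\<lambda>x. \<bar>tilt h0 x\<bar>"]) (auto intro!: AE_I2)
    then show ?thesis unfolding cq tilt_integral[OF g'] .
  qed
  have cb: "\<bar>sqrt n * (c n - 1)\<bar> \<le> W" for n :: nat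
  proof -
    have "\<bar>sqrt n * (c n - 1)\<bar> \<le> (\<integral>x. \<bar>sqrt n * (ktilt h0 (t n) x - f x)\<bar> \<partial>unit_lborel)"
      unfolding cq[symmetric] by (rule integral_abs_bound)
    also have "\<dots> \<le> W"
      unfolding W_def
    proof (rule integral_mono)
      show "integrable unit_lborel (\<lambda>x. \<bar>sqrt n * (ktilt h0 (t n) x - f x)\<bar>)"
        using ktilt_integrable[OF g'] f_integrable
        by (intro integrable_abs integrable_mult_right Bochner_Integration.integrable_diff)
      show "integrable unit_lborel (\<lambda>x. \<bar>tilt h0 x\<bar>)"
        using tilt_integrable[OF g'] by (rule integrable_abs)
    qed (use kb in simp)
    finally show ?thesis .
  qed
  have undo: "y \<longlonglongrightarrow> z" if "(\<lambda>n. sqrt (real n) * (y n - z)) \<longlonglongrightarrow> l" for y :: "nat \<Rightarrow> real" and z l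
  proof -
    have "(\<lambda>n. 1 / sqrt (real n) * (sqrt (real n) * (y n - z)) + z) \<longlonglongrightarrow> 0 * l + z"
      using that by (intro tendsto_intros inverse_sqrt_tendsto_0)
    then have "(\<lambda>n. 1 / sqrt (real n) * (sqrt (real n) * (y n - z)) + z) \<longlonglongrightarrow> z" by simp
    then show ?thesis
      by (rule Lim_transform_eventually) (rule eventually_sequentiallyI[of 1], simp)
  qed
  have c1: "c \<longlonglongrightarrow> 1" using undo[OF cl] by simp
  have c_half: "\<forall>\<^sub>F n in sequentially. 1 / 2 < c n"
    using c1 by (rule order_tendstoD) simp
  have Fq: "sqrt n * (F n x - f x) = (sqrt n * (ktilt h0 (t n) x - f x) - f x * (sqrt n * (c n - 1))) / c n"
    for n x
    using ktilt_integral_pos[OF g', of "t n"]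
    by (simp add: F_def f_path_eq c_def[symmetric] field_simps)
  have Fl: "(\<lambda>n. sqrt n * (F n x - f x)) \<longlonglongrightarrow> tilt h0 x" if "x \<in> {0..1}" for x
  proof -
    have "(\<lambda>n. (sqrt n * (ktilt h0 (t n) x - f x) - f x * (sqrt n * (c n - 1))) / c n)
        \<longlonglongrightarrow> (tilt h0 x - f x * 0) / 1"
      by (intro tendsto_intros kl that cl c1) simp
    then show ?thesis by (simp add: Fq)
  qed
  have Fb: "\<bar>sqrt n * (F n x - f x)\<bar> \<le> 2 * (\<bar>tilt h0 x\<bar> + f 0 * W)" "0 \<le> F n x" "F n x \<le> 4 * f 0"
    if "x \<in> {0..1}" "1 / 2 < c n" for n x
  proof -
    have "\<bar>f x * (sqrt n * (c n - 1))\<bar> \<le> f 0 * W"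
      unfolding abs_mult[of "f x"] using f_nonneg[OF that(1)] f_le[OF that(1)] cb[of n] f0
      by (intro mult_mono) auto
    then have "\<bar>sqrt n * (ktilt h0 (t n) x - f x) - f x * (sqrt n * (c n - 1))\<bar> \<le> \<bar>tilt h0 x\<bar> + f 0 * W"
      using kb[OF that(1), of n] by linarith
    then have "\<bar>sqrt n * (F n x - f x)\<bar> \<le> (\<bar>tilt h0 x\<bar> + f 0 * W) / (1 / 2)"
      unfolding Fq abs_divide using that(2) by (intro frac_le) auto
    then show "\<bar>sqrt n * (F n x - f x)\<bar> \<le> 2 * (\<bar>tilt h0 x\<bar> + f 0 * W)" by simp
    show "0 \<le> F n x" using ktilt_bounds(1)[OF that(1), of h0 "t n"] that(2)
      by (simp add: F_def f_path_eq c_def[symmetric])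
    have "ktilt h0 (t n) x \<le> 2 * f 0"
      using ktilt_bounds(2)[OF that(1), of h0 "t n"] f_le[OF that(1)] by simp
    then have "F n x \<le> 2 * f 0 / (1 / 2)"
      unfolding F_def f_path_eq c_def[symmetric]
      using that(2) f0 ktilt_bounds(1)[OF that(1), of h0 "t n"] by (intro frac_le) auto
    then show "F n x \<le> 4 * f 0" by simp
  qed
  have pq: "sqrt n * (path_dens g n x - p x) = a * (1 - F n x) + (1 - \<theta>) * (sqrt n * (F n x - f x))"
    if "n \<ge> 1" for n x
  proof -
    have "path_dens g n x - p x = t n * a * (1 - F n x) + (1 - \<theta>) * (F n x - f x)"
      by (simp add: path_dens_def mix_dens_def g_eq F_def t_def algebra_simps)
    then have "sqrt n * (path_dens g n x - p x)
        = (sqrt n * t n) * (a * (1 - F n x)) + (1 - \<theta>) * (sqrt n * (F n x - f x))"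
      by (simp only: distrib_left mult.assoc mult.left_commute)
    also have "sqrt n * t n = 1" using that by (simp add: t_def)
    finally show ?thesis by simp
  qed
  \<comment> \<open>Once \<open>c n > 1/2\<close>, dividing by \<open>c n\<close> at most doubles
    the increments and gives \<open>F n x \<le> 4 * f 0\<close>, hence
    \<open>\<bar>1 - F n x\<bar> \<le> 1 + 4 * f 0\<close>.\<close>
  define G where "G x = \<bar>a\<bar> * (1 + 4 * f 0) + 2 * (\<bar>tilt h0 x\<bar> + f 0 * W)" for x
  show thesis
  proof (rule that)
    show "G \<in> borel_measurable unit_lborel" unfolding G_def[abs_def] by measurable
    have "integrable unit_lborel (\<lambda>x. \<bar>tilt h0 x\<bar>)"
      using tilt_integrable[OF g'] by simp
    then have "integrable unit_lborel
      (\<lambda>x. (\<bar>a\<bar> * (1 + 4 * f 0) + 2 * f 0 * W)\<^sup>2 + (4 * (\<bar>a\<bar> * (1 + 4 * f 0) + 2 * f 0 * W)) * \<bar>tilt h0 x\<bar>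
        + 4 * (tilt h0 x)\<^sup>2)"
      using tilt_L2[OF g']
      by (intro Bochner_Integration.integrable_add integrable_mult_right) auto
    moreover have "(G x)\<^sup>2 = (\<bar>a\<bar> * (1 + 4 * f 0) + 2 * f 0 * W)\<^sup>2
        + (4 * (\<bar>a\<bar> * (1 + 4 * f 0) + 2 * f 0 * W)) * \<bar>tilt h0 x\<bar> + 4 * (tilt h0 x)\<^sup>2" for x
    proof -
      have "(A + 2 * (B + D))\<^sup>2 = (A + 2 * D)\<^sup>2 + 4 * (A + 2 * D) * B + 4 * B\<^sup>2" for A B D :: real
        by (simp add: power2_eq_square algebra_simps)
      from this[of "\<bar>a\<bar> * (1 + 4 * f 0)" "\<bar>tilt h0 x\<bar>" "f 0 * W"] show ?thesis
        by (simp add: G_def mult.assoc)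
    qed
    ultimately show "integrable unit_lborel (\<lambda>x. (G x)\<^sup>2)" by simp
    show "\<forall>\<^sub>F n in sequentially. \<forall>x\<in>{0..1}. \<bar>sqrt n * (path_dens g n x - p x)\<bar> \<le> G x"
      using c_half eventually_ge_at_top[of 1]
    proof (eventually_elim, intro ballI)
      fix n and x :: real assume n: "1 / 2 < c n" "1 \<le> n" and x: "x \<in> {0..1}"
      have "\<bar>a * (1 - F n x)\<bar> \<le> \<bar>a\<bar> * (1 + 4 * f 0)"
        unfolding abs_mult using Fb(2,3)[OF x n(1)] f0 by (intro mult_left_mono) auto
      moreover have "\<bar>(1 - \<theta>) * (sqrt n * (F n x - f x))\<bar> \<le> 1 * (2 * (\<bar>tilt h0 x\<bar> + f 0 * W))"
        unfolding abs_mult[of "1 - \<theta>"] using Fb(1)[OF x n(1)] theta by (intro mult_mono) auto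
      ultimately show "\<bar>sqrt n * (path_dens g n x - p x)\<bar> \<le> G x"
        unfolding pq[OF n(2)] G_def by linarith
    qed
    fix x :: real assume x: "x \<in> {0..1}"
    have "(\<lambda>n. a * (1 - F n x) + (1 - \<theta>) * (sqrt n * (F n x - f x)))
        \<longlonglongrightarrow> a * (1 - f x) + (1 - \<theta>) * tilt h0 x"
      by (intro tendsto_intros undo[OF Fl] Fl x)
    then have "(\<lambda>n. sqrt n * (path_dens g n x - p x)) \<longlonglongrightarrow> a * (1 - f x) + (1 - \<theta>) * tilt h0 x"
      by (rule Lim_transform_eventually) (rule eventually_sequentiallyI[of 1], simp add: pq)
    then show "(\<lambda>n. sqrt n * (path_dens g n x - p x)) \<longlonglongrightarrow> score g x * p x"
      using p_pos[OF x] by (simp add: path_score_eq g_eq)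
  qed
qed

lemma path_score_borel:
  assumes "g \<in> path_set"
  shows "score g \<in> borel_measurable unit_lborel"
proof -
  have "(fst g, snd g) \<in> path_set" using assms by simp
  note [measurable] = tilt_borel[OF this]
  show ?thesis unfolding path_score_eq[abs_def] by measurable
qed

text \<open>With the factor \<open>n\<close> absorbed into the square, the integrand is the squared
  difference of two rescaled increments from the common \<open>p\<close>, divided by a density
  tending to \<open>p\<close>; pointwise it tends to \<open>p\<close> times the squared difference
  of the scores.\<close>

lemma chi2_path_limit:
  assumes g1: "g1 \<in> path_set" and g2: "g2 \<in> path_set"
  shows "(\<lambda>n. n * (\<integral>x. (path_dens g1 n x - path_dens g2 n x)\<^sup>2 / path_dens g2 n x \<partial>unit_lborel))
    \<longlonglongrightarrow> (\<integral>x. (score g1 x - score g2 x)\<^sup>2 \<partial>P)"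
proof -
  let ?s1 = "score g1" and ?s2 = "score g2"
  note [measurable] = path_score_borel[OF g1] path_score_borel[OF g2] path_dens_borel[OF g1] path_dens_borel[OF g2]
  obtain G1 where G1[measurable]: "G1 \<in> borel_measurable unit_lborel"
    and G1i: "integrable unit_lborel (\<lambda>x. (G1 x)\<^sup>2)"
    and G1b: "\<forall>\<^sub>F n in sequentially. \<forall>x\<in>{0..1}. \<bar>sqrt n * (path_dens g1 n x - p x)\<bar> \<le> G1 x"
    and G1l: "\<And>x. x \<in> {0..1} \<Longrightarrow> (\<lambda>n. sqrt n * (path_dens g1 n x - p x)) \<longlonglongrightarrow> ?s1 x * p x"
    by (rule path_dens_expansion[OF g1]) (rule that, assumption+)
  obtain G2 where G2[measurable]: "G2 \<in> borel_measurable unit_lborel"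
    and G2i: "integrable unit_lborel (\<lambda>x. (G2 x)\<^sup>2)"
    and G2b: "\<forall>\<^sub>F n in sequentially. \<forall>x\<in>{0..1}. \<bar>sqrt n * (path_dens g2 n x - p x)\<bar> \<le> G2 x"
    and G2l: "\<And>x. x \<in> {0..1} \<Longrightarrow> (\<lambda>n. sqrt n * (path_dens g2 n x - p x)) \<longlonglongrightarrow> ?s2 x * p x"
    by (rule path_dens_expansion[OF g2]) (rule that, assumption+)
  define q where "q n x = n * ((path_dens g1 n x - path_dens g2 n x)\<^sup>2 / path_dens g2 n x)" for n :: nat and x
  have q_eq: "q n x = (sqrt n * (path_dens g1 n x - p x) - sqrt n * (path_dens g2 n x - p x))\<^sup>2 / path_dens g2 n x"
    for n x
  proof -
    have "sqrt n * (path_dens g1 n x - p x) - sqrt n * (path_dens g2 n x - p x)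
        = sqrt n * (path_dens g1 n x - path_dens g2 n x)"
      by (simp add: algebra_simps)
    then show ?thesis by (simp add: q_def power_mult_distrib)
  qed
  \<comment> \<open>From \<open>(u - v)\<^sup>2 \<le> 2 * (u\<^sup>2 + v\<^sup>2)\<close> and a
    denominator of at least \<open>\<theta> / 2\<close>.\<close>
  define H where "H x = 4 / \<theta> * ((G1 x)\<^sup>2 + (G2 x)\<^sup>2)" for x
  have Hi: "integrable unit_lborel H" unfolding H_def[abs_def] using G1i G2i by simp
  have [measurable]: "H \<in> borel_measurable unit_lborel" "q n \<in> borel_measurable unit_lborel" for n
    unfolding H_def[abs_def] q_def[abs_def] by measurable
  have "\<forall>\<^sub>F n in sequentially. \<forall>x\<in>{0..1}. \<bar>q n x\<bar> \<le> H x"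
    using G1b G2b eventually_path_dens_ge[OF g2]
  proof (eventually_elim, intro ballI)
    fix n and x :: real
    assume n: "\<forall>x\<in>{0..1}. \<bar>sqrt n * (path_dens g1 n x - p x)\<bar> \<le> G1 x"
      "\<forall>x\<in>{0..1}. \<bar>sqrt n * (path_dens g2 n x - p x)\<bar> \<le> G2 x"
      "\<forall>x\<in>{0..1}. \<theta> / 2 \<le> path_dens g2 n x" and x: "x \<in> {0..1}"
    let ?u = "sqrt n * (path_dens g1 n x - p x)" and ?v = "sqrt n * (path_dens g2 n x - p x)"
    have "u\<^sup>2 \<le> A \<Longrightarrow> v\<^sup>2 \<le> B \<Longrightarrow> (u - v)\<^sup>2 \<le> 2 * (A + B)" for u v A B :: real
      using zero_le_power2[of "u + v"] by (simp add: power2_sum power2_diff)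
    moreover have "?u\<^sup>2 \<le> (G1 x)\<^sup>2" "?v\<^sup>2 \<le> (G2 x)\<^sup>2"
      using n(1,2) x unfolding abs_le_square_iff[symmetric] by (auto intro: order_trans[OF _ abs_ge_self])
    ultimately have "(?u - ?v)\<^sup>2 \<le> 2 * ((G1 x)\<^sup>2 + (G2 x)\<^sup>2)" by blast
    then have "(?u - ?v)\<^sup>2 / path_dens g2 n x \<le> 2 * ((G1 x)\<^sup>2 + (G2 x)\<^sup>2) / (\<theta> / 2)"
      using n(3) x theta by (intro frac_le) auto
    moreover have "0 \<le> (?u - ?v)\<^sup>2 / path_dens g2 n x"
      using n(3) x theta by (intro divide_nonneg_nonneg) (auto intro: order_trans[of _ "\<theta> / 2"])
    ultimately show "\<bar>q n x\<bar> \<le> H x" by (simp add: q_eq H_def)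
  qed
  then obtain N where N: "\<And>n x. n \<ge> N \<Longrightarrow> x \<in> {0..1} \<Longrightarrow> \<bar>q n x\<bar> \<le> H x"
    unfolding eventually_sequentially by blast
  have ql: "(\<lambda>n. q n x) \<longlonglongrightarrow> p x * (?s1 x - ?s2 x)\<^sup>2" if x: "x \<in> {0..1}" for x
  proof -
    have "(\<lambda>n. 1 / sqrt (real n) * (sqrt n * (path_dens g2 n x - p x)) + p x) \<longlonglongrightarrow> 0 * (?s2 x * p x) + p x"
      using x by (intro tendsto_intros inverse_sqrt_tendsto_0 G2l)
    then have "(\<lambda>n. 1 / sqrt (real n) * (sqrt n * (path_dens g2 n x - p x)) + p x) \<longlonglongrightarrow> p x" by simp
    then have "(\<lambda>n. path_dens g2 n x) \<longlonglongrightarrow> p x"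
      by (rule Lim_transform_eventually) (rule eventually_sequentiallyI[of 1], simp)
    then have "(\<lambda>n. q n x) \<longlonglongrightarrow> (?s1 x * p x - ?s2 x * p x)\<^sup>2 / p x"
      unfolding q_eq using p_pos[OF x] x by (intro tendsto_intros G1l G2l) auto
    moreover have "(?s1 x * p x - ?s2 x * p x)\<^sup>2 / p x = p x * (?s1 x - ?s2 x)\<^sup>2"
      using p_pos[OF x] by (simp add: power2_eq_square field_simps)
    ultimately show ?thesis by simp
  qed
  \<comment> \<open>Domination by \<open>H\<close> holds from \<open>N\<close> on, while the
    convergence theorem asks for every index; hence the shift.\<close>
  have "(\<lambda>n. \<integral>x. q (n + N) x \<partial>unit_lborel) \<longlonglongrightarrow> (\<integral>x. p x * (?s1 x - ?s2 x)\<^sup>2 \<partial>unit_lborel)"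
  proof (rule integral_dominated_convergence[where w = H])
    show "AE x in unit_lborel. (\<lambda>n. q (n + N) x) \<longlonglongrightarrow> p x * (?s1 x - ?s2 x)\<^sup>2"
      using ql by (intro AE_I2 LIMSEQ_ignore_initial_segment) auto
    show "AE x in unit_lborel. norm (q (n + N) x) \<le> H x" for n
      using N by (intro AE_I2) auto
  qed (use Hi in measurable)
  then have "(\<lambda>n. \<integral>x. q n x \<partial>unit_lborel) \<longlonglongrightarrow> (\<integral>x. p x * (?s1 x - ?s2 x)\<^sup>2 \<partial>unit_lborel)"
    by (rule LIMSEQ_offset)
  moreover have "(\<integral>x. p x * (?s1 x - ?s2 x)\<^sup>2 \<partial>unit_lborel) = (\<integral>x. (?s1 x - ?s2 x)\<^sup>2 \<partial>P)"
    by (rule integral_mix[OF f_dens theta01(1), symmetric]) measurable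
  ultimately show ?thesis
    unfolding q_def integral_mult_right_zero by simp
qed

end

section \<open>The local minimax bound\<close>

lemma estimator_measurable:
  assumes "estimator_seq T"
  shows "T n \<in> borel_measurable (sample_law n (mix \<theta> f))"
proof -
  have "sets (mix \<theta> f) = sets (restrict_space borel {0..1})"
    by (simp add: sets_mix sets_restrict_space)
  then have "sets (sample_law n (mix \<theta> f)) = sets (\<Pi>\<^sub>M i\<in>{..<n}. restrict_space borel {0..1::real})"
    unfolding sample_law_def by (intro sets_PiM_cong) auto
  then show ?thesis
    using assms by (simp add: estimator_seq_def cong: measurable_cong_sets)
qed

context mixture_model
begin

abbreviation P_n :: "nat \<Rightarrow> (nat \<Rightarrow> real) measure" where
  "P_n n \<equiv> sample_law n P"

abbreviation path_sample :: "real \<times> (real \<Rightarrow> real) \<Rightarrow> nat \<Rightarrow> (nat \<Rightarrow> real) measure" where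
  "path_sample g n \<equiv> sample_law n (path_law \<delta> \<theta> f g (1 / sqrt n))"

definition path_ratio ::
    "real \<times> (real \<Rightarrow> real) \<Rightarrow> real \<times> (real \<Rightarrow> real) \<Rightarrow> nat \<Rightarrow> (nat \<Rightarrow> real) \<Rightarrow> real" where
  "path_ratio g1 g2 n x = (\<Prod>i<n. path_dens g1 n (x i) / path_dens g2 n (x i))"

text \<open>The constant path, with law \<open>P\<close> at every time and score 0. Comparisons of
  two paths thereby include the comparison of a path with \<open>P\<close>.\<close>

definition base_path :: "real \<times> (real \<Rightarrow> real)" where
  "base_path = (0, \<lambda>_. 0)"

lemma base_path_in: "base_path \<in> path_set"
proof -
  have t: "tilt (\<lambda>_. 0) = (\<lambda>_. 0)" by (auto simp: tilt_def)
  show ?thesis unfolding base_path_def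
    by (rule pathsI) (auto simp: t monotone_on_def)
qed

lemma path_score_base: "score base_path x = 0"
  by (simp add: base_path_def path_score_eq tilt_def)

lemma path_law_base: "path_law \<delta> \<theta> f base_path t = P"
proof -
  have "ktilt (\<lambda>_. 0) t x = f x" if "x \<in> {0..1}" for x
    using f_zero[of x] that by (auto simp: ktilt_def)
  moreover from this have "(\<integral>x. ktilt (\<lambda>_. 0) t x \<partial>unit_lborel) = (\<integral>x. f x \<partial>unit_lborel)"
    by (intro Bochner_Integration.integral_cong) auto
  ultimately have "f_path \<delta> f (\<lambda>_. 0) t x = f x" if "x \<in> {0..1}" for x
    using that by (simp add: f_path_eq f_integral)
  moreover have "mix \<theta> (f_path \<delta> f (\<lambda>_. 0) t) = P" if "\<And>x. x \<in> {0..1} \<Longrightarrow> f_path \<delta> f (\<lambda>_. 0) t x = f x"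
  proof -
    have [measurable]: "mix_dens \<theta> (f_path \<delta> f (\<lambda>_. 0) t) \<in> borel_measurable unit_lborel"
      by (rule measurable_cong[THEN iffD1, OF _ p_borel]) (use that in \<open>simp add: mix_dens_def\<close>)
    show ?thesis
      unfolding mix_def
    proof (rule density_cong)
      show "AE x in unit_lborel. ennreal (mix_dens \<theta> (f_path \<delta> f (\<lambda>_. 0) t) x) = ennreal (p x)"
        using that by (intro AE_I2) (simp add: mix_dens_def)
    qed measurable
  qed
  ultimately show ?thesis by (simp add: path_law_def base_path_def)
qed

lemma eventually_prob_space_path_sample:
  assumes "g \<in> path_set"
  shows "\<forall>\<^sub>F n in sequentially. prob_space (path_sample g n)"
  using eventually_theta_path_bounds[of "fst g"]
proof eventually_elim
  case (elim n)
  then have "prob_space (path_law \<delta> \<theta> f g (1 / sqrt (real n)))"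
    unfolding path_law_eq using f_path_dens_class[of "fst g" "snd g" "1 / sqrt (real n)"] assms
    by (intro prob_space_mix) auto
  then show ?case unfolding sample_law_def by (intro prob_space_PiM) auto
qed

lemma path_f_dens_class:
  assumes "g \<in> path_set"
  shows "f_path \<delta> f (snd g) (1 / sqrt (real n)) \<in> dens_class \<delta>"
  using f_path_dens_class[of "fst g" "snd g" "1 / sqrt (real n)"] assms by simp

text \<open>One observation has divergence about \<open>d / n\<close>, where \<open>d\<close> is the
  squared distance of the scores; tensorisation turns \<open>n\<close> observations into at most
  about \<open>exp d - 1\<close>. Here \<open>K n\<close> is \<open>n\<close> times the divergence
  of one observation.\<close>

lemma path_likelihood_ratio:
  assumes g1: "g1 \<in> path_set" and g2: "g2 \<in> path_set"
  obtains K where "K \<longlonglongrightarrow> (\<integral>x. (score g1 x - score g2 x)\<^sup>2 \<partial>P)"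
    and "\<forall>\<^sub>F n in sequentially. likelihood_ratio (path_sample g2 n) (path_ratio g1 g2 n) \<and>
      path_sample g1 n = density (path_sample g2 n) (\<lambda>x. ennreal (path_ratio g1 g2 n x)) \<and>
      likelihood_ratio.chi2 (path_sample g2 n) (path_ratio g1 g2 n) \<le> exp (K n) - 1"
proof
  show "(\<lambda>n. n * (\<integral>x. (path_dens g1 n x - path_dens g2 n x)\<^sup>2 / path_dens g2 n x \<partial>unit_lborel))
    \<longlonglongrightarrow> (\<integral>x. (score g1 x - score g2 x)\<^sup>2 \<partial>P)"
    by (rule chi2_path_limit[OF g1 g2])
  show "\<forall>\<^sub>F n in sequentially. likelihood_ratio (path_sample g2 n) (path_ratio g1 g2 n) \<and>
      path_sample g1 n = density (path_sample g2 n) (\<lambda>x. ennreal (path_ratio g1 g2 n x)) \<and>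
      likelihood_ratio.chi2 (path_sample g2 n) (path_ratio g1 g2 n)
      \<le> exp (n * (\<integral>x. (path_dens g1 n x - path_dens g2 n x)\<^sup>2 / path_dens g2 n x \<partial>unit_lborel)) - 1"
    using eventually_theta_path_bounds[of "fst g1"] eventually_theta_path_bounds[of "fst g2"]
  proof eventually_elim
    case (elim n)
    let ?t = "1 / sqrt (real n)"
    have F: "f_path \<delta> f (snd g1) ?t \<in> dens_class \<delta>" "f_path \<delta> f (snd g2) ?t \<in> dens_class \<delta>"
      by (rule path_f_dens_class, fact)+
    have \<theta>: "\<theta> + ?t * fst g1 \<in> {0..1}" "\<theta> + ?t * fst g2 \<in> {0<..1}" using elim by auto
    interpret L: likelihood_ratio "path_law \<delta> \<theta> f g2 ?t" "\<lambda>x. path_dens g1 n x / path_dens g2 n x"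
      unfolding path_law_eq path_dens_def by (rule mix_likelihood_ratio(1)[OF F(2,1) \<theta>(2,1)])
    have "path_law \<delta> \<theta> f g1 ?t = density (path_law \<delta> \<theta> f g2 ?t) (\<lambda>x. ennreal (path_dens g1 n x / path_dens g2 n x))"
      unfolding path_law_eq path_dens_def by (rule mix_eq_density[OF F(2,1) \<theta>(2,1)])
    moreover have "L.chi2 = (\<integral>x. (path_dens g1 n x - path_dens g2 n x)\<^sup>2 / path_dens g2 n x \<partial>unit_lborel)"
      unfolding path_law_eq path_dens_def by (rule mix_likelihood_ratio(2)[OF F(2,1) \<theta>(2,1)])
    moreover have "path_ratio g1 g2 n = (\<lambda>x. \<Prod>i<n. path_dens g1 n (x i) / path_dens g2 n (x i))"
      by (simp add: path_ratio_def fun_eq_iff)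
    ultimately show ?case
      using L.likelihood_ratio_PiM[of "{..<n}"] L.chi2_PiM_le[of "{..<n}"] L.PiM_density[of "{..<n}"]
      by (simp add: sample_law_def)
  qed
qed

end

lemma (in prob_space) abs_mean_le_L2:
  fixes X :: "'a \<Rightarrow> real"
  assumes "X \<in> borel_measurable M" "integrable M (\<lambda>x. (X x)\<^sup>2)"
  shows "\<bar>\<integral>x. X x \<partial>M\<bar> \<le> sqrt (\<integral>x. (X x)\<^sup>2 \<partial>M)"
  using Cauchy_Schwarz_integral[of X M "\<lambda>_. 1"] assms by (simp add: prob_space)

lemma nn_integral_square_le:
  assumes [measurable]: "X \<in> borel_measurable M" and "0 \<le> r"
    and le: "(\<integral>\<^sup>+x. ennreal ((X x)\<^sup>2) \<partial>M) \<le> ennreal r"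
  shows "integrable M (\<lambda>x. (X x :: real)\<^sup>2)" "(\<integral>x. (X x)\<^sup>2 \<partial>M) \<le> r"
proof -
  have "(\<integral>\<^sup>+x. ennreal ((X x)\<^sup>2) \<partial>M) < \<infinity>"
    using le by (rule le_less_trans) simp
  then show i: "integrable M (\<lambda>x. (X x)\<^sup>2)"
    by (intro integrableI_nonneg) auto
  show "(\<integral>x. (X x)\<^sup>2 \<partial>M) \<le> r"
    using le \<open>0 \<le> r\<close> nn_integral_eq_integral[OF i] by simp
qed

context mixture_model
begin

text \<open>If every grid point had risk below \<open>r\<close>, each of the \<open>m\<close> steps
  would move the mean of the rescaled estimator by at most about
  \<open>sqrt r * sqrt (exp (s\<^sup>2 * I) - 1)\<close>, with \<open>I\<close> the squared norm of
  the score. The mean has to follow the target over the distance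
  \<open>m * s * \<bar>a\<bar>\<close>, up to a bias of \<open>sqrt r\<close> at either end; the
  last hypothesis says that the steps fall short of this.\<close>

lemma minimax_step:
  fixes a s r :: real and h0 :: "real \<Rightarrow> real" and T :: "nat \<Rightarrow> (nat \<Rightarrow> real) \<Rightarrow> real" and m :: nat
  defines "gs j \<equiv> (real j * s * a, \<lambda>x. real j * s * h0 x)"
  assumes g: "(a, h0) \<in> path_set" and T: "estimator_seq T" and "0 \<le> s" "0 \<le> r"
    and small: "real m * (sqrt r * sqrt (exp (s\<^sup>2 * (\<integral>x. (score (a, h0) x)\<^sup>2 \<partial>P)) - 1))
      < real m * s * \<bar>a\<bar> - 2 * sqrt r"
  shows "\<forall>\<^sub>F n in sequentially.
      ennreal r \<le> (SUP g\<in>gs ` {..m}. quad_risk T n (path_law \<delta> \<theta> f g (1 / sqrt n)))"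
proof -
  let ?I = "\<integral>x. (score (a, h0) x)\<^sup>2 \<partial>P"
  have gs: "gs j \<in> path_set" for j
    using paths_scale[OF g, of "real j * s"] \<open>0 \<le> s\<close> by (simp add: gs_def)
  have sc: "score (gs (Suc j)) x - score (gs j) x = s * score (a, h0) x"
    for j x
    using path_score_scale[of "real j * s" a h0 x] path_score_scale[of "real (Suc j) * s" a h0 x]
    by (simp add: gs_def algebra_simps)
  define good where "good j n k \<longleftrightarrow>
      likelihood_ratio (path_sample (gs j) n) (path_ratio (gs (Suc j)) (gs j) n) \<and>
      path_sample (gs (Suc j)) n
        = density (path_sample (gs j) n) (\<lambda>x. ennreal (path_ratio (gs (Suc j)) (gs j) n x)) \<and>
      likelihood_ratio.chi2 (path_sample (gs j) n) (path_ratio (gs (Suc j)) (gs j) n) \<le> exp k - 1"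
    for j n and k :: real
  have "\<exists>K. K \<longlonglongrightarrow> s\<^sup>2 * ?I \<and> (\<forall>\<^sub>F n in sequentially. good j n (K n))" for j
    unfolding good_def
    by (rule path_likelihood_ratio[OF gs[of "Suc j"] gs[of j]]) (auto simp: sc power_mult_distrib)
  then have "\<forall>j. \<exists>K. K \<longlonglongrightarrow> s\<^sup>2 * ?I \<and> (\<forall>\<^sub>F n in sequentially. good j n (K n))" ..
  from choice[OF this] obtain K where K: "\<And>j. K j \<longlonglongrightarrow> s\<^sup>2 * ?I"
    and L: "\<And>j. \<forall>\<^sub>F n in sequentially. good j n (K j n)"
    by blast
  have "(\<lambda>n. \<Sum>j<m. sqrt r * sqrt (exp (K j n) - 1)) \<longlonglongrightarrow> (\<Sum>j<m. sqrt r * sqrt (exp (s\<^sup>2 * ?I) - 1))"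
    by (intro tendsto_intros K)
  then have ev_small: "\<forall>\<^sub>F n in sequentially.
      (\<Sum>j<m. sqrt r * sqrt (exp (K j n) - 1)) < real m * s * \<bar>a\<bar> - 2 * sqrt r"
    by (rule order_tendstoD) (use small in simp)
  \<comment> \<open>The index \<open>m\<close> is included although the last step leads from
    \<open>m - 1\<close> to \<open>m\<close>: the bias bound at \<open>m\<close> uses that the
    sample law there is a probability measure.\<close>
  have ev_L: "\<forall>\<^sub>F n in sequentially. \<forall>j\<in>{..m}. good j n (K j n)"
    using L by (intro eventually_ball_finite) auto
  have ev_psi: "\<forall>\<^sub>F n in sequentially. \<forall>j\<in>{..m}.
      psi (path_law \<delta> \<theta> f (gs j) (1 / sqrt n)) = \<theta> + fst (gs j) / sqrt n"
    using eventually_psi_path_law[OF gs] by (intro eventually_ball_finite) auto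
  show ?thesis
    using ev_small ev_L ev_psi eventually_ge_at_top[of 1]
  proof eventually_elim
    case (elim n)
    show ?case
    proof (rule ccontr)
      assume not_case: "\<not> ?case"
      have risk: "quad_risk T n (path_law \<delta> \<theta> f (gs j) (1 / sqrt n)) \<le> ennreal r" if "j \<le> m" for j
      proof -
        have "quad_risk T n (path_law \<delta> \<theta> f (gs j) (1 / sqrt n))
            \<le> (SUP g\<in>gs ` {..m}. quad_risk T n (path_law \<delta> \<theta> f g (1 / sqrt n)))"
          using that by (intro SUP_upper) auto
        with not_case show ?thesis by simp
      qed
      \<comment> \<open>The centring at \<open>\<theta>\<close> is the same at all grid points, so
        one and the same statistic is followed along the grid, with moving target
        \<open>c j\<close>.\<close>
      define X where "X x = sqrt n * (T n x - \<theta>)" for x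
      define c where "c j = real j * s * a" for j
      have X[measurable]: "X \<in> borel_measurable (path_sample (gs j) n)" for j
        using estimator_measurable[OF T, of n] unfolding X_def[abs_def] path_law_eq by measurable
      have Xc: "integrable (path_sample (gs j) n) (\<lambda>x. (X x - c j)\<^sup>2)"
        "(\<integral>x. (X x - c j)\<^sup>2 \<partial>path_sample (gs j) n) \<le> r" if j: "j \<le> m" for j
      proof -
        have "sqrt n * (T n x - (\<theta> + fst (gs j) / sqrt n)) = X x - c j" for x
          using elim(4) by (simp add: X_def c_def gs_def field_simps)
        then have "(\<integral>\<^sup>+x. ennreal ((X x - c j)\<^sup>2) \<partial>path_sample (gs j) n) \<le> ennreal r"
          using risk[OF j] elim(3) j by (simp add: quad_risk_def)
        then show "integrable (path_sample (gs j) n) (\<lambda>x. (X x - c j)\<^sup>2)"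
          "(\<integral>x. (X x - c j)\<^sup>2 \<partial>path_sample (gs j) n) \<le> r"
          using nn_integral_square_le[of "\<lambda>x. X x - c j"] \<open>0 \<le> r\<close> by auto
      qed
      define \<mu> where "\<mu> j = (\<integral>x. X x \<partial>path_sample (gs j) n)" for j
      have bias: "\<bar>\<mu> j - c j\<bar> \<le> sqrt r" if j: "j \<le> m" for j
      proof -
        interpret L: likelihood_ratio "path_sample (gs j) n" "path_ratio (gs (Suc j)) (gs j) n"
          using elim(2) j unfolding good_def by blast
        have i: "integrable (path_sample (gs j) n) (\<lambda>x. X x - c j)"
          by (rule L.square_integrable_imp_integrable[OF _ Xc(1)[OF j]]) measurable
        have "integrable (path_sample (gs j) n) X"
          using Bochner_Integration.integrable_add[OF i, of "\<lambda>_. c j"] by simp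
        then have "\<mu> j - c j = (\<integral>x. X x - c j \<partial>path_sample (gs j) n)"
          by (simp add: \<mu>_def L.prob_space)
        also have "\<bar>\<dots>\<bar> \<le> sqrt (\<integral>x. (X x - c j)\<^sup>2 \<partial>path_sample (gs j) n)"
          by (rule L.abs_mean_le_L2[OF _ Xc(1)[OF j]]) measurable
        also have "\<dots> \<le> sqrt r" using Xc(2)[OF j] by simp
        finally show ?thesis .
      qed
      have step: "\<bar>\<mu> (Suc j) - \<mu> j\<bar> \<le> sqrt r * sqrt (exp (K j n) - 1)" if "j < m" for j
      proof -
        from that have j: "j \<le> m" by simp
        interpret L: likelihood_ratio "path_sample (gs j) n" "path_ratio (gs (Suc j)) (gs j) n"
          using elim(2) j unfolding good_def by blast
        have "path_sample (gs (Suc j)) n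
            = density (path_sample (gs j) n) (\<lambda>x. ennreal (path_ratio (gs (Suc j)) (gs j) n x))"
          "L.chi2 \<le> exp (K j n) - 1"
          using elim(2) j unfolding good_def by blast+
        then have "\<bar>\<mu> (Suc j) - \<mu> j\<bar> \<le> sqrt (\<integral>x. (X x - c j)\<^sup>2 \<partial>path_sample (gs j) n) * sqrt L.chi2"
          using L.mean_shift_le[OF X Xc(1)[OF j]] by (simp add: \<mu>_def)
        also have "\<dots> \<le> sqrt r * sqrt (exp (K j n) - 1)"
          using Xc(2)[OF j] \<open>L.chi2 \<le> _\<close> L.chi2_nonneg \<open>0 \<le> r\<close> by (intro mult_mono) auto
        finally show ?thesis .
      qed
      have "\<bar>\<mu> m - \<mu> 0\<bar> = \<bar>\<Sum>j<m. \<mu> (Suc j) - \<mu> j\<bar>"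
        by (simp add: sum_lessThan_telescope)
      also have "\<dots> \<le> (\<Sum>j<m. sqrt r * sqrt (exp (K j n) - 1))"
        using step by (intro order_trans[OF sum_abs] sum_mono) auto
      finally have "\<bar>\<mu> m - \<mu> 0\<bar> < real m * s * \<bar>a\<bar> - 2 * sqrt r" using elim(1) by simp
      moreover have "\<bar>c m\<bar> = real m * s * \<bar>a\<bar>" using \<open>0 \<le> s\<close> by (simp add: c_def abs_mult)
      moreover have "c 0 = 0" by (simp add: c_def)
      ultimately show False using bias[of m] bias[of 0] by simp
    qed
  qed
qed

theorem minimax_lower_bound:
  assumes g: "(a, h0) \<in> path_set" and T: "estimator_seq T"
    and B: "(\<integral>x. (score (a, h0) x)\<^sup>2 \<partial>P) \<le> B" "0 < B"
  shows "ennreal (a\<^sup>2 / B) \<le> local_minimax_risk \<delta> \<theta> f T"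
proof (rule ccontr)
  assume "\<not> ?thesis"
  then obtain v where v: "local_minimax_risk \<delta> \<theta> f T < v" "v < ennreal (a\<^sup>2 / B)"
    using dense by (auto simp: not_le)
  obtain r where r: "v = ennreal r" "0 \<le> r" using v(2) by (cases v) auto
  have rB: "r * B < a\<^sup>2" using v(2) r B(2) by (simp add: ennreal_less_iff pos_less_divide_eq)
  \<comment> \<open>As \<open>(exp y - 1) / y\<close> tends to 1, the strict inequality
    \<open>r * B < a\<^sup>2\<close> survives for some \<open>y > 0\<close>. The step size is then
    fixed by \<open>s\<^sup>2 * B = y\<close>, which makes the cost of one step smaller than its
    target \<open>s * \<bar>a\<bar>\<close>.\<close>
  have "((\<lambda>y. r * B * ((exp y - 1) / y)) \<longlongrightarrow> r * B * 1) (at (0::real))"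
    using DERIV_exp[of 0] by (intro tendsto_intros) (simp add: DERIV_def)
  then have "\<forall>\<^sub>F y in at (0::real). r * B * ((exp y - 1) / y) < a\<^sup>2"
    by (rule order_tendstoD) (use rB in simp)
  then have "\<forall>\<^sub>F y in at_right (0::real). r * B * ((exp y - 1) / y) < a\<^sup>2"
    by (rule filter_leD[OF at_le, rotated]) simp
  then obtain y where y: "0 < y" "r * B * ((exp y - 1) / y) < a\<^sup>2"
    using eventually_happens[OF eventually_conj[OF eventually_at_right_less[of "0::real"]]] by force
  define s where "s = sqrt (y / B)"
  have s: "0 < s" "s\<^sup>2 * B = y" using y(1) B(2) by (auto simp: s_def)
  let ?I = "\<integral>x. (score (a, h0) x)\<^sup>2 \<partial>P"
  have "sqrt r * sqrt (exp (s\<^sup>2 * ?I) - 1) \<le> sqrt r * sqrt (exp y - 1)"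
    unfolding s(2)[symmetric] using B(1) r(2) by (intro mult_left_mono) (auto intro: mult_left_mono)
  also have "r * (exp y - 1) < s\<^sup>2 * a\<^sup>2"
    using y B(2) unfolding s_def by (simp add: field_simps)
  then have "sqrt r * sqrt (exp y - 1) < s * \<bar>a\<bar>"
    using s(1) real_sqrt_less_mono[of "r * (exp y - 1)" "(s * \<bar>a\<bar>)\<^sup>2"]
    by (simp add: real_sqrt_mult power_mult_distrib abs_mult)
  finally have gap: "0 < s * \<bar>a\<bar> - sqrt r * sqrt (exp (s\<^sup>2 * ?I) - 1)" by simp
  \<comment> \<open>Each step leaves a fixed positive deficit; enough of them exceed the two end
    biases.\<close>
  obtain m :: nat where "2 * sqrt r / (s * \<bar>a\<bar> - sqrt r * sqrt (exp (s\<^sup>2 * ?I) - 1)) < m"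
    using reals_Archimedean2 by blast
  then have "2 * sqrt r < m * (s * \<bar>a\<bar> - sqrt r * sqrt (exp (s\<^sup>2 * ?I) - 1))"
    using gap by (simp add: pos_divide_less_eq)
  then have "real m * (sqrt r * sqrt (exp (s\<^sup>2 * ?I) - 1)) < real m * s * \<bar>a\<bar> - 2 * sqrt r"
    by (simp add: algebra_simps)
  from minimax_step[OF g T less_imp_le[OF s(1)] r(2) this]
  have "ennreal r \<le> liminf (\<lambda>n. SUP g\<in>(\<lambda>j. (real j * s * a, \<lambda>x. real j * s * h0 x)) ` {..m}.
      quad_risk T n (path_law \<delta> \<theta> f g (1 / sqrt n)))"
    by (rule Liminf_bounded)
  also have "\<dots> \<le> local_minimax_risk \<delta> \<theta> f T"
    unfolding local_minimax_risk_def
  proof (rule SUP_upper)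
    show "(\<lambda>j. (real j * s * a, \<lambda>x. real j * s * h0 x)) ` {..m} \<in> {E. finite E \<and> E \<subseteq> path_set}"
      using paths_scale[OF g] s(1) by auto
  qed
  finally show False using v(1) r(1) by simp
qed

end

section \<open>Least favourable paths\<close>

lemma integral_indicator_tail:
  assumes "e \<in> {0..1}"
  shows "(\<integral>x. indicator {1-e..1} x \<partial>unit_lborel) = e"
proof -
  have "(\<integral>x. indicator {1-e..1} x \<partial>unit_lborel) = measure unit_lborel ({1-e..1} \<inter> space unit_lborel)"
    by simp
  also have "\<dots> = e"
    using assms by (subst measure_restrict_space) (auto simp: min_def max_def)
  finally show ?thesis .
qed

text \<open>Because \<open>f\<close> vanishes on the tail, the tail has mass
  \<open>\<theta> * \<delta>\<close> whatever \<open>f\<close> is. This makes the tail frequency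
  divided by \<open>\<delta>\<close> unbiased for \<open>\<theta>\<close>, under the path laws as
  well.\<close>

lemma integral_indicator_mix:
  assumes f: "f \<in> dens_class \<delta>" and "\<delta> \<in> {0..1}" "\<theta> \<in> {0..1}"
  shows "(\<integral>x. indicator {1-\<delta>..1} x \<partial>mix \<theta> f) = \<theta> * \<delta>"
proof -
  have [measurable]: "indicator {1-\<delta>..1} \<in> borel_measurable unit_lborel"
    by (intro measurable_restrict_space1) measurable
  have "(\<integral>x. indicator {1-\<delta>..1} x \<partial>mix \<theta> f) = (\<integral>x. mix_dens \<theta> f x * indicator {1-\<delta>..1} x \<partial>unit_lborel)"
    using assms by (intro integral_mix) auto
  also have "\<dots> = (\<integral>x. \<theta> * indicator {1-\<delta>..1} x \<partial>unit_lborel)"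
    using dens_class_zero[OF f]
    by (intro Bochner_Integration.integral_cong) (auto simp: mix_dens_def split: split_indicator)
  also have "\<dots> = \<theta> * \<delta>" using integral_indicator_tail[OF assms(2)] by simp
  finally show ?thesis .
qed

context mixture_model
begin

text \<open>One centred summand of the tail estimator; it turns out to be the efficient influence
  function when \<open>\<delta> > 0\<close>.\<close>

definition infl :: "real \<Rightarrow> real" where
  "infl x = indicator {1-\<delta>..1} x / \<delta> - \<theta>"

text \<open>The variance of \<open>infl\<close> under \<open>P\<close>. It is also the first
  component of the path with score \<open>infl\<close>: pairing \<open>infl\<close> with a score
  returns that component, and pairing \<open>infl\<close> with itself returns its variance.\<close>

definition opt_var :: real where
  "opt_var = \<theta> * (1 / \<delta> - \<theta>)"

text \<open>Obtained by solving \<open>score (a, h0) = infl\<close>: on the tail this forces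
  \<open>a = opt_var\<close>, and then \<open>h0\<close> is determined on \<open>[0,1-\<delta>)\<close>.\<close>

definition opt_h :: "real \<Rightarrow> real" where
  "opt_h x = (opt_var - \<theta> * (1 - \<theta>) - \<theta> / \<delta> / f x) / (1 - \<theta>)"

lemma measurable_indicator_tail [measurable]: "indicator {1-e..1::real} \<in> borel_measurable unit_lborel"
  by (intro measurable_restrict_space1) measurable

lemma infl_borel [measurable]: "infl \<in> borel_measurable unit_lborel"
  unfolding infl_def[abs_def] by measurable

context
  assumes delta_pos: "0 < \<delta>"
begin

lemma opt_var_pos: "0 < opt_var"
proof -
  have "1 < 1 / \<delta>" using delta delta_pos by simp
  then show ?thesis using theta by (simp add: opt_var_def)
qed

text \<open>Multiplication by \<open>f\<close> cancels the \<open>1 / f\<close> in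
  \<open>opt_h\<close>, so the tilt is bounded although \<open>opt_h\<close> tends to minus infinity
  at \<open>1-\<delta>\<close>.\<close>

lemma tilt_opt_h:
  assumes "x \<in> {0..1}"
  shows "tilt opt_h x = ((opt_var - \<theta> * (1 - \<theta>)) * f x - \<theta> / \<delta> * (1 - indicator {1-\<delta>..1} x)) / (1 - \<theta>)"
proof (cases "x < 1 - \<delta>")
  case True
  then have "f x \<noteq> 0" using f_pos[of x] assms by auto
  then show ?thesis using True by (simp add: tilt_def opt_h_def field_simps)
next
  case False
  then show ?thesis using f_zero[of x] assms by (simp add: tilt_def)
qed

lemma opt_path_in: "(opt_var, opt_h) \<in> path_set"
proof (rule pathsI)
  have sub: "{0..<1-\<delta>} \<subseteq> {0..1}" using delta by auto
  show "continuous_on {0..<1-\<delta>} opt_h"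
    unfolding opt_h_def[abs_def]
  proof (intro continuous_intros continuous_on_subset[OF dens_class_continuous[OF f_dens] sub] ballI)
    show "f x \<noteq> 0" if "x \<in> {0..<1-\<delta>}" for x using f_pos[OF that] by simp
  qed (use theta in auto)
  show "antimono_on {0..<1-\<delta>} opt_h"
  proof (rule monotone_onI)
    fix x y assume xy: "x \<in> {0..<1-\<delta>}" "y \<in> {0..<1-\<delta>}" "x \<le> y"
    then have "x \<in> {0..1}" "y \<in> {0..1}" using delta by auto
    with xy(3) have "f y \<le> f x" using dens_class_antimono[OF f_dens] by (simp add: monotone_on_def)
    then have "\<theta> / \<delta> / f x \<le> \<theta> / \<delta> / f y"
      using f_pos[OF xy(2)] theta delta_pos by (intro divide_left_mono) auto
    then show "opt_h y \<le> opt_h x" unfolding opt_h_def using theta by (intro divide_right_mono) auto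
  qed
  show [measurable]: "tilt opt_h \<in> borel_measurable unit_lborel"
    by (rule measurable_cong[THEN iffD1, rotated, of
      "\<lambda>x. ((opt_var - \<theta> * (1 - \<theta>)) * f x - \<theta> / \<delta> * (1 - indicator {1-\<delta>..1} x)) / (1 - \<theta>)"])
      (use tilt_opt_h in auto)
  have ind: "integrable unit_lborel (indicator {1-\<delta>..1} :: real \<Rightarrow> real)"
    by (rule unit_lborel.integrable_const_bound[where B = 1]) auto
  have "(\<integral>x. tilt opt_h x \<partial>unit_lborel)
      = (\<integral>x. ((opt_var - \<theta> * (1 - \<theta>)) * f x - \<theta> / \<delta> * (1 - indicator {1-\<delta>..1} x)) / (1 - \<theta>) \<partial>unit_lborel)"
    using tilt_opt_h by (intro Bochner_Integration.integral_cong) auto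
  also have "\<dots> = ((opt_var - \<theta> * (1 - \<theta>)) - \<theta> / \<delta> * (1 - \<delta>)) / (1 - \<theta>)"
    using f_integrable f_integral ind integral_indicator_tail[of \<delta>] delta unit_lborel.prob_space by simp
  \<comment> \<open>The constant \<open>opt_var - \<theta> * (1 - \<theta>)\<close> equals
    \<open>\<theta> / \<delta> * (1 - \<delta>)\<close>: solving for the score has already centred
    \<open>opt_h\<close>.\<close>
  also have "\<dots> = 0" using delta_pos by (simp add: opt_var_def field_simps)
  finally show "(\<integral>x. tilt opt_h x \<partial>unit_lborel) = 0" .
  define C where "C = (\<bar>opt_var - \<theta> * (1 - \<theta>)\<bar> * f 0 + \<theta> / \<delta>) / (1 - \<theta>)"
  show "integrable unit_lborel (\<lambda>x. (tilt opt_h x)\<^sup>2)"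
  proof (rule integrable_bounded_square)
    fix x :: real assume x: "x \<in> {0..1}"
    have "\<bar>(opt_var - \<theta> * (1 - \<theta>)) * f x\<bar> \<le> \<bar>opt_var - \<theta> * (1 - \<theta>)\<bar> * f 0"
      unfolding abs_mult using f_le[OF x] f_nonneg[OF x] by (intro mult_left_mono) auto
    moreover have "\<bar>\<theta> / \<delta> * (1 - indicator {1-\<delta>..1} x)\<bar> \<le> \<theta> / \<delta> * 1"
      unfolding abs_mult using theta delta_pos by (intro mult_mono) (auto split: split_indicator)
    ultimately have "\<bar>(opt_var - \<theta> * (1 - \<theta>)) * f x - \<theta> / \<delta> * (1 - indicator {1-\<delta>..1} x)\<bar>
        \<le> \<bar>opt_var - \<theta> * (1 - \<theta>)\<bar> * f 0 + \<theta> / \<delta>"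
      by linarith
    then show "\<bar>tilt opt_h x\<bar> \<le> C"
      unfolding tilt_opt_h[OF x] C_def abs_divide using theta by (simp add: divide_right_mono)
  qed measurable
qed

lemma path_score_opt:
  assumes "x \<in> {0..1}"
  shows "score (opt_var, opt_h) x = infl x"
proof -
  have "opt_var * (1 - f x) + (1 - \<theta>) * tilt opt_h x
      = opt_var - \<theta> * (1 - \<theta>) * f x - \<theta> / \<delta> * (1 - indicator {1-\<delta>..1} x)"
  proof -
    have "(1 - \<theta>) * tilt opt_h x
        = (opt_var - \<theta> * (1 - \<theta>)) * f x - \<theta> / \<delta> * (1 - indicator {1-\<delta>..1} x)"
      using theta by (simp add: tilt_opt_h[OF assms])
    then show ?thesis by (simp add: algebra_simps)
  qed
  also have "\<dots> = infl x * p x"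
  proof (cases "x < 1 - \<delta>")
    case True
    then show ?thesis using delta_pos by (simp add: infl_def opt_var_def mix_dens_def field_simps)
  next
    case False
    then show ?thesis using f_zero[of x] assms delta_pos
      by (simp add: infl_def opt_var_def mix_dens_def field_simps)
  qed
  finally show ?thesis using p_pos[OF assms] by (simp add: path_score_eq)
qed

lemma integral_infl_square: "(\<integral>x. (infl x)\<^sup>2 \<partial>P) = opt_var"
proof -
  interpret prob_space P by (rule prob_space_mix[OF f_dens theta01(1)])
  have ind: "integrable P (indicator {1-\<delta>..1} :: real \<Rightarrow> real)"
    by (rule integrable_const_bound[where B = 1]) auto
  have "(infl x)\<^sup>2 = (1 / \<delta>\<^sup>2 - 2 * \<theta> / \<delta>) * indicator {1-\<delta>..1} x + \<theta>\<^sup>2" for x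
    by (auto simp: infl_def power2_diff power_divide split: split_indicator)
  then have "(\<integral>x. (infl x)\<^sup>2 \<partial>P) = (1 / \<delta>\<^sup>2 - 2 * \<theta> / \<delta>) * (\<theta> * \<delta>) + \<theta>\<^sup>2"
    using ind integral_indicator_mix[OF f_dens _ theta01(1)] delta prob_space by simp
  also have "\<dots> = opt_var"
    using delta_pos by (simp add: opt_var_def power2_eq_square field_simps)
  finally show ?thesis .
qed

lemma integral_path_score_opt_square: "(\<integral>x. (score (opt_var, opt_h) x)\<^sup>2 \<partial>P) = opt_var"
proof -
  have "(\<integral>x. (score (opt_var, opt_h) x)\<^sup>2 \<partial>P) = (\<integral>x. (infl x)\<^sup>2 \<partial>P)"
    using path_score_opt by (intro Bochner_Integration.integral_cong) auto
  then show ?thesis by (simp add: integral_infl_square)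
qed

theorem minimax_delta_pos:
  assumes "estimator_seq T"
  shows "ennreal (\<theta> * (1 / \<delta> - \<theta>)) \<le> local_minimax_risk \<delta> \<theta> f T"
proof -
  have "opt_var\<^sup>2 / opt_var = opt_var" by (simp add: power2_eq_square)
  then show ?thesis
    using minimax_lower_bound[OF opt_path_in assms, of opt_var] opt_var_pos
    by (simp add: integral_path_score_opt_square flip: opt_var_def)
qed

end

text \<open>Here \<open>- 1 / f\<close> is truncated at the level \<open>f (1 - e)\<close>; the resulting score is of order \<open>e\<close> on
  \<open>[0,1-e)\<close> and bounded on the remaining interval of length \<open>e\<close>.\<close>

lemma small_score_path:
  assumes "\<delta> = 0" and "0 < B"
  obtains h0 where "(1, h0) \<in> path_set" "(\<integral>x. (score (1, h0) x)\<^sup>2 \<partial>P) \<le> B"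
proof -
  \<comment> \<open>\<open>C\<close> will bound the score on \<open>[0,1]\<close>. The squared norm
    is then at most \<open>e * D\<close>: the first summand of \<open>D\<close> comes from
    \<open>[0,1-e)\<close> with \<open>e\<^sup>2 \<le> e\<close>, the second from the remaining
    interval, where \<open>p\<close> is at most \<open>1 + f 0\<close>. This dictates
    \<open>e \<le> B / D\<close>.\<close>
  define C where "C = 1 / \<theta> + 1 / (1 - \<theta>)"
  define D where "D = 1 / (1 - \<theta>)\<^sup>2 + C\<^sup>2 * (1 + f 0)"
  have f0: "0 \<le> f 0" using f_nonneg[of 0] by simp
  have D: "0 < D" using theta f0 unfolding D_def by (intro add_pos_nonneg) auto
  define e where "e = min (1 / 2) (B / D)"
  have e: "0 < e" "e \<le> 1 / 2" "e * D \<le> B"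
    using D assms(2) by (auto simp: e_def min_def field_simps)
  define k where "k = f (1 - e)"
  have k: "0 < k" using e assms(1) f_pos[of "1 - e"] by (simp add: k_def)
  have k_le: "k \<le> f x" if "x \<in> {0..1 - e}" for x
    using dens_class_antimono[OF f_dens] that e by (auto simp: k_def monotone_on_def)
  \<comment> \<open>This is \<open>f / max f k\<close>, that is \<open>f\<close> times the truncated
    \<open>1 / f\<close>. It equals 1 on \<open>[0,1-e]\<close>, so its mean \<open>\<mu>\<close>,
    the centring of \<open>h0\<close>, is within \<open>e\<close> of 1.\<close>
  define m where "m x = min 1 (f x / k)" for x
  have m: "0 \<le> m x" "m x \<le> 1" if "x \<in> {0..1}" for x using f_nonneg[OF that] k by (auto simp: m_def)
  have [measurable]: "m \<in> borel_measurable unit_lborel" unfolding m_def[abs_def] by measurable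
  have mi: "integrable unit_lborel m"
    by (rule unit_lborel.integrable_const_bound[where B = 1]) (use m in auto)
  define \<mu> where "\<mu> = (\<integral>x. m x \<partial>unit_lborel)"
  have ind: "integrable unit_lborel (indicator {1-e..1} :: real \<Rightarrow> real)"
    by (rule unit_lborel.integrable_const_bound[where B = 1]) auto
  have "\<mu> \<le> (\<integral>x. 1 \<partial>unit_lborel)"
    unfolding \<mu>_def using m mi by (intro integral_mono) auto
  then have mu1: "\<mu> \<le> 1" using unit_lborel.prob_space by simp
  have "(\<integral>x. 1 - indicator {1-e..1} x \<partial>unit_lborel) \<le> \<mu>"
    unfolding \<mu>_def
  proof (rule integral_mono)
    show "1 - indicator {1-e..1} x \<le> m x" if "x \<in> space unit_lborel" for x
      using that k_le[of x] k m(1)[of x] by (auto simp: m_def split: split_indicator)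
  qed (use mi ind in simp_all)
  then have mu2: "1 - \<mu> \<le> e"
    using ind integral_indicator_tail[of e] e unit_lborel.prob_space by simp
  define h0 where "h0 x = (\<mu> - 1 / max (f x) k) / (1 - \<theta>)" for x
  have th: "tilt h0 x = (\<mu> * f x - m x) / (1 - \<theta>)" if "x \<in> {0..1}" for x
  proof (cases "x < 1")
    case True
    then have "tilt h0 x = f x * h0 x" using assms(1) unfolding tilt_def by simp
    moreover have "f x / max (f x) k = m x" using k by (auto simp: m_def max_def min_def field_simps)
    ultimately show ?thesis by (simp add: h0_def algebra_simps)
  next
    case False
    then have "tilt h0 x = 0" using assms(1) unfolding tilt_def by simp
    moreover have "f x = 0" using False that f_zero[of x] assms(1) by simp
    ultimately show ?thesis by (simp add: m_def)
  qed
  have path: "(1, h0) \<in> path_set"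
  proof (rule pathsI)
    have sub: "{0..<1-\<delta>} \<subseteq> {0..1}" using delta by auto
    show "continuous_on {0..<1-\<delta>} h0"
      unfolding h0_def[abs_def] using k theta
      by (intro continuous_intros continuous_on_subset[OF dens_class_continuous[OF f_dens] sub]) auto
    show "antimono_on {0..<1-\<delta>} h0"
    proof (rule monotone_onI)
      fix x y assume xy: "x \<in> {0..<1-\<delta>}" "y \<in> {0..<1-\<delta>}" "x \<le> y"
      then have "x \<in> {0..1}" "y \<in> {0..1}" using delta by auto
      with xy(3) have "f y \<le> f x" using dens_class_antimono[OF f_dens] by (simp add: monotone_on_def)
      then have "1 / max (f x) k \<le> 1 / max (f y) k"
        using k by (intro divide_left_mono) auto
      then show "h0 y \<le> h0 x" unfolding h0_def using theta by (intro divide_right_mono) auto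
    qed
    show [measurable]: "tilt h0 \<in> borel_measurable unit_lborel"
      by (rule measurable_cong[THEN iffD1, rotated, of "\<lambda>x. (\<mu> * f x - m x) / (1 - \<theta>)"]) (use th in auto)
    have "(\<integral>x. tilt h0 x \<partial>unit_lborel) = (\<integral>x. (\<mu> * f x - m x) / (1 - \<theta>) \<partial>unit_lborel)"
      using th by (intro Bochner_Integration.integral_cong) auto
    also have "\<dots> = 0" using f_integrable f_integral mi by (simp add: \<mu>_def)
    finally show "(\<integral>x. tilt h0 x \<partial>unit_lborel) = 0" .
    show "integrable unit_lborel (\<lambda>x. (tilt h0 x)\<^sup>2)"
    proof (rule integrable_bounded_square)
      fix x :: real assume x: "x \<in> {0..1}"
      have "\<bar>\<mu> * f x\<bar> \<le> \<bar>\<mu>\<bar> * f 0"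
        unfolding abs_mult using f_le[OF x] f_nonneg[OF x] by (intro mult_left_mono) auto
      then show "\<bar>tilt h0 x\<bar> \<le> (\<bar>\<mu>\<bar> * f 0 + 1) / (1 - \<theta>)"
        unfolding th[OF x] abs_divide using theta m[OF x] by (intro frac_le) auto
    qed measurable
  qed
  let ?s = "score (1, h0)"
  have s_eq: "?s x = ((1 - m x) - (1 - \<mu>) * f x) / p x" if "x \<in> {0..1}" for x
  proof -
    have "(1 - \<theta>) * tilt h0 x = \<mu> * f x - m x" using theta by (simp add: th[OF that])
    then show ?thesis by (simp add: path_score_eq algebra_simps)
  qed
  have fp: "f x / p x \<le> 1 / (1 - \<theta>)" if "x \<in> {0..1}" for x
    using p_pos[OF that] theta by (simp add: field_simps mix_dens_def)
  have s1: "\<bar>?s x\<bar> \<le> e / (1 - \<theta>)" if x: "x \<in> {0..1}" "x < 1 - e" for x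
  proof -
    have "m x = 1" using k_le[of x] x k by (simp add: m_def)
    then have "\<bar>?s x\<bar> = (1 - \<mu>) * (f x / p x)"
      using s_eq[OF x(1)] mu1 f_nonneg[OF x(1)] p_pos[OF x(1)] by (simp add: abs_mult)
    also have "\<dots> \<le> e * (1 / (1 - \<theta>))"
      using mu1 mu2 e fp[OF x(1)] f_nonneg[OF x(1)] p_pos[OF x(1)] by (intro mult_mono) auto
    finally show ?thesis by simp
  qed
  have s2: "\<bar>?s x\<bar> \<le> C" if x: "x \<in> {0..1}" for x
  proof -
    have "\<bar>(1 - \<mu>) * f x\<bar> \<le> 1 * f x"
      unfolding abs_mult using mu1 mu2 e f_nonneg[OF x] by (intro mult_mono) auto
    then have "\<bar>(1 - m x) - (1 - \<mu>) * f x\<bar> \<le> 1 + f x" using m[OF x] by simp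
    then have "\<bar>?s x\<bar> \<le> (1 + f x) / p x"
      unfolding s_eq[OF x] abs_divide using p_pos[OF x] by (simp add: divide_right_mono)
    also have "\<dots> \<le> C"
      unfolding C_def add_divide_distrib using fp[OF x] p_ge[OF x] theta
      by (intro add_mono divide_left_mono) auto
    finally show ?thesis .
  qed
  note [measurable] = path_score_borel[OF path]
  have "(\<integral>x. (?s x)\<^sup>2 \<partial>P) = (\<integral>x. p x * (?s x)\<^sup>2 \<partial>unit_lborel)"
    by (rule integral_mix[OF f_dens theta01(1)]) measurable
  also have "\<dots> \<le> (\<integral>x. e\<^sup>2 / (1 - \<theta>)\<^sup>2 * p x + (1 + f 0) * C\<^sup>2 * indicator {1-e..1} x \<partial>unit_lborel)"
  proof (rule integral_mono)
    show "integrable unit_lborel (\<lambda>x. p x * (?s x)\<^sup>2)"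
    proof (rule unit_lborel.integrable_const_bound[where B = "(1 + f 0) * C\<^sup>2"])
      show "AE x in unit_lborel. norm (p x * (?s x)\<^sup>2) \<le> (1 + f 0) * C\<^sup>2"
      proof (rule AE_I2)
        fix x assume "x \<in> space unit_lborel"
        then have x: "x \<in> {0..1}" by simp
        have "(?s x)\<^sup>2 \<le> C\<^sup>2" using power_mono[OF s2[OF x], of 2] by simp
        then show "norm (p x * (?s x)\<^sup>2) \<le> (1 + f 0) * C\<^sup>2"
          using p_pos[OF x] p_le[OF x] f0 by (simp add: mult_mono)
      qed
    qed measurable
    show "integrable unit_lborel (\<lambda>x. e\<^sup>2 / (1 - \<theta>)\<^sup>2 * p x + (1 + f 0) * C\<^sup>2 * indicator {1-e..1} x)"
      using ind mix_dens_integrable[OF f_dens] by (intro Bochner_Integration.integrable_add integrable_mult_right)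
    fix x assume "x \<in> space unit_lborel"
    then have x: "x \<in> {0..1}" by simp
    show "p x * (?s x)\<^sup>2 \<le> e\<^sup>2 / (1 - \<theta>)\<^sup>2 * p x + (1 + f 0) * C\<^sup>2 * indicator {1-e..1} x"
    proof (cases "x < 1 - e")
      case True
      have "(?s x)\<^sup>2 \<le> (e / (1 - \<theta>))\<^sup>2"
        using power_mono[OF s1[OF x True], of 2] by simp
      then have "p x * (?s x)\<^sup>2 \<le> p x * (e / (1 - \<theta>))\<^sup>2" using p_pos[OF x] by simp
      then show ?thesis using True by (simp add: power_divide mult.commute)
    next
      case False
      have "(?s x)\<^sup>2 \<le> C\<^sup>2" using power_mono[OF s2[OF x], of 2] by simp
      then have "p x * (?s x)\<^sup>2 \<le> (1 + f 0) * C\<^sup>2"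
        using p_pos[OF x] p_le[OF x] f0 by (intro mult_mono) auto
      moreover have "0 \<le> e\<^sup>2 / (1 - \<theta>)\<^sup>2 * p x" using p_pos[OF x] by simp
      ultimately show ?thesis using False x by simp
    qed
  qed
  also have "\<dots> = e\<^sup>2 / (1 - \<theta>)\<^sup>2 + (1 + f 0) * C\<^sup>2 * e"
    using ind mix_dens_integrable[OF f_dens, of \<theta>] mix_dens_integral[OF f_dens, of \<theta>]
      integral_indicator_tail[of e] e by simp
  also have "\<dots> \<le> e * D"
  proof -
    have "e\<^sup>2 \<le> e" using e by (simp add: power2_eq_square mult_left_le)
    then have "e\<^sup>2 / (1 - \<theta>)\<^sup>2 \<le> e / (1 - \<theta>)\<^sup>2" by (rule divide_right_mono) simp
    then show ?thesis by (simp add: D_def algebra_simps)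
  qed
  finally show thesis using path e(3) by (intro that) auto
qed

theorem minimax_delta_zero:
  assumes "\<delta> = 0" "estimator_seq T"
  shows "local_minimax_risk \<delta> \<theta> f T = \<infinity>"
proof (rule ccontr)
  assume "local_minimax_risk \<delta> \<theta> f T \<noteq> \<infinity>"
  then obtain r where r: "local_minimax_risk \<delta> \<theta> f T = ennreal r" "0 \<le> r"
    by (cases "local_minimax_risk \<delta> \<theta> f T") auto
  \<comment> \<open>A path with \<open>a = 1\<close> and squared norm at most
    \<open>1 / (r + 1)\<close> forces the risk up to \<open>r + 1\<close>, above its supposed value
    \<open>r\<close>.\<close>
  have "0 < 1 / (r + 1)" using r(2) by simp
  from small_score_path[OF assms(1) this] obtain h0
    where "(1, h0) \<in> path_set" "(\<integral>x. (score (1, h0) x)\<^sup>2 \<partial>P) \<le> 1 / (r + 1)" .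
  from minimax_lower_bound[OF this(1) assms(2) this(2) \<open>0 < 1 / (r + 1)\<close>] r
  show False by simp
qed

end

section \<open>Limit theorems\<close>

context prob_space
begin

lemma
  fixes X :: "'a \<Rightarrow> real"
  assumes "i \<in> I" and [measurable]: "X \<in> borel_measurable M"
  shows integral_PiM_component: "(\<integral>x. X (x i) \<partial>(\<Pi>\<^sub>M i\<in>I. M)) = (\<integral>x. X x \<partial>M)"
    and integrable_PiM_component: "integrable (\<Pi>\<^sub>M i\<in>I. M) (\<lambda>x. X (x i)) \<longleftrightarrow> integrable M X"
proof -
  have d: "distr (\<Pi>\<^sub>M i\<in>I. M) M (\<lambda>x. x i) = M"
    using assms(1) prob_space_axioms by (intro distr_PiM_component) auto
  have [measurable]: "(\<lambda>x. x i) \<in> (\<Pi>\<^sub>M i\<in>I. M) \<rightarrow>\<^sub>M M"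
    using assms(1) by (rule measurable_component_singleton)
  show "(\<integral>x. X (x i) \<partial>(\<Pi>\<^sub>M i\<in>I. M)) = (\<integral>x. X x \<partial>M)"
    using integral_distr[of "\<lambda>x. x i" "\<Pi>\<^sub>M i\<in>I. M" M X] by (simp add: d)
  show "integrable (\<Pi>\<^sub>M i\<in>I. M) (\<lambda>x. X (x i)) \<longleftrightarrow> integrable M X"
    using integrable_distr_eq[of "\<lambda>x. x i" "\<Pi>\<^sub>M i\<in>I. M" M X] by (simp add: d)
qed

lemma integral_PiM_cross:
  fixes X :: "'a \<Rightarrow> real"
  assumes "finite I" "i \<in> I" "j \<in> I" "i \<noteq> j" and X: "integrable M X" "(\<integral>x. X x \<partial>M) = 0"
  shows "(\<integral>x. X (x i) * X (x j) \<partial>(\<Pi>\<^sub>M i\<in>I. M)) = 0"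
    and "integrable (\<Pi>\<^sub>M i\<in>I. M) (\<lambda>x. X (x i) * X (x j))"
proof -
  interpret P: product_sigma_finite "\<lambda>_. M"
    unfolding product_sigma_finite_def by (simp add: sigma_finite_measure_axioms)
  \<comment> \<open>Padding with the constant 1 at all other coordinates turns the product of two
    coordinates into one over \<open>I\<close>, to which independence applies.\<close>
  define F where "F k = (if k = i \<or> k = j then X else (\<lambda>_. 1))" for k
  have F: "integrable M (F k)" for k using X(1) by (simp add: F_def)
  have prod: "(\<Prod>k\<in>I. F k (x k)) = X (x i) * X (x j)" for x
  proof -
    have "(\<Prod>k\<in>I. F k (x k)) = (\<Prod>k\<in>{i, j}. F k (x k))"
      using assms by (intro prod.mono_neutral_right) (auto simp: F_def)
    also have "\<dots> = X (x i) * X (x j)" using \<open>i \<noteq> j\<close> by (simp add: F_def)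
    finally show ?thesis .
  qed
  have "(\<integral>x. (\<Prod>k\<in>I. F k (x k)) \<partial>(\<Pi>\<^sub>M i\<in>I. M)) = (\<Prod>k\<in>I. \<integral>x. F k x \<partial>M)"
    by (rule P.product_integral_prod[OF assms(1)]) (rule F)
  also have "\<dots> = 0"
    using assms by (intro prod_zero[OF assms(1)] bexI[of _ i]) (auto simp: F_def)
  finally show "(\<integral>x. X (x i) * X (x j) \<partial>(\<Pi>\<^sub>M i\<in>I. M)) = 0" by (simp add: prod)
  show "integrable (\<Pi>\<^sub>M i\<in>I. M) (\<lambda>x. X (x i) * X (x j))"
    using P.product_integrable_prod[OF assms(1), of F] F by (simp add: prod)
qed

lemma
  fixes X :: "'a \<Rightarrow> real"
  assumes "finite I" and X[measurable]: "X \<in> borel_measurable M" and X2: "integrable M (\<lambda>x. (X x)\<^sup>2)"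
    and X0: "(\<integral>x. X x \<partial>M) = 0"
  shows integral_PiM_sum_square: "(\<integral>x. (\<Sum>i\<in>I. X (x i))\<^sup>2 \<partial>(\<Pi>\<^sub>M i\<in>I. M)) = card I * (\<integral>x. (X x)\<^sup>2 \<partial>M)"
    and integrable_PiM_sum_square: "integrable (\<Pi>\<^sub>M i\<in>I. M) (\<lambda>x. (\<Sum>i\<in>I. X (x i))\<^sup>2)"
proof -
  let ?P = "\<Pi>\<^sub>M i\<in>I. M"
  have X1: "integrable M X" by (rule square_integrable_imp_integrable[OF X X2])
  have i: "integrable ?P (\<lambda>x. X (x i) * X (x j))" if "i \<in> I" "j \<in> I" for i j
    using integral_PiM_cross(2)[OF assms(1) that _ X1 X0]
      integrable_PiM_component[OF that(1), of "\<lambda>x. (X x)\<^sup>2"] X2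
    by (cases "i = j") (simp_all add: power2_eq_square)
  have e: "(\<integral>x. X (x i) * X (x j) \<partial>?P) = (if i = j then (\<integral>x. (X x)\<^sup>2 \<partial>M) else 0)"
    if "i \<in> I" "j \<in> I" for i j
    using integral_PiM_cross(1)[OF assms(1) that _ X1 X0]
      integral_PiM_component[OF that(1), of "\<lambda>x. (X x)\<^sup>2"]
    by (cases "i = j") (simp_all add: power2_eq_square)
  have sq: "(\<Sum>i\<in>I. X (x i))\<^sup>2 = (\<Sum>i\<in>I. \<Sum>j\<in>I. X (x i) * X (x j))" for x
    by (simp add: power2_eq_square sum_product)
  show "integrable ?P (\<lambda>x. (\<Sum>i\<in>I. X (x i))\<^sup>2)"
    unfolding sq using i by (intro Bochner_Integration.integrable_sum)
  have "(\<integral>x. (\<Sum>i\<in>I. X (x i))\<^sup>2 \<partial>?P) = (\<Sum>i\<in>I. \<Sum>j\<in>I. \<integral>x. X (x i) * X (x j) \<partial>?P)"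
    unfolding sq using i by (simp add: Bochner_Integration.integral_sum)
  also have "\<dots> = (\<Sum>i\<in>I. \<Sum>j\<in>I. if i = j then (\<integral>x. (X x)\<^sup>2 \<partial>M) else 0)"
    by (intro sum.cong refl e)
  also have "\<dots> = card I * (\<integral>x. (X x)\<^sup>2 \<partial>M)" using assms(1) by simp
  finally show "(\<integral>x. (\<Sum>i\<in>I. X (x i))\<^sup>2 \<partial>?P) = card I * (\<integral>x. (X x)\<^sup>2 \<partial>M)" .
qed

end

lemma char_normal_distribution:
  assumes "0 < \<sigma>"
  shows "char (density lborel (normal_density 0 \<sigma>)) t = exp (- (\<sigma>\<^sup>2 * t\<^sup>2) / 2)"
proof -
  interpret S: prob_space std_normal_distribution
    using real_dist_normal_dist by (simp add: real_distribution_def)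
  have "distributed std_normal_distribution lborel (\<lambda>x. x) std_normal_density"
    by (simp add: distributed_def distr_id2 cong: distr_cong)
  from S.normal_density_affine[OF this, of \<sigma> 0] assms
  have "density lborel (normal_density 0 \<sigma>) = distr std_normal_distribution lborel (\<lambda>x. \<sigma> * x)"
    by (simp add: distributed_def)
  then have "char (density lborel (normal_density 0 \<sigma>)) t = char std_normal_distribution (t * \<sigma>)"
    by (simp add: char_def integral_distr mult.assoc)
  then show ?thesis by (simp add: char_std_normal_distribution power_mult_distrib mult.commute)
qed

lemma real_distribution_normal:
  assumes "0 < \<sigma>" shows "real_distribution (density lborel (normal_density 0 \<sigma>))"
  using prob_space_normal_density[OF assms] by (simp add: real_distribution_def real_distribution_axioms_def)

text \<open>Path laws are probability measures for large \<open>n\<close> only. Shifting the index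
  past the exceptions makes Levy's continuity theorems applicable, which ask for a distribution at
  every index.\<close>

lemma weak_conv_m_offset: "weak_conv_m (\<lambda>n. M (n + N)) L \<longleftrightarrow> weak_conv_m M L"
proof -
  have "(\<lambda>n. cdf (M (n + N)) x) \<longlonglongrightarrow> l \<longleftrightarrow> (\<lambda>n. cdf (M n) x) \<longlonglongrightarrow> l" for x l
    using LIMSEQ_offset[of "\<lambda>n. cdf (M n) x" N l]
      LIMSEQ_ignore_initial_segment[of "\<lambda>n. cdf (M n) x" l N] by auto
  then show ?thesis by (simp add: weak_conv_m_def weak_conv_def)
qed

lemma weak_conv_m_iff_char:
  assumes M: "\<forall>\<^sub>F n in sequentially. real_distribution (M n)" and L: "real_distribution L"
  shows "weak_conv_m M L \<longleftrightarrow> (\<forall>t. (\<lambda>n. char (M n) t) \<longlonglongrightarrow> char L t)"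
proof -
  obtain N where N: "\<And>n. real_distribution (M (n + N))"
    using M unfolding eventually_sequentially by (metis le_add2)
  show ?thesis
  proof
    assume "weak_conv_m M L"
    then have w: "weak_conv_m (\<lambda>n. M (n + N)) L" by (simp add: weak_conv_m_offset)
    have "(\<lambda>n. char (M (n + N)) t) \<longlonglongrightarrow> char L t" for t
      using levy_continuity1[OF N L w] .
    then show "\<forall>t. (\<lambda>n. char (M n) t) \<longlonglongrightarrow> char L t"
      by (intro allI) (rule LIMSEQ_offset)
  next
    assume c: "\<forall>t. (\<lambda>n. char (M n) t) \<longlonglongrightarrow> char L t"
    have "weak_conv_m (\<lambda>n. M (n + N)) L"
      by (rule levy_continuity[OF N L]) (rule LIMSEQ_ignore_initial_segment[OF c[rule_format]])
    then show "weak_conv_m M L" by (simp add: weak_conv_m_offset)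
  qed
qed

lemma weak_conv_m_tight:
  assumes w: "weak_conv_m M L" and L: "real_distribution L"
    and M: "\<forall>\<^sub>F n in sequentially. real_distribution (M n)" and "0 < e"
  obtains K where "0 < K" "\<forall>\<^sub>F n in sequentially. measure (M n) {x. K < \<bar>x\<bar>} < e"
proof -
  interpret L: real_distribution L by (rule L)
  interpret Lf: finite_borel_measure L by (rule L.finite_borel_measure_M)
  \<comment> \<open>Weak convergence gives limits of the distribution functions only at continuity
    points of the limit. The discontinuities are countable, so every interval contains a continuity
    point.\<close>
  have countable: "countable {x. \<not> isCont (cdf L) x}"
    using L.countable_atoms L.isCont_cdf by (simp add: zero_less_measure_iff)
  have dense: "\<exists>x. a < x \<and> x < b \<and> isCont (cdf L) x" if "a < b" for a b
  proof (rule ccontr)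
    assume "\<not> ?thesis"
    then have "{a<..<b} \<subseteq> {x. \<not> isCont (cdf L) x}" by auto
    then have "countable {a<..<b}" using countable by (rule countable_subset)
    then show False using uncountable_open_interval[of a b] that by simp
  qed
  have "\<forall>\<^sub>F x in at_top. 1 - e / 3 < cdf L x"
    using L.cdf_lim_at_top_prob \<open>0 < e\<close> by (intro order_tendstoD) auto
  then obtain b0 where b0: "\<And>x. x \<ge> b0 \<Longrightarrow> 1 - e / 3 < cdf L x" by (auto simp: eventually_at_top_linorder)
  have "\<forall>\<^sub>F x in at_bot. cdf L x < e / 3"
    using L.cdf_lim_at_bot \<open>0 < e\<close> by (intro order_tendstoD) auto
  then obtain a0 where a0: "\<And>x. x \<le> a0 \<Longrightarrow> cdf L x < e / 3" by (auto simp: eventually_at_bot_linorder)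
  obtain b where b: "b0 < b" "isCont (cdf L) b" using dense[of b0 "b0 + 1"] by auto
  obtain a where a: "a < a0" "isCont (cdf L) a" using dense[of "a0 - 1" a0] by auto
  define K where "K = max 1 (max \<bar>a\<bar> \<bar>b\<bar>)"
  have "(\<lambda>n. cdf (M n) b) \<longlonglongrightarrow> cdf L b" "(\<lambda>n. cdf (M n) a) \<longlonglongrightarrow> cdf L a"
    using w a(2) b(2) by (auto simp: weak_conv_m_def weak_conv_def)
  then have "\<forall>\<^sub>F n in sequentially. 1 - e / 3 < cdf (M n) b" "\<forall>\<^sub>F n in sequentially. cdf (M n) a < e / 3"
    using order_tendstoD b0[of b] a0[of a] a b by (fastforce intro: less_imp_le)+
  then have "\<forall>\<^sub>F n in sequentially. measure (M n) {x. K < \<bar>x\<bar>} < e"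
    using M
  proof eventually_elim
    case (elim n)
    interpret Mn: real_distribution "M n" by (rule elim(3))
    have [simp]: "A \<in> sets (M n)" if "A \<in> sets borel" for A using that by simp
    have "measure (M n) {x. K < \<bar>x\<bar>} \<le> measure (M n) ({..a} \<union> (UNIV - {..b}))"
      by (intro Mn.finite_measure_mono) (auto simp: K_def)
    also have "\<dots> \<le> measure (M n) {..a} + measure (M n) (UNIV - {..b})"
      by (intro measure_Un_le) auto
    also have "measure (M n) (UNIV - {..b}) = 1 - measure (M n) {..b}"
      using Mn.prob_compl[of "{..b}"] by simp
    finally show ?case using elim(1,2) \<open>0 < e\<close> by (simp add: cdf_def)
  qed
  then show thesis by (intro that[of K]) (auto simp: K_def)
qed

lemma iexp_Lipschitz: "cmod (iexp a - iexp b) \<le> \<bar>a - b\<bar>"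
proof -
  have "iexp a - iexp b = iexp b * (iexp (a - b) - 1)"
    by (simp add: algebra_simps flip: exp_add)
  then have "cmod (iexp a - iexp b) = cmod (iexp (a - b) - 1)"
    by (simp add: norm_mult)
  also have "\<dots> \<le> \<bar>a - b\<bar>" using iexp_approx1[of "a - b" 0] by simp
  finally show ?thesis .
qed

text \<open>Lindeberg's argument; for bounded summands the third-order remainder is uniform over the row.\<close>

lemma char_row_limit:
  fixes Q :: "nat \<Rightarrow> 'a measure" and W :: "nat \<Rightarrow> 'a \<Rightarrow> real"
  assumes Q: "\<forall>\<^sub>F n in sequentially. prob_space (Q n)"
    and W: "\<And>n. W n \<in> borel_measurable (Q n)"
    and bounded: "\<forall>\<^sub>F n in sequentially. \<forall>x\<in>space (Q n). \<bar>W n x\<bar> \<le> C"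
    and mean: "\<forall>\<^sub>F n in sequentially. (\<integral>x. W n x \<partial>Q n) = 0"
    and var: "(\<lambda>n. \<integral>x. (W n x)\<^sup>2 \<partial>Q n) \<longlonglongrightarrow> v"
  shows "(\<lambda>n. \<integral>x. iexp (u * (\<Sum>i<n. W n (x i) / sqrt n)) \<partial>(\<Pi>\<^sub>M i\<in>{..<n}. Q n))
    \<longlonglongrightarrow> exp (- (v * u\<^sup>2) / 2)"
proof -
  define z where "z n = (\<integral>x. iexp (u / sqrt n * W n x) \<partial>Q n)" for n
  define w :: "nat \<Rightarrow> real" where "w n = 1 + (- (v * u\<^sup>2) / 2) / n" for n
  define v' where "v' n = (\<integral>x. (W n x)\<^sup>2 \<partial>Q n)" for n
  have prod: "\<forall>\<^sub>F n in sequentially.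
      (\<integral>x. iexp (u * (\<Sum>i<n. W n (x i) / sqrt n)) \<partial>(\<Pi>\<^sub>M i\<in>{..<n}. Q n)) = z n ^ n"
    using Q
  proof eventually_elim
    case (elim n)
    interpret Qn: prob_space "Q n" by (rule elim)
    interpret P: product_sigma_finite "\<lambda>_. Q n"
      unfolding product_sigma_finite_def by (simp add: Qn.sigma_finite_measure_axioms)
    have "iexp (u * (\<Sum>i<n. W n (x i) / sqrt n)) = (\<Prod>i<n. iexp (u / sqrt n * W n (x i)))" for x
      by (simp add: exp_sum[symmetric] sum_distrib_left)
    then have "(\<integral>x. iexp (u * (\<Sum>i<n. W n (x i) / sqrt n)) \<partial>(\<Pi>\<^sub>M i\<in>{..<n}. Q n))
        = (\<integral>x. (\<Prod>i<n. iexp (u / sqrt n * W n (x i))) \<partial>(\<Pi>\<^sub>M i\<in>{..<n}. Q n))"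
      by simp
    also have "\<dots> = (\<Prod>i<n. z n)"
      unfolding z_def using W[of n]
      by (intro P.product_integral_prod Qn.integrable_iexp) auto
    finally show ?case by simp
  qed
  \<comment> \<open>For complex numbers of modulus at most 1,
    \<open>\<bar>z ^ n - w ^ n\<bar> \<le> n * \<bar>z - w\<bar>\<close>. The factor
    \<open>n\<close> meets a third-order Taylor remainder of order \<open>n powr (-3/2)\<close> and
    a variance error of order \<open>\<bar>v' n - v\<bar> / n\<close>. Nonnegativity of
    \<open>v\<close> and \<open>- 1 < w n\<close> keep \<open>w n\<close> in the unit disc.\<close>
  have approx: "\<forall>\<^sub>F n in sequentially. cmod (z n ^ n - of_real (w n) ^ n)
      \<le> \<bar>u\<bar> ^ 3 * \<bar>C\<bar> ^ 3 / 6 * (1 / sqrt n) + u\<^sup>2 / 2 * \<bar>v' n - v\<bar>"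
  proof -
    have v: "0 \<le> v" using var by (rule LIMSEQ_le_const) auto
    have "(\<lambda>n. 1 + (- (v * u\<^sup>2) / 2) / real n) \<longlonglongrightarrow> 1 + 0"
      by (intro tendsto_intros tendsto_divide_0[OF tendsto_const] filterlim_at_top_imp_at_infinity
          filterlim_real_sequentially)
    then have "\<forall>\<^sub>F n in sequentially. - 1 < w n" unfolding w_def by (intro order_tendstoD) auto
    then show ?thesis
      using Q bounded mean eventually_ge_at_top[of 1]
    proof eventually_elim
      case (elim n)
      interpret Qn: prob_space "Q n" by (rule elim)
      note [measurable] = W[of n]
      have i1: "integrable (Q n) (W n)"
        by (rule Qn.integrable_const_bound[where B = C]) (use elim in auto)
      have i2: "integrable (Q n) (\<lambda>x. (W n x)\<^sup>2)"
      proof (rule Qn.integrable_const_bound[where B = "\<bar>C\<bar>\<^sup>2"])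
        show "AE x in Q n. norm ((W n x)\<^sup>2) \<le> \<bar>C\<bar>\<^sup>2"
          using elim(3) power_mono[of "\<bar>W n _\<bar>" "\<bar>C\<bar>" 2] by (intro AE_I2) fastforce
      qed measurable
      let ?t = "u / sqrt n"
      have "char (distr (Q n) borel (W n)) ?t = z n"
        by (simp add: char_def integral_distr z_def)
      then have "cmod (z n - (1 - ?t\<^sup>2 * v' n / 2))
          \<le> ?t\<^sup>2 / 6 * (\<integral>x. min (6 * (W n x)\<^sup>2) (\<bar>?t\<bar> * \<bar>W n x\<bar> ^ 3) \<partial>Q n)"
        using Qn.char_approx3'[OF W i1 i2 elim(4) _ refl, of "v' n" ?t] elim(4) by (simp add: v'_def)
      also have "(\<integral>x. min (6 * (W n x)\<^sup>2) (\<bar>?t\<bar> * \<bar>W n x\<bar> ^ 3) \<partial>Q n) \<le> (\<integral>x. \<bar>?t\<bar> * \<bar>C\<bar> ^ 3 \<partial>Q n)"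
      proof (rule integral_mono)
        have le: "\<bar>?t\<bar> * \<bar>W n x\<bar> ^ 3 \<le> \<bar>?t\<bar> * \<bar>C\<bar> ^ 3" if "x \<in> space (Q n)" for x
          using elim(3) that by (intro mult_left_mono power_mono) auto
        show "min (6 * (W n x)\<^sup>2) (\<bar>?t\<bar> * \<bar>W n x\<bar> ^ 3) \<le> \<bar>?t\<bar> * \<bar>C\<bar> ^ 3"
          if "x \<in> space (Q n)" for x
          using le[OF that] by (rule min.coboundedI2)
        show "integrable (Q n) (\<lambda>x. min (6 * (W n x)\<^sup>2) (\<bar>?t\<bar> * \<bar>W n x\<bar> ^ 3))"
        proof (rule Qn.integrable_const_bound[where B = "\<bar>?t\<bar> * \<bar>C\<bar> ^ 3"])
          show "AE x in Q n. norm (min (6 * (W n x)\<^sup>2) (\<bar>?t\<bar> * \<bar>W n x\<bar> ^ 3)) \<le> \<bar>?t\<bar> * \<bar>C\<bar> ^ 3"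
          proof (rule AE_I2)
            fix x assume "x \<in> space (Q n)"
            moreover have "0 \<le> min (6 * (W n x)\<^sup>2) (\<bar>?t\<bar> * \<bar>W n x\<bar> ^ 3)" by simp
            ultimately show "norm (min (6 * (W n x)\<^sup>2) (\<bar>?t\<bar> * \<bar>W n x\<bar> ^ 3)) \<le> \<bar>?t\<bar> * \<bar>C\<bar> ^ 3"
              using le[of x] unfolding real_norm_def by (metis abs_of_nonneg min.coboundedI2)
          qed
        qed measurable
      qed simp
      finally have "cmod (z n - (1 - ?t\<^sup>2 * v' n / 2)) \<le> ?t\<^sup>2 / 6 * (\<bar>?t\<bar> * \<bar>C\<bar> ^ 3)"
        by (simp add: Qn.prob_space mult_left_mono)
      moreover have "cmod ((1 - ?t\<^sup>2 * v' n / 2) - of_real (w n)) = ?t\<^sup>2 / 2 * \<bar>v' n - v\<bar>"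
      proof -
        have "(1 - ?t\<^sup>2 * v' n / 2) - w n = ?t\<^sup>2 / 2 * (v - v' n)"
          using elim(5) by (simp add: w_def power_divide field_simps)
        then have "complex_of_real (1 - ?t\<^sup>2 * v' n / 2) - of_real (w n) = of_real (?t\<^sup>2 / 2 * (v - v' n))"
          by (simp only: of_real_diff[symmetric])
        then have "cmod (complex_of_real (1 - ?t\<^sup>2 * v' n / 2) - of_real (w n)) = \<bar>?t\<^sup>2 / 2 * (v - v' n)\<bar>"
          by (simp only: norm_of_real)
        then show ?thesis by (simp add: abs_mult abs_minus_commute)
      qed
      ultimately have zw: "cmod (z n - of_real (w n)) \<le> ?t\<^sup>2 / 6 * (\<bar>?t\<bar> * \<bar>C\<bar> ^ 3) + ?t\<^sup>2 / 2 * \<bar>v' n - v\<bar>"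
        using norm_triangle_ineq[of "z n - (1 - ?t\<^sup>2 * v' n / 2)" "(1 - ?t\<^sup>2 * v' n / 2) - of_real (w n)"]
        by simp
      have "cmod (z n) \<le> 1"
      proof -
        have "cmod (z n) \<le> (\<integral>x. norm (iexp (?t * W n x)) \<partial>Q n)"
          unfolding z_def by (rule integral_norm_bound)
        then show ?thesis by (simp add: Qn.prob_space)
      qed
      moreover have "cmod (of_real (w n)) \<le> 1"
      proof -
        have "w n \<le> 1" using v by (simp add: w_def)
        then show ?thesis using elim(1) by (simp add: abs_le_iff)
      qed
      ultimately have "cmod (z n ^ n - of_real (w n) ^ n) \<le> n * cmod (z n - of_real (w n))"
        by (rule norm_power_diff)
      also have "\<dots> \<le> n * (?t\<^sup>2 / 6 * (\<bar>?t\<bar> * \<bar>C\<bar> ^ 3) + ?t\<^sup>2 / 2 * \<bar>v' n - v\<bar>)"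
        using zw by (rule mult_left_mono) simp
      also have "\<dots> = \<bar>u\<bar> ^ 3 * \<bar>C\<bar> ^ 3 / 6 * (1 / sqrt n) + u\<^sup>2 / 2 * \<bar>v' n - v\<bar>"
      proof -
        have t: "n * ?t\<^sup>2 = u\<^sup>2" using elim(5) by (simp add: power_divide)
        have "n * (?t\<^sup>2 / 6 * (\<bar>?t\<bar> * \<bar>C\<bar> ^ 3) + ?t\<^sup>2 / 2 * \<bar>v' n - v\<bar>)
            = (n * ?t\<^sup>2) / 6 * (\<bar>?t\<bar> * \<bar>C\<bar> ^ 3) + (n * ?t\<^sup>2) / 2 * \<bar>v' n - v\<bar>"
          by (simp add: distrib_left)
        also have "\<dots> = \<bar>u\<bar> ^ 3 * \<bar>C\<bar> ^ 3 / 6 * (1 / sqrt n) + u\<^sup>2 / 2 * \<bar>v' n - v\<bar>"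
          unfolding t by (simp add: abs_divide power2_eq_square power3_eq_cube abs_mult_self_eq flip: abs_mult)
        finally show ?thesis .
      qed
      finally show ?case .
    qed
  qed
  have "(\<lambda>n. \<bar>u\<bar> ^ 3 * \<bar>C\<bar> ^ 3 / 6 * (1 / sqrt (real n)) + u\<^sup>2 / 2 * \<bar>v' n - v\<bar>)
      \<longlonglongrightarrow> \<bar>u\<bar> ^ 3 * \<bar>C\<bar> ^ 3 / 6 * 0 + u\<^sup>2 / 2 * \<bar>v - v\<bar>"
    unfolding v'_def by (intro tendsto_intros inverse_sqrt_tendsto_0 var)
  then have err: "(\<lambda>n. \<bar>u\<bar> ^ 3 * \<bar>C\<bar> ^ 3 / 6 * (1 / sqrt (real n)) + u\<^sup>2 / 2 * \<bar>v' n - v\<bar>) \<longlonglongrightarrow> 0"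
    by simp
  have "(\<lambda>n. complex_of_real (w n ^ n)) \<longlonglongrightarrow> of_real (exp (- (v * u\<^sup>2) / 2))"
    unfolding w_def by (intro tendsto_of_real tendsto_exp_limit_sequentially)
  then have "(\<lambda>n. z n ^ n) \<longlonglongrightarrow> of_real (exp (- (v * u\<^sup>2) / 2))"
    by (rule Lim_transform) (use Lim_null_comparison[OF approx err] in simp)
  then show ?thesis
    by (rule Lim_transform_eventually) (use prod in \<open>auto elim: eventually_mono\<close>)
qed

section \<open>Efficiency\<close>

context mixture_model
begin

lemma path_score_L2:
  assumes g: "g \<in> path_set"
  shows "integrable P (\<lambda>x. (score g x)\<^sup>2)"
proof -
  note [measurable] = path_score_borel[OF g]
  have g': "(fst g, snd g) \<in> path_set" using g by simp
  note [measurable] = tilt_borel[OF g']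
  define N where "N x = fst g * (1 - f x) - (- (1 - \<theta>) * tilt (snd g) x)" for x
  have [measurable]: "N \<in> borel_measurable unit_lborel" unfolding N_def[abs_def] by measurable
  have "integrable unit_lborel (\<lambda>x. (N x)\<^sup>2)"
    unfolding N_def
  proof (rule integrable_diff_L2)
    show "integrable unit_lborel (\<lambda>x. (fst g * (1 - f x))\<^sup>2)"
    proof (rule integrable_bounded_square)
      fix x :: real assume "x \<in> {0..1}"
      then show "\<bar>fst g * (1 - f x)\<bar> \<le> \<bar>fst g\<bar> * (1 + f 0)"
        unfolding abs_mult using f_le[of x] f_nonneg[of x] by (intro mult_left_mono) auto
    qed measurable
    have "(\<lambda>x. (- (1 - \<theta>) * tilt (snd g) x)\<^sup>2) = (\<lambda>x. (1 - \<theta>)\<^sup>2 * (tilt (snd g) x)\<^sup>2)"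
      unfolding power_mult_distrib power2_minus ..
    then show "integrable unit_lborel (\<lambda>x. (- (1 - \<theta>) * tilt (snd g) x)\<^sup>2)"
      using tilt_L2[OF g'] by simp
  qed measurable
  then have i: "integrable unit_lborel (\<lambda>x. (N x)\<^sup>2 / \<theta>)" by simp
  have "integrable unit_lborel (\<lambda>x. p x * (score g x)\<^sup>2)"
  proof (rule Bochner_Integration.integrable_bound[OF i])
    show "AE x in unit_lborel. norm (p x * (score g x)\<^sup>2) \<le> norm ((N x)\<^sup>2 / \<theta>)"
    proof (rule AE_I2)
      fix x assume "x \<in> space unit_lborel"
      then have x: "x \<in> {0..1}" by simp
      have "score g x = N x / p x" by (simp add: path_score_eq N_def left_diff_distrib)
      then have "p x * (score g x)\<^sup>2 = (N x)\<^sup>2 / p x"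
        using p_pos[OF x] by (simp add: power2_eq_square)
      also have "\<dots> \<le> (N x)\<^sup>2 / \<theta>"
        using p_ge[OF x] theta by (intro divide_left_mono) auto
      finally show "norm (p x * (score g x)\<^sup>2) \<le> norm ((N x)\<^sup>2 / \<theta>)"
        using p_pos[OF x] theta by simp
    qed
  qed measurable
  then show ?thesis by (subst integrable_mix[OF f_dens theta01(1)]) auto
qed

context
  assumes delta_pos: "0 < \<delta>"
begin

lemma infl_bounded: "\<bar>infl x\<bar> \<le> 1 / \<delta> + 1"
  using delta_pos theta unfolding infl_def by (auto simp: abs_le_iff add_increasing split: split_indicator)

lemma integrable_infl_square: "integrable P (\<lambda>x. (infl x)\<^sup>2)"
proof -
  interpret prob_space P by (rule prob_space_mix[OF f_dens theta01(1)])
  show ?thesis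
    by (rule integrable_const_bound[where B = "(1 / \<delta> + 1)\<^sup>2"])
      (use power_mono[OF infl_bounded, where n = 2] in \<open>auto intro!: AE_I2\<close>)
qed

text \<open>On the tail \<open>f\<close> and \<open>tilt\<close> vanish, so the indicator part
  contributes \<open>fst g\<close>. The constant part \<open>- \<theta>\<close> meets
  \<open>1 - f\<close> and \<open>tilt\<close>, both of Lebesgue mean 0.\<close>

lemma integral_infl_path_score:
  assumes g: "g \<in> path_set"
  shows "(\<integral>x. infl x * score g x \<partial>P) = fst g"
proof -
  have g': "(fst g, snd g) \<in> path_set" using g by simp
  note [measurable] = path_score_borel[OF g]
  have ind: "integrable unit_lborel (indicator {1-\<delta>..1} :: real \<Rightarrow> real)"
    by (rule unit_lborel.integrable_const_bound[where B = 1]) auto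
  have "(\<integral>x. infl x * score g x \<partial>P) = (\<integral>x. p x * (infl x * score g x) \<partial>unit_lborel)"
    by (rule integral_mix[OF f_dens theta01(1)]) measurable
  also have "\<dots> = (\<integral>x. fst g * (indicator {1-\<delta>..1} x / \<delta> - \<theta> * (1 - f x))
      - \<theta> * (1 - \<theta>) * tilt (snd g) x \<partial>unit_lborel)"
  proof (rule Bochner_Integration.integral_cong[OF refl])
    fix x assume "x \<in> space unit_lborel"
    then have x: "x \<in> {0..1}" by simp
    have "p x * (infl x * score g x) = infl x * (fst g * (1 - f x) + (1 - \<theta>) * tilt (snd g) x)"
      using p_pos[OF x] by (simp add: path_score_eq)
    also have "\<dots> = fst g * (indicator {1-\<delta>..1} x / \<delta> - \<theta> * (1 - f x)) - \<theta> * (1 - \<theta>) * tilt (snd g) x"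
      using f_zero[of x] x by (cases "x < 1 - \<delta>") (auto simp: infl_def tilt_def algebra_simps)
    finally show "p x * (infl x * score g x)
      = fst g * (indicator {1-\<delta>..1} x / \<delta> - \<theta> * (1 - f x)) - \<theta> * (1 - \<theta>) * tilt (snd g) x" .
  qed
  also have "\<dots> = fst g"
    using ind f_integrable f_integral tilt_integrable[OF g'] tilt_integral[OF g']
      integral_indicator_tail[of \<delta>] delta delta_pos unit_lborel.prob_space by simp
  finally show ?thesis .
qed

text \<open>A single score, that of the least favourable path, equals \<open>infl\<close> on
  \<open>[0,1]\<close> and serves as the approximating element for every
  \<open>\<epsilon>\<close>.\<close>

lemma efficient_influence_infl: "efficient_influence \<delta> \<theta> f infl"
proof -
  have "infl \<in> closed_lin_span P (score ` path_set)"
    unfolding closed_lin_span_def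
  proof (intro CollectI conjI allI impI)
    show "infl \<in> L2 P"
      using integrable_infl_square infl_borel by (simp add: L2_def cong: measurable_cong_sets add: sets_mix)
    fix \<epsilon> :: real assume "0 < \<epsilon>"
    let ?s = "score (opt_var, opt_h)"
    show "\<exists>s\<in>lin_span (score ` path_set). (\<integral>\<^sup>+x. ennreal ((infl x - s x)\<^sup>2) \<partial>P) < ennreal \<epsilon>"
    proof (rule bexI[of _ ?s])
      have "(\<integral>\<^sup>+x. ennreal ((infl x - ?s x)\<^sup>2) \<partial>P) = (\<integral>\<^sup>+x. 0 \<partial>P)"
        using path_score_opt[OF delta_pos] by (intro nn_integral_cong) auto
      then show "(\<integral>\<^sup>+x. ennreal ((infl x - ?s x)\<^sup>2) \<partial>P) < ennreal \<epsilon>" using \<open>0 < \<epsilon>\<close> by simp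
      show "?s \<in> lin_span (score ` path_set)"
        unfolding lin_span_def using opt_path_in[OF delta_pos]
        by (auto intro!: exI[of _ "Suc 0"] exI[of _ "\<lambda>_. 1"] exI[of _ "\<lambda>_. ?s"])
    qed
  qed
  then show ?thesis using integral_infl_path_score by (simp add: efficient_influence_def)
qed

text \<open>The difference \<open>q\<close> of \<open>\<phi>\<close> and \<open>infl\<close> is
  orthogonal to all scores, hence to their closed span and in particular to \<open>\<phi>\<close>.
  So the squared norm of \<open>\<phi>\<close> equals its pairing with \<open>infl\<close>, which is
  \<open>opt_var\<close> because \<open>infl\<close> is itself a score.\<close>

lemma efficient_influence_variance:
  assumes "efficient_influence \<delta> \<theta> f \<phi>"
  shows "(\<integral>x. (\<phi> x)\<^sup>2 \<partial>P) = opt_var"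
proof -
  have span: "\<phi> \<in> closed_lin_span P (score ` path_set)"
    and rep: "\<And>g. g \<in> path_set \<Longrightarrow> (\<integral>x. \<phi> x * score g x \<partial>P) = fst g"
    using assms by (auto simp: efficient_influence_def)
  from span have \<phi>[measurable]: "\<phi> \<in> borel_measurable P" and \<phi>2: "integrable P (\<lambda>x. (\<phi> x)\<^sup>2)"
    by (auto simp: closed_lin_span_def L2_def)
  have infl_P[measurable]: "infl \<in> borel_measurable P" using infl_borel by measurable
  define q where "q x = \<phi> x - infl x" for x
  have [measurable]: "q \<in> borel_measurable P" unfolding q_def[abs_def] by measurable
  have q2: "integrable P (\<lambda>x. (q x)\<^sup>2)"
    unfolding q_def by (rule integrable_diff_L2[OF \<phi> infl_P \<phi>2 integrable_infl_square])
  have score_P: "score g \<in> borel_measurable P" if "g \<in> path_set" for g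
    using path_score_borel[OF that] by measurable
  have \<phi>infl: "(\<integral>x. \<phi> x * infl x \<partial>P) = opt_var"
  proof -
    have "(\<integral>x. \<phi> x * infl x \<partial>P) = (\<integral>x. \<phi> x * score (opt_var, opt_h) x \<partial>P)"
      using path_score_opt[OF delta_pos] by (intro Bochner_Integration.integral_cong) auto
    then show ?thesis using rep[OF opt_path_in[OF delta_pos]] by simp
  qed
  have dist: "(\<integral>x. (\<phi> x)\<^sup>2 \<partial>P) - opt_var = (\<integral>x. q x * \<phi> x \<partial>P)"
  proof -
    have "(\<integral>x. q x * \<phi> x \<partial>P) = (\<integral>x. (\<phi> x)\<^sup>2 - \<phi> x * infl x \<partial>P)"
      by (simp add: q_def power2_eq_square algebra_simps)
    also have "\<dots> = (\<integral>x. (\<phi> x)\<^sup>2 \<partial>P) - opt_var"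
      using \<phi>2 integrable_mult_L2[OF \<phi> infl_P \<phi>2 integrable_infl_square] by (simp add: \<phi>infl)
    finally show ?thesis ..
  qed
  have orth: "(\<integral>x. q x * s x \<partial>P) = 0" "s \<in> borel_measurable P"
    if s: "s \<in> lin_span (score ` path_set)" for s
  proof -
    obtain m c S where S: "\<And>i. i < m \<Longrightarrow> S i \<in> score ` path_set"
      and s_eq: "s = (\<lambda>x. \<Sum>i<(m::nat). c i * S i x)"
      using s by (auto simp: lin_span_def)
    have meas: "S i \<in> borel_measurable P" if "i < m" for i using S[OF that] score_P by auto
    show "s \<in> borel_measurable P" unfolding s_eq using meas by measurable
    have i: "integrable P (\<lambda>x. q x * S i x)" "(\<integral>x. q x * S i x \<partial>P) = 0" if im: "i < m" for i
    proof -
      obtain g where g: "g \<in> path_set" "S i = score g" using S[OF im] by auto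
      note sc = score_P[OF g(1)] path_score_L2[OF g(1)]
      show "integrable P (\<lambda>x. q x * S i x)"
        unfolding g(2) by (rule integrable_mult_L2[OF _ sc(1) q2 sc(2)]) measurable
      show "(\<integral>x. q x * S i x \<partial>P) = 0"
        using integrable_mult_L2[OF \<phi> sc(1) \<phi>2 sc(2)]
          integrable_mult_L2[OF infl_P sc(1) integrable_infl_square sc(2)]
        by (simp add: g(2) q_def left_diff_distrib rep[OF g(1)] integral_infl_path_score[OF g(1)])
    qed
    have "(\<integral>x. q x * s x \<partial>P) = (\<integral>x. (\<Sum>i<m. c i * (q x * S i x)) \<partial>P)"
      unfolding s_eq by (simp add: sum_distrib_left mult.left_commute)
    also have "\<dots> = (\<Sum>i<m. c i * (\<integral>x. q x * S i x \<partial>P))"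
      using i(1) by (subst Bochner_Integration.integral_sum) auto
    also have "\<dots> = 0" using i(2) by simp
    finally show "(\<integral>x. q x * s x \<partial>P) = 0" .
  qed
  have bound: "\<bar>(\<integral>x. q x * \<phi> x \<partial>P)\<bar> \<le> sqrt (\<integral>x. (q x)\<^sup>2 \<partial>P) * e" if "0 < e" for e
  proof -
    have "0 < e\<^sup>2" using that by simp
    then obtain s where s: "s \<in> lin_span (score ` path_set)"
      and close: "(\<integral>\<^sup>+x. ennreal ((\<phi> x - s x)\<^sup>2) \<partial>P) < ennreal (e\<^sup>2)"
      using span unfolding closed_lin_span_def by blast
    note [measurable] = orth(2)[OF s]
    have d: "integrable P (\<lambda>x. (\<phi> x - s x)\<^sup>2)" "(\<integral>x. (\<phi> x - s x)\<^sup>2 \<partial>P) \<le> e\<^sup>2"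
      using nn_integral_square_le[of "\<lambda>x. \<phi> x - s x" P "e\<^sup>2"] close by auto
    have qs: "integrable P (\<lambda>x. q x * (\<phi> x - s x))"
      by (rule integrable_mult_L2[OF _ _ q2 d(1)]) measurable
    have q\<phi>: "integrable P (\<lambda>x. q x * \<phi> x)"
      by (rule integrable_mult_L2[OF _ _ q2 \<phi>2]) measurable
    have "(\<integral>x. q x * \<phi> x \<partial>P) = (\<integral>x. q x * (\<phi> x - s x) \<partial>P)"
    proof -
      have "(\<integral>x. q x * s x \<partial>P) = (\<integral>x. q x * \<phi> x - q x * (\<phi> x - s x) \<partial>P)"
        by (simp add: algebra_simps)
      then show ?thesis using orth(1)[OF s] qs q\<phi> by simp
    qed
    also have "\<bar>\<dots>\<bar> \<le> sqrt (\<integral>x. (q x)\<^sup>2 \<partial>P) * sqrt (\<integral>x. (\<phi> x - s x)\<^sup>2 \<partial>P)"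
      by (rule Cauchy_Schwarz_integral[OF _ _ q2 d(1)]) measurable
    also have "\<dots> \<le> sqrt (\<integral>x. (q x)\<^sup>2 \<partial>P) * e"
      using d(2) that by (intro mult_left_mono real_le_lsqrt) auto
    finally show ?thesis .
  qed
  have "((\<lambda>e. sqrt (\<integral>x. (q x)\<^sup>2 \<partial>P) * e) \<longlongrightarrow> sqrt (\<integral>x. (q x)\<^sup>2 \<partial>P) * 0) (at_right 0)"
    by (intro tendsto_intros)
  then have "\<bar>(\<integral>x. q x * \<phi> x \<partial>P)\<bar> \<le> sqrt (\<integral>x. (q x)\<^sup>2 \<partial>P) * 0"
    by (rule tendsto_lowerbound) (auto simp: eventually_at_right_less intro!: eventually_mono[OF eventually_at_right_less[of "0::real"]] bound)
  then show ?thesis using dist by simp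
qed

end

end

text \<open>A quantitative form of Slutsky's lemma: off the exceptional event \<open>iexp\<close> is
  Lipschitz, on it two unit complex numbers differ by at most 2.\<close>

lemma (in prob_space) char_perturbation:
  fixes U V :: "'a \<Rightarrow> real"
  assumes [measurable]: "U \<in> borel_measurable M" "V \<in> borel_measurable M" and "0 \<le> e"
  shows "cmod ((\<integral>x. iexp (u * U x) \<partial>M) - (\<integral>x. iexp (u * V x) \<partial>M))
    \<le> \<bar>u\<bar> * e + 2 * measure M {x \<in> space M. e < \<bar>U x - V x\<bar>}"
proof -
  let ?A = "{x \<in> space M. e < \<bar>U x - V x\<bar>}"
  have i: "integrable M (\<lambda>x. iexp (u * U x))" "integrable M (\<lambda>x. iexp (u * V x))"
    by (rule integrable_iexp, measurable)+
  have ind: "integrable M (indicator ?A :: 'a \<Rightarrow> real)"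
    by (rule integrable_const_bound[where B = 1]) auto
  have "cmod ((\<integral>x. iexp (u * U x) \<partial>M) - (\<integral>x. iexp (u * V x) \<partial>M))
      = cmod (\<integral>x. iexp (u * U x) - iexp (u * V x) \<partial>M)"
    using i by simp
  also have "\<dots> \<le> (\<integral>x. cmod (iexp (u * U x) - iexp (u * V x)) \<partial>M)"
    by (rule integral_norm_bound)
  also have "\<dots> \<le> (\<integral>x. \<bar>u\<bar> * e + 2 * indicator ?A x \<partial>M)"
  proof (rule integral_mono)
    show "integrable M (\<lambda>x. cmod (iexp (u * U x) - iexp (u * V x)))"
      using i by (intro integrable_norm Bochner_Integration.integrable_diff)
    show "integrable M (\<lambda>x. \<bar>u\<bar> * e + 2 * indicator ?A x)"
      using ind by simp
    fix x assume x: "x \<in> space M"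
    show "cmod (iexp (u * U x) - iexp (u * V x)) \<le> \<bar>u\<bar> * e + 2 * indicator ?A x"
    proof (cases "x \<in> ?A")
      case True
      have "cmod (iexp (u * U x) - iexp (u * V x)) \<le> cmod (iexp (u * U x)) + cmod (iexp (u * V x))"
        by (rule norm_triangle_ineq4)
      also have "\<dots> \<le> 2" by simp
      finally show ?thesis using True \<open>0 \<le> e\<close> by (simp add: add_increasing)
    next
      case False
      have "cmod (iexp (u * U x) - iexp (u * V x)) \<le> \<bar>u * U x - u * V x\<bar>"
        by (rule iexp_Lipschitz)
      also have "\<dots> = \<bar>u\<bar> * \<bar>U x - V x\<bar>"
        by (simp add: abs_mult flip: right_diff_distrib)
      also have "\<dots> \<le> \<bar>u\<bar> * e" using False x by (intro mult_left_mono) auto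
      finally show ?thesis using False by simp
    qed
  qed
  also have "\<dots> = \<bar>u\<bar> * e + 2 * measure M ?A"
    using ind by (simp add: prob_space Int_absorb2)
  finally show ?thesis .
qed

context mixture_model
begin

lemma measurable_sample_component:
  assumes [measurable]: "X \<in> borel_measurable unit_lborel" and "i < n"
  shows "(\<lambda>x. X (x i) :: real) \<in> borel_measurable (sample_law n (mix \<theta>' f'))"
  unfolding sample_law_def
  by (rule measurable_compose[OF measurable_component_singleton[of i]]) (use assms in \<open>auto simp: mix_def\<close>)

context
  assumes delta_pos: "0 < \<delta>"
begin

abbreviation tail_freq :: "nat \<Rightarrow> (nat \<Rightarrow> real) \<Rightarrow> real" where
  "tail_freq n X \<equiv> 1 / real n * (\<Sum>i<n. 1 / \<delta> * indicator {1-\<delta>..1} (X i))"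

lemma tail_freq_borel: "tail_freq n \<in> borel_measurable (sample_law n (mix \<theta>' f'))"
  by (intro borel_measurable_times borel_measurable_const borel_measurable_sum measurable_sample_component) auto

lemma tail_freq_eq:
  assumes "1 \<le> n"
  shows "sqrt n * (tail_freq n x - (\<theta> + a / sqrt n)) = (\<Sum>i<n. (infl (x i) - a / sqrt n) / sqrt n)"
proof -
  have n: "0 < sqrt n" using assms by simp
  have "(\<Sum>i<n. (infl (x i) - a / sqrt n) / sqrt n)
      = ((\<Sum>i<n. 1 / \<delta> * indicator {1-\<delta>..1} (x i)) - n * (\<theta> + a / sqrt n)) / sqrt n"
    by (simp add: infl_def sum_divide_distrib[symmetric] sum_subtractf algebra_simps)
  also have "\<dots> = sqrt n * (tail_freq n x - (\<theta> + a / sqrt n))"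
  proof -
    have "(A - real n * b) / sqrt n = sqrt n * (1 / real n * A - b)" for A b
      using n assms real_sqrt_mult_self[of "real n"] by (simp add: field_simps)
    then show ?thesis .
  qed
  finally show ?thesis ..
qed

text \<open>Every path density vanishes on the tail, so the law of the tail indicator depends on the
  moved parameter alone. Centring at that parameter gives mean 0 exactly, not just in the
  limit.\<close>

lemma path_law_infl:
  assumes g: "g \<in> path_set"
  shows "\<forall>\<^sub>F n in sequentially. prob_space (path_law \<delta> \<theta> f g (1 / sqrt n)) \<and>
    (\<integral>x. infl x - fst g / sqrt n \<partial>path_law \<delta> \<theta> f g (1 / sqrt n)) = 0 \<and>
    (\<integral>x. (infl x - fst g / sqrt n)\<^sup>2 \<partial>path_law \<delta> \<theta> f g (1 / sqrt n))
      = (\<theta> + fst g / sqrt n) * (1 / \<delta> - (\<theta> + fst g / sqrt n))"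
  using eventually_theta_path_bounds[of "fst g"]
proof eventually_elim
  case (elim n)
  define \<theta>' where "\<theta>' = \<theta> + fst g / sqrt n"
  have \<theta>': "\<theta>' \<in> {0..1}" using elim by (auto simp: \<theta>'_def)
  note F = path_f_dens_class[OF g, of n]
  define Q where "Q = path_law \<delta> \<theta> f g (1 / sqrt n)"
  have Q: "Q = mix \<theta>' (f_path \<delta> f (snd g) (1 / sqrt n))"
    by (simp add: Q_def path_law_eq \<theta>'_def)
  interpret Q: prob_space Q unfolding Q by (rule prob_space_mix[OF F \<theta>'])
  have [measurable]: "(indicator {1-\<delta>..1} :: real \<Rightarrow> real) \<in> borel_measurable Q"
    unfolding Q by measurable
  have ind: "integrable Q (indicator {1-\<delta>..1} :: real \<Rightarrow> real)"
    by (rule Q.integrable_const_bound[where B = 1]) auto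
  have m: "(\<integral>x. indicator {1-\<delta>..1} x \<partial>Q) = \<theta>' * \<delta>"
    unfolding Q using delta by (intro integral_indicator_mix[OF F _ \<theta>']) auto
  have c: "infl x - fst g / sqrt n = indicator {1-\<delta>..1} x / \<delta> - \<theta>'" for x
    by (simp add: infl_def \<theta>'_def)
  have "(\<integral>x. infl x - fst g / sqrt n \<partial>Q) = 0"
    unfolding c using ind m delta_pos Q.prob_space by simp
  moreover have "(\<integral>x. (infl x - fst g / sqrt n)\<^sup>2 \<partial>Q) = \<theta>' * (1 / \<delta> - \<theta>')"
  proof -
    have "(infl x - fst g / sqrt n)\<^sup>2 = (1 / \<delta>\<^sup>2 - 2 * \<theta>' / \<delta>) * indicator {1-\<delta>..1} x + \<theta>'\<^sup>2" for x
      by (auto simp: c power2_diff power_divide split: split_indicator)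
    then have "(\<integral>x. (infl x - fst g / sqrt n)\<^sup>2 \<partial>Q) = (1 / \<delta>\<^sup>2 - 2 * \<theta>' / \<delta>) * (\<theta>' * \<delta>) + \<theta>'\<^sup>2"
      using ind m Q.prob_space by simp
    also have "\<dots> = \<theta>' * (1 / \<delta> - \<theta>')"
      using delta_pos by (simp add: power2_eq_square field_simps)
    finally show ?thesis .
  qed
  ultimately show ?case using Q.prob_space_axioms by (simp add: Q_def \<theta>'_def)
qed

text \<open>The law of one observation changes with \<open>n\<close>, so a limit theorem for rows is
  required. Applying it under each path directly gives the regularity of the tail frequency without
  a change of measure.\<close>

lemma char_tail_freq:
  assumes g: "g \<in> path_set"
  shows "(\<lambda>n. \<integral>x. iexp (u * (sqrt n * (tail_freq n x - (\<theta> + fst g / sqrt n)))) \<partial>path_sample g n)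
    \<longlonglongrightarrow> exp (- (opt_var * u\<^sup>2) / 2)"
proof -
  let ?Q = "\<lambda>n. path_law \<delta> \<theta> f g (1 / sqrt (real n))"
  let ?W = "\<lambda>n x. infl x - fst g / sqrt (real n)"
  note ev = path_law_infl[OF g]
  have "(\<lambda>n. \<theta> + fst g * (1 / sqrt (real n))) \<longlonglongrightarrow> \<theta> + fst g * 0"
    by (intro tendsto_intros inverse_sqrt_tendsto_0)
  then have th: "(\<lambda>n. \<theta> + fst g / sqrt (real n)) \<longlonglongrightarrow> \<theta>" by simp
  have "(\<lambda>n. (\<theta> + fst g / sqrt (real n)) * (1 / \<delta> - (\<theta> + fst g / sqrt (real n))))
      \<longlonglongrightarrow> \<theta> * (1 / \<delta> - \<theta>)"
    by (intro tendsto_intros th)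
  then have var: "(\<lambda>n. \<integral>x. (?W n x)\<^sup>2 \<partial>?Q n) \<longlonglongrightarrow> opt_var"
    unfolding opt_var_def by (rule Lim_transform_eventually) (use ev in \<open>auto elim: eventually_mono\<close>)
  have "(\<lambda>n. \<integral>x. iexp (u * (\<Sum>i<n. ?W n (x i) / sqrt n)) \<partial>(\<Pi>\<^sub>M i\<in>{..<n}. ?Q n))
      \<longlonglongrightarrow> exp (- (opt_var * u\<^sup>2) / 2)"
  proof (rule char_row_limit[where Q = ?Q and W = ?W, OF _ _ _ _ var])
    show "\<forall>\<^sub>F n in sequentially. prob_space (?Q n)" "\<forall>\<^sub>F n in sequentially. (\<integral>x. ?W n x \<partial>?Q n) = 0"
      using ev by (auto elim: eventually_mono)
    show "?W n \<in> borel_measurable (?Q n)" for n unfolding path_law_eq by measurable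
    show "\<forall>\<^sub>F n in sequentially. \<forall>x\<in>space (?Q n). \<bar>?W n x\<bar> \<le> 1 / \<delta> + 1 + \<bar>fst g\<bar>"
      using eventually_ge_at_top[of 1]
    proof (eventually_elim, intro ballI)
      fix n :: nat and x assume "1 \<le> n"
      then have "\<bar>fst g\<bar> / sqrt n \<le> \<bar>fst g\<bar> / 1" by (intro divide_left_mono) auto
      then have "\<bar>fst g / sqrt n\<bar> \<le> \<bar>fst g\<bar>" by (simp add: abs_divide)
      then show "\<bar>?W n x\<bar> \<le> 1 / \<delta> + 1 + \<bar>fst g\<bar>"
        using infl_bounded[OF delta_pos, of x] by linarith
    qed
  qed
  then show ?thesis
    by (rule Lim_transform_eventually)
      (rule eventually_sequentiallyI[of 1], simp only: tail_freq_eq sample_law_def)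
qed

text \<open>Levy's continuity theorem, with \<open>psi\<close> of the path law replaced by the value
  \<open>\<theta> + fst g / sqrt n\<close> that it has for large \<open>n\<close>.\<close>

lemma normal_limit_iff_char:
  assumes T: "estimator_seq T"
  shows "regular_with_limit \<delta> \<theta> f T (density lborel (normal_density 0 (sqrt opt_var))) \<longleftrightarrow>
    (\<forall>g\<in>path_set. \<forall>u. (\<lambda>n. \<integral>x. iexp (u * (sqrt n * (T n x - (\<theta> + fst g / sqrt n)))) \<partial>path_sample g n)
      \<longlonglongrightarrow> exp (- (opt_var * u\<^sup>2) / 2))"
proof -
  let ?L = "density lborel (normal_density 0 (sqrt opt_var))"
  note v = opt_var_pos[OF delta_pos]
  have L: "real_distribution ?L" using v by (intro real_distribution_normal) simp
  have charL: "char ?L u = exp (- (opt_var * u\<^sup>2) / 2)" for u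
    using char_normal_distribution[of "sqrt opt_var" u] v by simp
  let ?D = "\<lambda>g n. distr (path_sample g n) borel (\<lambda>x. sqrt n * (T n x - psi (path_law \<delta> \<theta> f g (1 / sqrt n))))"
  have "weak_conv_m (?D g) ?L \<longleftrightarrow>
      (\<forall>u. (\<lambda>n. \<integral>x. iexp (u * (sqrt n * (T n x - (\<theta> + fst g / sqrt n)))) \<partial>path_sample g n)
        \<longlonglongrightarrow> exp (- (opt_var * u\<^sup>2) / 2))" if g: "g \<in> path_set" for g
  proof -
    have T_meas: "T n \<in> borel_measurable (path_sample g n)" for n
      unfolding path_law_eq by (rule estimator_measurable[OF T])
    have "\<forall>\<^sub>F n in sequentially. real_distribution (?D g n)"
      using eventually_prob_space_path_sample[OF g]
    proof eventually_elim
      case (elim n)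
      then interpret prob_space "path_sample g n" .
      show ?case
        using T_meas by (intro real_distribution_distr borel_measurable_times borel_measurable_diff borel_measurable_const)
    qed
    then have "weak_conv_m (?D g) ?L \<longleftrightarrow> (\<forall>u. (\<lambda>n. char (?D g n) u) \<longlonglongrightarrow> char ?L u)"
      using L by (rule weak_conv_m_iff_char)
    moreover have "(\<lambda>n. char (?D g n) u) \<longlonglongrightarrow> l \<longleftrightarrow>
        (\<lambda>n. \<integral>x. iexp (u * (sqrt n * (T n x - (\<theta> + fst g / sqrt n)))) \<partial>path_sample g n) \<longlonglongrightarrow> l" for u l
    proof (rule tendsto_cong)
      show "\<forall>\<^sub>F n in sequentially. char (?D g n) u
          = (\<integral>x. iexp (u * (sqrt n * (T n x - (\<theta> + fst g / sqrt n)))) \<partial>path_sample g n)"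
        using eventually_psi_path_law[OF g]
      proof eventually_elim
        case (elim n)
        show ?case unfolding elim char_def using T_meas[of n] by (subst integral_distr) auto
      qed
    qed
    ultimately show ?thesis unfolding charL by simp
  qed
  then show ?thesis unfolding regular_with_limit_def Let_def using L by blast
qed

text \<open>The hypothesis speaks of \<open>P\<close> only. Bounded chi-square divergence from
  \<open>P\<close> carries the negligibility over to the samples of each path, where the limit law
  of the tail frequency is already known.\<close>

lemma oP_imp_efficient:
  assumes T: "estimator_seq T"
    and oP: "equal_up_to_oP P (\<lambda>n. real n powr (-1/2)) T tail_freq"
  shows "asymptotically_efficient \<delta> \<theta> f T"
proof -
  have "regular_with_limit \<delta> \<theta> f T (density lborel (normal_density 0 (sqrt opt_var)))"
    unfolding normal_limit_iff_char[OF T]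
  proof (intro ballI allI)
    fix g u assume g: "g \<in> path_set"
    define A where "A e n = {x \<in> space (P_n n). e * real n powr (-1/2) < \<bar>T n x - tail_freq n x\<bar>}" for e n
    define U where "U n x = sqrt n * (T n x - (\<theta> + fst g / sqrt n))" for n x
    define V where "V n x = sqrt n * (tail_freq n x - (\<theta> + fst g / sqrt n))" for n x
    have T_meas: "T n \<in> borel_measurable (path_sample g n)" for n
      unfolding path_law_eq by (rule estimator_measurable[OF T])
    have S_meas: "tail_freq n \<in> borel_measurable (path_sample g n)" for n
      unfolding path_law_eq by (rule tail_freq_borel)
    obtain K where K: "K \<longlonglongrightarrow> (\<integral>x. (score g x - score base_path x)\<^sup>2 \<partial>P)"
      and L: "\<forall>\<^sub>F n in sequentially. likelihood_ratio (path_sample base_path n) (path_ratio g base_path n) \<and>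
        path_sample g n = density (path_sample base_path n) (\<lambda>x. ennreal (path_ratio g base_path n x)) \<and>
        likelihood_ratio.chi2 (path_sample base_path n) (path_ratio g base_path n) \<le> exp (K n) - 1"
      by (rule path_likelihood_ratio[OF g base_path_in])
    have contig: "(\<lambda>n. measure (path_sample g n) (A e n)) \<longlonglongrightarrow> 0" if "0 < e" for e
    proof -
      define m where "m n = measure (P_n n) (A e n)" for n
      have "m \<longlonglongrightarrow> 0" using oP that unfolding equal_up_to_oP_def m_def A_def by blast
      then have "(\<lambda>n. m n + sqrt (m n) * sqrt (exp (K n) - 1)) \<longlonglongrightarrow> 0 + sqrt 0 *
          sqrt (exp (\<integral>x. (score g x - score base_path x)\<^sup>2 \<partial>P) - 1)"
        by (intro tendsto_intros K)
      then have lim: "(\<lambda>n. m n + sqrt (m n) * sqrt (exp (K n) - 1)) \<longlonglongrightarrow> 0" by simp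
      have "\<forall>\<^sub>F n in sequentially. norm (measure (path_sample g n) (A e n)) \<le> m n + sqrt (m n) * sqrt (exp (K n) - 1)"
        using L
      proof eventually_elim
        case (elim n)
        interpret L: likelihood_ratio "P_n n" "path_ratio g base_path n"
          using elim by (simp add: path_law_base)
        have [measurable]: "T n \<in> borel_measurable (P_n n)" "tail_freq n \<in> borel_measurable (P_n n)"
          using estimator_measurable[OF T] tail_freq_borel by auto
        have "A e n \<in> sets (P_n n)" unfolding A_def by measurable
        from L.measure_density_le[OF this] elim
        have "measure (path_sample g n) (A e n) \<le> m n + sqrt (m n) * sqrt L.chi2"
          by (simp add: path_law_base m_def)
        also have "\<dots> \<le> m n + sqrt (m n) * sqrt (exp (K n) - 1)"
          using elim by (intro add_left_mono mult_left_mono) (auto simp: path_law_base m_def)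
        finally show ?case by simp
      qed
      then show ?thesis using lim by (rule Lim_null_comparison)
    qed
    have "(\<lambda>n. (\<integral>x. iexp (u * U n x) \<partial>path_sample g n) - (\<integral>x. iexp (u * V n x) \<partial>path_sample g n)) \<longlonglongrightarrow> 0"
      unfolding tendsto_iff
    proof (intro allI impI)
      fix \<eta> :: real assume \<eta>: "0 < \<eta>"
      \<comment> \<open>The budget is \<open>\<eta> / 2\<close> for the Lipschitz part and twice
        \<open>\<eta> / 4\<close> for the exceptional event; adding 1 to
        \<open>\<bar>u\<bar>\<close> covers \<open>u = 0\<close>.\<close>
      define e where "e = \<eta> / (2 * (\<bar>u\<bar> + 1))"
      have e: "0 < e" "\<bar>u\<bar> * e \<le> \<eta> / 2"
        using \<eta> by (auto simp: e_def field_simps)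
      have "\<forall>\<^sub>F n in sequentially. measure (path_sample g n) (A e n) < \<eta> / 4"
        using contig[OF e(1)] by (rule order_tendstoD) (use \<eta> in simp)
      then show "\<forall>\<^sub>F n in sequentially. dist ((\<integral>x. iexp (u * U n x) \<partial>path_sample g n)
          - (\<integral>x. iexp (u * V n x) \<partial>path_sample g n)) 0 < \<eta>"
        using eventually_prob_space_path_sample[OF g] L eventually_ge_at_top[of 1]
      proof eventually_elim
        case (elim n)
        interpret prob_space "path_sample g n" by (rule elim)
        have [measurable]: "U n \<in> borel_measurable (path_sample g n)" "V n \<in> borel_measurable (path_sample g n)"
          unfolding U_def[abs_def] V_def[abs_def] using T_meas[of n] S_meas[of n] by measurable
        have "{x \<in> space (path_sample g n). e < \<bar>U n x - V n x\<bar>} = A e n"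
        proof -
          have sp: "space (path_sample g n) = space (P_n n)"
            by (simp add: sample_law_def space_PiM path_law_eq)
          have "U n x - V n x = sqrt n * (T n x - tail_freq n x)" for x
            by (simp add: U_def V_def algebra_simps)
          moreover have "real n powr (-1/2) = 1 / sqrt n"
            using elim(4) by (simp add: powr_minus_divide powr_half_sqrt)
          ultimately show ?thesis
            unfolding A_def sp using elim(4) by (simp add: abs_mult pos_divide_less_eq mult.commute)
        qed
        then have "cmod ((\<integral>x. iexp (u * U n x) \<partial>path_sample g n) - (\<integral>x. iexp (u * V n x) \<partial>path_sample g n))
            \<le> \<bar>u\<bar> * e + 2 * measure (path_sample g n) (A e n)"
          using char_perturbation[of "U n" "V n" e u] e(1) by simp
        then show ?case using e(2) elim(1) by simp
      qed
    qed
    from tendsto_add[OF this char_tail_freq[OF g, of u, folded V_def]]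
    show "(\<lambda>n. \<integral>x. iexp (u * (sqrt n * (T n x - (\<theta> + fst g / sqrt n)))) \<partial>path_sample g n)
      \<longlonglongrightarrow> exp (- (opt_var * u\<^sup>2) / 2)"
      by (simp add: U_def)
  qed
  then show ?thesis
    unfolding asymptotically_efficient_def
    using efficient_influence_infl[OF delta_pos] integral_infl_square[OF delta_pos] by (intro exI[of _ infl]) simp
qed

end

end

text \<open>The Taylor error of the sine at order two. For large \<open>M\<close> the truncation
  \<open>M * sin (u / M)\<close> is uniformly close to \<open>u\<close> on bounded sets, while
  staying bounded by \<open>M\<close>.\<close>

lemma abs_sub_scaled_sin_le:
  fixes u M :: real
  assumes "0 < M" shows "\<bar>u - M * sin (u / M)\<bar> \<le> u\<^sup>2 / (2 * M)"
proof -
  have "\<bar>sin (u / M) - u / M\<bar> \<le> (u / M)\<^sup>2 / 2"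
    using Maclaurin_sin_bound[of "u / M" 2] by (simp add: eval_nat_numeral sin_coeff_def)
  then have "M * \<bar>u / M - sin (u / M)\<bar> \<le> M * ((u / M)\<^sup>2 / 2)"
    using assms by (intro mult_left_mono) (auto simp: abs_minus_commute)
  moreover have "M * \<bar>u / M - sin (u / M)\<bar> = \<bar>u - M * sin (u / M)\<bar>"
    using assms abs_mult[of M "u / M - sin (u / M)"] by (simp add: right_diff_distrib)
  moreover have "M * ((u / M)\<^sup>2 / 2) = u\<^sup>2 / (2 * M)"
    using assms by (simp add: power2_eq_square)
  ultimately show ?thesis by simp
qed

lemma (in prob_space) Chebyshev_L2:
  fixes X :: "'a \<Rightarrow> real"
  assumes [measurable]: "X \<in> borel_measurable M" and X2: "integrable M (\<lambda>x. (X x)\<^sup>2)" and "0 < e"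
  shows "measure M {x \<in> space M. e < \<bar>X x\<bar>} \<le> (\<integral>x. (X x)\<^sup>2 \<partial>M) / e\<^sup>2"
proof -
  let ?A = "{x \<in> space M. e < \<bar>X x\<bar>}"
  have "measure M ?A = (\<integral>x. indicator ?A x \<partial>M)"
    by (simp add: Int_absorb2)
  also have "\<dots> \<le> (\<integral>x. (X x)\<^sup>2 / e\<^sup>2 \<partial>M)"
  proof (rule integral_mono)
    show "integrable M (indicator ?A :: 'a \<Rightarrow> real)"
      by (rule integrable_const_bound[where B = 1]) auto
    show "integrable M (\<lambda>x. (X x)\<^sup>2 / e\<^sup>2)" using X2 by simp
    show "indicator ?A x \<le> (X x)\<^sup>2 / e\<^sup>2" for x
      using \<open>0 < e\<close> power_mono[of e "\<bar>X x\<bar>" 2] by (auto simp: pos_le_divide_eq split: split_indicator)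
  qed
  finally show ?thesis by simp
qed

context likelihood_ratio
begin

text \<open>The difference quotient \<open>(r - 1) / c\<close> of the likelihood plays the role of a score; the square
  root is its \<open>L\<^sup>2\<close> distance to \<open>Z\<close>.\<close>

lemma covariance_score_le:
  assumes Y[measurable]: "Y \<in> borel_measurable M" and Yb: "\<And>x. x \<in> space M \<Longrightarrow> \<bar>Y x\<bar> \<le> B"
    and Z[measurable]: "Z \<in> borel_measurable M" and Z2: "integrable M (\<lambda>x. (Z x)\<^sup>2)"
    and "0 < c"
  defines "N \<equiv> density M (\<lambda>x. ennreal (r x))"
  shows "((\<integral>x. Y x \<partial>N) - (\<integral>x. Y x \<partial>M)) / c
    \<le> (\<integral>x. Y x * Z x \<partial>M)
      + B * sqrt ((\<integral>x. (Z x)\<^sup>2 \<partial>M) - 2 * ((\<integral>x. Z x \<partial>N) - (\<integral>x. Z x \<partial>M)) / c + chi2 / c\<^sup>2)"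
proof -
  define D where "D x = (r x - 1) / c" for x
  have [measurable]: "D \<in> borel_measurable M" unfolding D_def[abs_def] by measurable
  obtain x0 where "x0 \<in> space M" using not_empty by blast
  then have B: "0 \<le> B" using Yb[of x0] by simp
  have Y2: "integrable M (\<lambda>x. (Y x)\<^sup>2)" "(\<integral>x. (Y x)\<^sup>2 \<partial>M) \<le> B\<^sup>2"
  proof -
    have le: "(Y x)\<^sup>2 \<le> B\<^sup>2" if "x \<in> space M" for x
      using power_mono[OF Yb[OF that], of 2] by simp
    show i: "integrable M (\<lambda>x. (Y x)\<^sup>2)"
      by (rule integrable_const_bound[where B = "B\<^sup>2"]) (use le in auto)
    have "(\<integral>x. (Y x)\<^sup>2 \<partial>M) \<le> (\<integral>x. B\<^sup>2 \<partial>M)"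
      by (rule integral_mono[OF i]) (use le in auto)
    then show "(\<integral>x. (Y x)\<^sup>2 \<partial>M) \<le> B\<^sup>2" by (simp add: prob_space)
  qed
  have r1: "integrable M (\<lambda>x. (r x - 1)\<^sup>2)"
    using integrable_diff_L2[of r M "\<lambda>_. 1"] r_L2 by simp
  then have D2: "integrable M (\<lambda>x. (D x)\<^sup>2)" "(\<integral>x. (D x)\<^sup>2 \<partial>M) = chi2 / c\<^sup>2"
    by (simp_all add: D_def power_divide chi2_def)
  \<comment> \<open>For any square integrable statistic the mean shift divided by \<open>c\<close>
    is its inner product with \<open>D\<close>. For \<open>Y\<close> this is the left-hand side of
    the claim; for \<open>Z\<close> it is the cross term in the squared distance of \<open>D\<close>
    and \<open>Z\<close>.\<close>
  have cov: "(\<integral>x. X x * D x \<partial>M) = ((\<integral>x. X x \<partial>N) - (\<integral>x. X x \<partial>M)) / c"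
    if X[measurable]: "X \<in> borel_measurable M" and X2: "integrable M (\<lambda>x. (X x)\<^sup>2)" for X
  proof -
    have "(\<integral>x. X x * D x \<partial>M) = (\<integral>x. (r x * X x - X x) / c \<partial>M)"
      by (simp add: D_def algebra_simps)
    also have "\<dots> = ((\<integral>x. r x * X x \<partial>M) - (\<integral>x. X x \<partial>M)) / c"
      using integrable_mult_L2[OF r_measurable X r_L2 X2] square_integrable_imp_integrable[OF X X2] by simp
    finally show ?thesis by (simp add: N_def integral_density_eq[OF X])
  qed
  have YD: "integrable M (\<lambda>x. Y x * D x)" "integrable M (\<lambda>x. Y x * Z x)" "integrable M (\<lambda>x. Z x * D x)"
    using integrable_mult_L2[OF Y _ Y2(1) D2(1)] integrable_mult_L2[OF Y Z Y2(1) Z2]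
      integrable_mult_L2[OF Z _ Z2 D2(1)] by simp_all
  have ZD2: "integrable M (\<lambda>x. (D x - Z x)\<^sup>2)"
    by (rule integrable_diff_L2[OF _ Z D2(1) Z2]) measurable
  have "(\<integral>x. (D x - Z x)\<^sup>2 \<partial>M) = (\<integral>x. (D x)\<^sup>2 - 2 * (Z x * D x) + (Z x)\<^sup>2 \<partial>M)"
    by (simp add: power2_diff algebra_simps)
  also have "\<dots> = (\<integral>x. (Z x)\<^sup>2 \<partial>M) - 2 * ((\<integral>x. Z x \<partial>N) - (\<integral>x. Z x \<partial>M)) / c + chi2 / c\<^sup>2"
    using D2 Z2 YD(3) by (simp add: cov[OF Z Z2])
  finally have dist: "(\<integral>x. (D x - Z x)\<^sup>2 \<partial>M)
    = (\<integral>x. (Z x)\<^sup>2 \<partial>M) - 2 * ((\<integral>x. Z x \<partial>N) - (\<integral>x. Z x \<partial>M)) / c + chi2 / c\<^sup>2" .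
  have "((\<integral>x. Y x \<partial>N) - (\<integral>x. Y x \<partial>M)) / c = (\<integral>x. Y x * Z x + Y x * (D x - Z x) \<partial>M)"
    unfolding cov[OF Y Y2(1), symmetric] by (simp add: algebra_simps)
  also have "\<dots> = (\<integral>x. Y x * Z x \<partial>M) + (\<integral>x. Y x * (D x - Z x) \<partial>M)"
    using YD by (simp add: right_diff_distrib)
  also have "(\<integral>x. Y x * (D x - Z x) \<partial>M) \<le> sqrt (\<integral>x. (Y x)\<^sup>2 \<partial>M) * sqrt (\<integral>x. (D x - Z x)\<^sup>2 \<partial>M)"
    by (rule order_trans[OF abs_ge_self Cauchy_Schwarz_integral[OF _ _ Y2(1) ZD2]]) measurable
  also have "\<dots> \<le> B * sqrt (\<integral>x. (D x - Z x)\<^sup>2 \<partial>M)"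
    using Y2(2) B by (intro mult_right_mono real_le_lsqrt) auto
  finally show ?thesis unfolding dist by simp
qed

end

context mixture_model
begin

context
  assumes delta_pos: "0 < \<delta>"
begin

lemma scaled_tail_freq_eq:
  assumes "1 \<le> n"
  shows "sqrt n * (tail_freq n x - \<theta>) = (\<Sum>i<n. infl (x i)) / sqrt n"
  using tail_freq_eq[OF delta_pos assms, of x 0] by (simp add: sum_divide_distrib)

lemma tail_freq_base_moments:
  assumes "1 \<le> n"
  shows "integrable (P_n n) (\<lambda>x. (sqrt n * (tail_freq n x - \<theta>))\<^sup>2)"
    and "(\<integral>x. (sqrt n * (tail_freq n x - \<theta>))\<^sup>2 \<partial>P_n n) = opt_var"
proof -
  interpret prob_space P by (rule prob_space_mix[OF f_dens theta01(1)])
  have inflP: "infl \<in> borel_measurable P" by measurable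
  have ind: "integrable P (indicator {1-\<delta>..1} :: real \<Rightarrow> real)"
    by (rule integrable_const_bound[where B = 1]) auto
  have m0: "(\<integral>x. infl x \<partial>P) = 0"
    using ind integral_indicator_mix[OF f_dens _ theta01(1)] delta delta_pos prob_space
    by (simp add: infl_def)
  have sq: "(sqrt n * (tail_freq n x - \<theta>))\<^sup>2 = (\<Sum>i<n. infl (x i))\<^sup>2 / n" for x
    unfolding scaled_tail_freq_eq[OF assms] by (simp add: power_divide)
  show "integrable (P_n n) (\<lambda>x. (sqrt n * (tail_freq n x - \<theta>))\<^sup>2)"
    unfolding sq sample_law_def
    using integrable_PiM_sum_square[OF _ inflP integrable_infl_square[OF delta_pos] m0, of "{..<n}"] by simp
  show "(\<integral>x. (sqrt n * (tail_freq n x - \<theta>))\<^sup>2 \<partial>P_n n) = opt_var"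
    unfolding sq sample_law_def
    using integral_PiM_sum_square[OF _ inflP integrable_infl_square[OF delta_pos] m0, of "{..<n}"] assms
    by (simp add: integral_infl_square[OF delta_pos])
qed

lemma tail_freq_mean:
  assumes g: "g \<in> path_set"
  shows "\<forall>\<^sub>F n in sequentially. (\<integral>x. sqrt n * (tail_freq n x - \<theta>) \<partial>path_sample g n) = fst g"
  using path_law_infl[OF delta_pos g] eventually_ge_at_top[of 1]
proof eventually_elim
  case (elim n)
  define Q where "Q = path_law \<delta> \<theta> f g (1 / sqrt n)"
  interpret Q: prob_space Q using elim by (simp add: Q_def)
  have inflQ: "infl \<in> borel_measurable Q" unfolding Q_def path_law_eq by measurable
  have i: "integrable Q infl"
    by (rule Q.integrable_const_bound[where B = "1 / \<delta> + 1"])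
      (use infl_bounded[OF delta_pos] inflQ in auto)
  have "(\<integral>x. infl x \<partial>Q) = fst g / sqrt n"
    using elim i Q.prob_space by (simp add: Q_def[symmetric])
  then have comp: "(\<integral>x. infl (x i) \<partial>(\<Pi>\<^sub>M i\<in>{..<n}. Q)) = fst g / sqrt n"
    "integrable (\<Pi>\<^sub>M i\<in>{..<n}. Q) (\<lambda>x. infl (x i))" if "i \<in> {..<n}" for i
    using Q.integral_PiM_component[OF that inflQ] Q.integrable_PiM_component[OF that inflQ] i by simp_all
  have "(\<integral>x. (\<Sum>i<n. infl (x i)) / sqrt n \<partial>(\<Pi>\<^sub>M i\<in>{..<n}. Q))
      = (\<Sum>i<n. \<integral>x. infl (x i) \<partial>(\<Pi>\<^sub>M i\<in>{..<n}. Q)) / sqrt n"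
    unfolding integral_divide_zero by (subst Bochner_Integration.integral_sum[OF comp(2)]) auto
  also have "\<dots> = (\<Sum>i<n. fst g / sqrt n) / sqrt n"
    using comp(1) by (intro arg_cong2[where f = "(/)"] sum.cong refl)
  also have "\<dots> = fst g" using elim(2) by simp
  finally show ?case
    unfolding scaled_tail_freq_eq[OF elim(2)] by (simp add: sample_law_def Q_def)
qed

context
  fixes T :: "nat \<Rightarrow> (nat \<Rightarrow> real) \<Rightarrow> real"
  assumes T: "estimator_seq T"
    and regular: "regular_with_limit \<delta> \<theta> f T (density lborel (normal_density 0 (sqrt opt_var)))"
begin

text \<open>The ray through the least favourable path. On \<open>[0,1]\<close> its score is
  \<open>c * infl\<close>, so \<open>c * opt_var\<close> is the shift of the parameter and
  \<open>c\<^sup>2 * opt_var\<close> the squared norm.\<close>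

definition opt_path :: "real \<Rightarrow> real \<times> (real \<Rightarrow> real)" where
  "opt_path c = (c * opt_var, \<lambda>x. c * opt_h x)"

lemma opt_path_scaled_in: "0 \<le> c \<Longrightarrow> opt_path c \<in> path_set"
  unfolding opt_path_def by (rule paths_scale[OF opt_path_in[OF delta_pos]])

lemma T_borel: "T n \<in> borel_measurable (path_sample g n)"
  unfolding path_law_eq by (rule estimator_measurable[OF T])

text \<open>Centring at the fixed \<open>\<theta>\<close> turns the local shift into a phase factor,
  so that the same statistic can be compared under different \<open>c\<close>.\<close>

lemma iexp_limit:
  assumes "0 \<le> c"
  shows "(\<lambda>n. \<integral>x. iexp (u * (sqrt n * (T n x - \<theta>))) \<partial>path_sample (opt_path c) n)
    \<longlonglongrightarrow> iexp (u * (c * opt_var)) * exp (- (opt_var * u\<^sup>2) / 2)"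
proof -
  have "(\<lambda>n. iexp (u * (c * opt_var)) *
      (\<integral>x. iexp (u * (sqrt n * (T n x - (\<theta> + c * opt_var / sqrt n)))) \<partial>path_sample (opt_path c) n))
    \<longlonglongrightarrow> iexp (u * (c * opt_var)) * exp (- (opt_var * u\<^sup>2) / 2)"
    using regular[unfolded normal_limit_iff_char[OF delta_pos T], rule_format,
        OF opt_path_scaled_in[OF assms], of u]
    by (intro tendsto_intros) (simp add: opt_path_def)
  then show ?thesis
  proof (rule Lim_transform_eventually)
    show "\<forall>\<^sub>F n in sequentially. iexp (u * (c * opt_var)) *
        (\<integral>x. iexp (u * (sqrt n * (T n x - (\<theta> + c * opt_var / sqrt n)))) \<partial>path_sample (opt_path c) n)
      = (\<integral>x. iexp (u * (sqrt n * (T n x - \<theta>))) \<partial>path_sample (opt_path c) n)"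
      using eventually_ge_at_top[of 1]
    proof eventually_elim
      case (elim n)
      have "u * (sqrt n * (T n x - \<theta>))
          = u * (c * opt_var) + u * (sqrt n * (T n x - (\<theta> + c * opt_var / sqrt n)))" for x
        using elim by (simp add: field_simps)
      then have "iexp (u * (sqrt n * (T n x - \<theta>)))
          = iexp (u * (c * opt_var)) * iexp (u * (sqrt n * (T n x - (\<theta> + c * opt_var / sqrt n))))" for x
        by (simp only: of_real_add distrib_left exp_add)
      then show ?case by (simp only: integral_mult_right_zero)
    qed
  qed
qed

lemma trig_limits:
  assumes "0 \<le> c"
  shows "(\<lambda>n. \<integral>x. sin (u * (sqrt n * (T n x - \<theta>))) \<partial>path_sample (opt_path c) n)
      \<longlonglongrightarrow> sin (u * (c * opt_var)) * exp (- (opt_var * u\<^sup>2) / 2)"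
    and "(\<lambda>n. \<integral>x. cos (u * (sqrt n * (T n x - \<theta>))) \<partial>path_sample (opt_path c) n)
      \<longlonglongrightarrow> cos (u * (c * opt_var)) * exp (- (opt_var * u\<^sup>2) / 2)"
proof -
  let ?I = "\<lambda>n. \<integral>x. iexp (u * (sqrt n * (T n x - \<theta>))) \<partial>path_sample (opt_path c) n"
  have parts: "\<forall>\<^sub>F n in sequentially.
      Im (?I n) = (\<integral>x. sin (u * (sqrt n * (T n x - \<theta>))) \<partial>path_sample (opt_path c) n) \<and>
      Re (?I n) = (\<integral>x. cos (u * (sqrt n * (T n x - \<theta>))) \<partial>path_sample (opt_path c) n)"
    using eventually_prob_space_path_sample[OF opt_path_scaled_in[OF assms]]
  proof eventually_elim
    case (elim n)
    interpret prob_space "path_sample (opt_path c) n" by (rule elim)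
    note [measurable] = T_borel[of n "opt_path c"]
    have i: "integrable (path_sample (opt_path c) n) (\<lambda>x. iexp (u * (sqrt n * (T n x - \<theta>))))"
      by (rule integrable_iexp) measurable
    show ?case
      unfolding integral_Im[OF i, symmetric] integral_Re[OF i, symmetric] by (simp add: Im_exp Re_exp)
  qed
  have "(\<lambda>n. Im (?I n)) \<longlonglongrightarrow> Im (iexp (u * (c * opt_var)) * exp (- (opt_var * u\<^sup>2) / 2))"
    "(\<lambda>n. Re (?I n)) \<longlonglongrightarrow> Re (iexp (u * (c * opt_var)) * exp (- (opt_var * u\<^sup>2) / 2))"
    using iexp_limit[OF assms, of u] by (rule tendsto_Im tendsto_Re)+
  moreover have Im_mult: "Im (z * of_real r) = Im z * r" and Re_mult: "Re (z * of_real r) = Re z * r" for z r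
    by simp_all
  have "Im (iexp (u * (c * opt_var)) * exp (- (opt_var * u\<^sup>2) / 2))
      = sin (u * (c * opt_var)) * exp (- (opt_var * u\<^sup>2) / 2)"
    "Re (iexp (u * (c * opt_var)) * exp (- (opt_var * u\<^sup>2) / 2))
      = cos (u * (c * opt_var)) * exp (- (opt_var * u\<^sup>2) / 2)"
    unfolding Im_mult Re_mult by (simp_all add: Im_exp Re_exp)
  ultimately show "(\<lambda>n. \<integral>x. sin (u * (sqrt n * (T n x - \<theta>))) \<partial>path_sample (opt_path c) n)
      \<longlonglongrightarrow> sin (u * (c * opt_var)) * exp (- (opt_var * u\<^sup>2) / 2)"
    "(\<lambda>n. \<integral>x. cos (u * (sqrt n * (T n x - \<theta>))) \<partial>path_sample (opt_path c) n)
      \<longlonglongrightarrow> cos (u * (c * opt_var)) * exp (- (opt_var * u\<^sup>2) / 2)"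
    using parts by (auto elim!: Lim_transform_eventually eventually_mono)
qed

text \<open>\<open>Y\<close>, the sine truncation of the rescaled estimator \<open>U\<close>, is
  compared with the rescaled tail frequency \<open>Z\<close> in mean square. The second moment of
  \<open>Z\<close> is \<open>v\<close>, that of \<open>Y\<close> tends to at most \<open>v\<close>,
  and the mean shift of \<open>Y\<close> along \<open>opt_path c\<close> bounds the covariance from
  below by nearly \<open>v\<close>. Chebyshev's inequality then controls \<open>Y - Z\<close>, and
  tightness of \<open>U\<close> controls \<open>U - Y\<close>.\<close>

lemma oP_of_truncation:
  assumes "0 < \<eta>" "0 < \<epsilon>"
  shows "\<forall>\<^sub>F n in sequentially.
    measure (P_n n) {x \<in> space (P_n n). \<epsilon> < \<bar>sqrt n * (T n x - tail_freq n x)\<bar>} < \<eta>"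
proof -
  define v where "v = opt_var"
  have v: "0 < v" using opt_var_pos[OF delta_pos] by (simp add: v_def)
  define U where "U n x = sqrt n * (T n x - \<theta>)" for n x
  define Z where "Z n x = sqrt n * (tail_freq n x - \<theta>)" for n x
  have U_borel[measurable]: "U n \<in> borel_measurable (P_n n)" for n
    unfolding U_def[abs_def] using estimator_measurable[OF T, of n] by measurable
  have Z_borel[measurable]: "Z n \<in> borel_measurable (P_n n)" for n
    unfolding Z_def[abs_def] using tail_freq_borel[OF delta_pos, of n] by measurable
  have base: "path_sample (opt_path 0) n = P_n n" for n
    using path_law_base by (simp add: opt_path_def base_path_def)

  \<comment> \<open>Tightness of the rescaled estimator\<close>
  have dist: "\<forall>\<^sub>F n in sequentially. real_distribution (distr (P_n n) borel (U n))"
    using eventually_prob_space_path_sample[OF base_path_in]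
  proof eventually_elim
    case (elim n)
    then interpret prob_space "P_n n" by (simp add: path_law_base)
    show ?case by (intro real_distribution_distr) measurable
  qed
  have "weak_conv_m (\<lambda>n. distr (P_n n) borel (U n)) (density lborel (normal_density 0 (sqrt opt_var)))"
  proof -
    have "(\<lambda>n. char (distr (P_n n) borel (U n)) u)
        \<longlonglongrightarrow> char (density lborel (normal_density 0 (sqrt opt_var))) u" for u
    proof -
      have "char (distr (P_n n) borel (U n)) u = (\<integral>x. iexp (u * U n x) \<partial>P_n n)" for n
        unfolding char_def by (subst integral_distr) auto
      moreover have "char (density lborel (normal_density 0 (sqrt opt_var))) u = exp (- (opt_var * u\<^sup>2) / 2)"
        using char_normal_distribution[of "sqrt opt_var" u] v by (simp add: v_def)
      ultimately show ?thesis using iexp_limit[of 0 u] by (simp add: base U_def)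
    qed
    with dist show ?thesis
      using v by (subst weak_conv_m_iff_char) (auto simp: v_def intro!: real_distribution_normal)
  qed
  moreover have "real_distribution (density lborel (normal_density 0 (sqrt opt_var)))"
    using v by (intro real_distribution_normal) (simp add: v_def)
  moreover note dist
  ultimately obtain K where K: "0 < K"
    and tight: "\<forall>\<^sub>F n in sequentially. measure (distr (P_n n) borel (U n)) {x. K < \<bar>x\<bar>} < \<eta> / 2"
    by (rule weak_conv_m_tight[where e = "\<eta> / 2"]) (use assms in auto)

  \<comment> \<open>Error budget and truncation level\<close>
  define \<beta> where "\<beta> = \<eta> * (\<epsilon> / 2)\<^sup>2 / 2"
  have \<beta>: "0 < \<beta>" using assms by (simp add: \<beta>_def)
  \<comment> \<open>Chebyshev's inequality at \<open>\<epsilon> / 2\<close> turns a mean square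
    below \<open>\<beta>\<close> into probability below \<open>\<eta> / 2\<close>. In
    \<open>M\<close> the first term makes the sine error at most \<open>\<epsilon> / 2\<close> where
    \<open>\<bar>U n x\<bar> \<le> K\<close>; the second makes \<open>v\<^sup>2 / M\<^sup>2\<close>,
    the loss caused by truncation, smaller than \<open>\<beta>\<close>.\<close>
  define M where "M = max (K\<^sup>2 / \<epsilon>) (v\<^sup>2 / \<beta> + 1)"
  have M: "1 \<le> M" "K\<^sup>2 / \<epsilon> \<le> M" "v\<^sup>2 / \<beta> < M"
  proof -
    have "0 \<le> v\<^sup>2 / \<beta>" using \<beta> by simp
    then show "1 \<le> M" "K\<^sup>2 / \<epsilon> \<le> M" "v\<^sup>2 / \<beta> < M"
      unfolding M_def by linarith+
  qed
  have vM: "v\<^sup>2 / M\<^sup>2 < \<beta>"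
  proof -
    have "v\<^sup>2 < \<beta> * M" using M(3) \<beta> by (simp add: pos_divide_less_eq mult.commute)
    also have "\<dots> \<le> \<beta> * M\<^sup>2" using M(1) \<beta> by (intro mult_left_mono) (auto simp: power2_eq_square)
    finally show ?thesis using M(1) by (simp add: pos_divide_less_eq)
  qed
  \<comment> \<open>The characteristic function of the centred normal law with variance
    \<open>v\<close>, taken at \<open>1 / M\<close>: the damping of the sine, close to 1 for large
    \<open>M\<close>.\<close>
  define \<kappa> where "\<kappa> = exp (- (v * (1 / M)\<^sup>2) / 2)"
  \<comment> \<open>A bounded substitute for \<open>U n x\<close> whose first two moments are values of characteristic functions.\<close>
  define Y where "Y n x = M * sin (1 / M * U n x)" for n x
  have Y_borel[measurable]: "Y n \<in> borel_measurable (P_n n)" for n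
    unfolding Y_def[abs_def] by measurable
  have Yb: "\<bar>Y n x\<bar> \<le> M" for n x
  proof -
    have "M * \<bar>sin (1 / M * U n x)\<bar> \<le> M * 1" using M(1) by (intro mult_left_mono) auto
    then show ?thesis using M(1) by (simp add: Y_def abs_mult)
  qed

  \<comment> \<open>Dominates the upper limit of \<open>\<integral>x. (Y n x - Z n x)\<^sup>2 \<partial>P_n n\<close>, for every \<open>c > 0\<close>.\<close>
  define R where "R c = v + v - 2 * (M * (sin (1 / M * (c * v)) * \<kappa>) / c)
      + 2 * (M * sqrt ((exp (c\<^sup>2 * v) - 1) / c\<^sup>2 - v))" for c :: real

  \<comment> \<open>The limit of \<open>R\<close> at 0 and the choice of \<open>c\<close>\<close>
  have sin0: "((\<lambda>c. sin (1 / M * (c * v)) / c) \<longlongrightarrow> v / M) (at 0)"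
  proof -
    have "((\<lambda>c. sin (1 / M * (c * v))) has_field_derivative v / M) (at 0)"
      using M(1) by (auto intro!: derivative_eq_intros)
    then show ?thesis by (simp add: DERIV_def)
  qed
  have exp0: "((\<lambda>c. (exp (c\<^sup>2 * v) - 1) / c\<^sup>2) \<longlongrightarrow> v) (at 0)"
  proof -
    have D: "((\<lambda>y. (exp (y * v) - 1) / y) \<longlongrightarrow> v) (at 0)"
    proof -
      have "((\<lambda>y. exp (y * v)) has_field_derivative v) (at 0)"
        by (auto intro!: derivative_eq_intros)
      then show ?thesis by (simp add: DERIV_def)
    qed
    have "filterlim (\<lambda>c::real. c\<^sup>2) (at 0) (at 0)"
      unfolding filterlim_at by (auto intro!: tendsto_eq_intros simp: eventually_at_filter)
    from filterlim_compose[OF D this] show ?thesis .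
  qed
  have R_eq: "R = (\<lambda>c. v + v - 2 * (M * \<kappa> * (sin (1 / M * (c * v)) / c))
      + 2 * (M * sqrt ((exp (c\<^sup>2 * v) - 1) / c\<^sup>2 - v)))"
    by (simp add: R_def fun_eq_iff)
  have lim_eq: "2 * v * (1 - \<kappa>) = v + v - 2 * (M * \<kappa> * (v / M)) + 2 * (M * sqrt (v - v))"
    using M(1) by (simp add: algebra_simps)
  \<comment> \<open>The mean shift of \<open>Y\<close> per unit of \<open>c\<close> tends to
    \<open>v * \<kappa>\<close>, and the square root vanishes because the difference quotient of
    \<open>exp\<close> tends to \<open>v\<close>.\<close>
  have "(R \<longlongrightarrow> 2 * v * (1 - \<kappa>)) (at 0)"
    unfolding R_eq lim_eq by (intro tendsto_intros sin0 exp0)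
  then have "(R \<longlongrightarrow> 2 * v * (1 - \<kappa>)) (at_right 0)"
    by (rule tendsto_mono[OF at_le, rotated]) simp
  moreover have "2 * v * (1 - \<kappa>) < \<beta>"
  proof -
    have "1 - \<kappa> \<le> v * (1 / M)\<^sup>2 / 2"
      using exp_ge_add_one_self[of "- (v * (1 / M)\<^sup>2) / 2"] by (simp add: \<kappa>_def)
    then have "2 * v * (1 - \<kappa>) \<le> 2 * v * (v * (1 / M)\<^sup>2 / 2)" using v by (intro mult_left_mono) auto
    also have "\<dots> = v\<^sup>2 / M\<^sup>2" by (simp add: power2_eq_square)
    finally show ?thesis using vM by simp
  qed
  ultimately have "\<forall>\<^sub>F c in at_right 0. R c < \<beta>"
    by (rule order_tendstoD)
  then have "\<forall>\<^sub>F c in at_right 0. 0 < c \<and> R c < \<beta>"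
    using eventually_at_right_less[of "0::real"] by eventually_elim simp
  then obtain c where c: "0 < c" "R c < \<beta>"
    using eventually_happens by force

  \<comment> \<open>Limits of the moments of the truncated estimator\<close>
  have Y_int: "integral\<^sup>L N (Y n) = M * (\<integral>x. sin (1 / M * U n x) \<partial>N)" for N n
    unfolding Y_def[abs_def] by (rule integral_mult_right_zero)
  define mc where "mc n = (\<integral>x. Y n x \<partial>path_sample (opt_path c) n)" for n
  define m0 where "m0 n = (\<integral>x. Y n x \<partial>P_n n)" for n
  have mc: "mc \<longlonglongrightarrow> M * (sin (1 / M * (c * v)) * \<kappa>)"
  proof -
    have "(\<lambda>n. M * (\<integral>x. sin (1 / M * U n x) \<partial>path_sample (opt_path c) n))
        \<longlonglongrightarrow> M * (sin (1 / M * (c * v)) * \<kappa>)"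
      unfolding U_def v_def \<kappa>_def using c(1) by (intro tendsto_intros trig_limits) simp
    then show ?thesis unfolding mc_def[abs_def] Y_int .
  qed
  have m0: "m0 \<longlonglongrightarrow> 0"
  proof -
    have "(\<lambda>n. M * (\<integral>x. sin (1 / M * U n x) \<partial>path_sample (opt_path 0) n))
        \<longlonglongrightarrow> M * (sin (1 / M * (0 * v)) * \<kappa>)"
      unfolding U_def v_def \<kappa>_def by (intro tendsto_intros trig_limits) simp
    then show ?thesis unfolding m0_def[abs_def] Y_int by (simp add: base)
  qed
  \<comment> \<open>By \<open>sin\<^sup>2 = (1 - cos) / 2\<close> at the doubled argument, the
    second moment of \<open>Y\<close> is a characteristic function at \<open>2 / M\<close>.\<close>
  define q where "q n = (\<integral>x. cos (2 / M * U n x) \<partial>P_n n)" for n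
  have q: "(\<lambda>n. M\<^sup>2 / 2 * (1 - q n)) \<longlonglongrightarrow> M\<^sup>2 / 2 * (1 - exp (- (v * (2 / M)\<^sup>2) / 2))"
  proof -
    have "(\<lambda>n. \<integral>x. cos (2 / M * U n x) \<partial>path_sample (opt_path 0) n)
        \<longlonglongrightarrow> cos (2 / M * (0 * opt_var)) * exp (- (opt_var * (2 / M)\<^sup>2) / 2)"
      unfolding U_def by (rule trig_limits) simp
    then have "q \<longlonglongrightarrow> exp (- (v * (2 / M)\<^sup>2) / 2)"
      by (simp add: q_def[abs_def] base v_def)
    then show ?thesis by (intro tendsto_intros)
  qed
  have q_le: "M\<^sup>2 / 2 * (1 - exp (- (v * (2 / M)\<^sup>2) / 2)) \<le> v"
  proof -
    have "1 - exp (- (v * (2 / M)\<^sup>2) / 2) \<le> v * (2 / M)\<^sup>2 / 2"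
      using exp_ge_add_one_self[of "- (v * (2 / M)\<^sup>2) / 2"] by simp
    then have "M\<^sup>2 / 2 * (1 - exp (- (v * (2 / M)\<^sup>2) / 2)) \<le> M\<^sup>2 / 2 * (v * (2 / M)\<^sup>2 / 2)"
      by (intro mult_left_mono) auto
    also have "\<dots> = v" using M(1) by (simp add: power2_eq_square)
    finally show ?thesis .
  qed

  \<comment> \<open>The likelihood ratio along the ray and the resulting bound
    \<open>B\<close>\<close>
  obtain L where L: "L \<longlonglongrightarrow> (\<integral>x. (score (opt_path c) x - score base_path x)\<^sup>2 \<partial>P)"
    and LR: "\<forall>\<^sub>F n in sequentially. likelihood_ratio (path_sample base_path n) (path_ratio (opt_path c) base_path n) \<and>
      path_sample (opt_path c) n
        = density (path_sample base_path n) (\<lambda>x. ennreal (path_ratio (opt_path c) base_path n x)) \<and>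
      likelihood_ratio.chi2 (path_sample base_path n) (path_ratio (opt_path c) base_path n) \<le> exp (L n) - 1"
    by (rule path_likelihood_ratio[OF opt_path_scaled_in[OF less_imp_le[OF c(1)]] base_path_in])
  have "(\<integral>x. (score (opt_path c) x - score base_path x)\<^sup>2 \<partial>P)
      = (\<integral>x. c\<^sup>2 * (score (opt_var, opt_h) x)\<^sup>2 \<partial>P)"
    by (simp add: path_score_base opt_path_def path_score_scale power_mult_distrib)
  also have "\<dots> = c\<^sup>2 * v"
    unfolding integral_mult_right_zero integral_path_score_opt_square[OF delta_pos] v_def ..
  finally have L: "L \<longlonglongrightarrow> c\<^sup>2 * v" using L by simp

  define B where "B n = M\<^sup>2 / 2 * (1 - q n) + v - 2 * ((mc n - m0 n) / c)
      + 2 * (M * sqrt ((exp (L n) - 1) / c\<^sup>2 - v))" for n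
  have "B \<longlonglongrightarrow> M\<^sup>2 / 2 * (1 - exp (- (v * (2 / M)\<^sup>2) / 2)) + v
      - 2 * ((M * (sin (1 / M * (c * v)) * \<kappa>) - 0) / c) + 2 * (M * sqrt ((exp (c\<^sup>2 * v) - 1) / c\<^sup>2 - v))"
    unfolding B_def using c(1) by (intro tendsto_intros q mc m0 L) auto
  then have B_small: "\<forall>\<^sub>F n in sequentially. B n < \<beta>"
    by (rule order_tendstoD) (use c(2) q_le in \<open>simp add: R_def\<close>)

  have mean_c: "\<forall>\<^sub>F n in sequentially. (\<integral>x. Z n x \<partial>path_sample (opt_path c) n) = c * v"
    using tail_freq_mean[OF opt_path_scaled_in[OF less_imp_le[OF c(1)]]]
    by (simp add: Z_def opt_path_def v_def)
  have mean_0: "\<forall>\<^sub>F n in sequentially. (\<integral>x. Z n x \<partial>P_n n) = 0"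
  proof -
    have "fst base_path = 0" by (simp add: base_path_def)
    then show ?thesis using tail_freq_mean[OF base_path_in] unfolding path_law_base Z_def by simp
  qed

  \<comment> \<open>The mean-square comparison for a fixed large \<open>n\<close>\<close>
  show ?thesis
    using LR mean_c mean_0 B_small tight eventually_ge_at_top[of 1]
  proof eventually_elim
    case (elim n)
    let ?A = "{x \<in> space (P_n n). \<epsilon> < \<bar>sqrt n * (T n x - tail_freq n x)\<bar>}"
      and ?B = "{x \<in> space (P_n n). K < \<bar>U n x\<bar>}"
      and ?C = "{x \<in> space (P_n n). \<epsilon> / 2 < \<bar>Y n x - Z n x\<bar>}"
    interpret LR: likelihood_ratio "P_n n" "path_ratio (opt_path c) base_path n"
      using elim(1) by (simp add: path_law_base)
    have Z2: "integrable (P_n n) (\<lambda>x. (Z n x)\<^sup>2)" "(\<integral>x. (Z n x)\<^sup>2 \<partial>P_n n) = v"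
      unfolding Z_def v_def using tail_freq_base_moments[OF elim(6)] by auto
    have Y2: "integrable (P_n n) (\<lambda>x. (Y n x)\<^sup>2)"
      by (rule LR.integrable_const_bound[where B = "M\<^sup>2"])
        (use power_mono[OF Yb, where n = 2] in \<open>auto intro!: AE_I2\<close>)
    have Y2_eq: "(\<integral>x. (Y n x)\<^sup>2 \<partial>P_n n) = M\<^sup>2 / 2 * (1 - q n)"
    proof -
      have sq: "(Y n x)\<^sup>2 = M\<^sup>2 / 2 * (1 - cos (2 / M * U n x))" for x
        using cos_double_sin[of "1 / M * U n x"] by (simp add: Y_def power_mult_distrib)
      have "integrable (P_n n) (\<lambda>x. cos (2 / M * U n x))"
        by (rule LR.integrable_const_bound[where B = 1]) auto
      then show ?thesis unfolding sq q_def by (simp add: LR.prob_space)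
    qed
    have YZ: "integrable (P_n n) (\<lambda>x. Y n x * Z n x)"
      by (rule integrable_mult_L2[OF Y_borel Z_borel Y2 Z2(1)])
    have N: "density (P_n n) (\<lambda>x. ennreal (path_ratio (opt_path c) base_path n x)) = path_sample (opt_path c) n"
      using elim(1) by (simp add: path_law_base)
    \<comment> \<open>\<open>Z\<close> has variance \<open>v\<close> and mean shift exactly
      \<open>c * v\<close>, so the radicand is \<open>chi2 / c\<^sup>2 - v\<close>: the likelihood
      quotient is close to \<open>Z\<close> in mean square when \<open>c\<close> is small and
      \<open>n\<close> is large.\<close>
    have "(mc n - m0 n) / c \<le> (\<integral>x. Y n x * Z n x \<partial>P_n n)
        + M * sqrt (v - 2 * (c * v - 0) / c + LR.chi2 / c\<^sup>2)"
      using LR.covariance_score_le[OF Y_borel Yb Z_borel Z2(1) c(1)] elim(2,3)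
      unfolding N by (simp add: mc_def m0_def Z2(2))
    also have "\<dots> \<le> (\<integral>x. Y n x * Z n x \<partial>P_n n) + M * sqrt ((exp (L n) - 1) / c\<^sup>2 - v)"
    proof -
      have "LR.chi2 / c\<^sup>2 \<le> (exp (L n) - 1) / c\<^sup>2"
        using elim(1) by (intro divide_right_mono) (auto simp: path_law_base)
      then have "v - 2 * (c * v - 0) / c + LR.chi2 / c\<^sup>2 \<le> (exp (L n) - 1) / c\<^sup>2 - v"
        using c(1) by simp
      then show ?thesis using M(1) by (intro add_left_mono mult_left_mono) auto
    qed
    finally have cov: "(mc n - m0 n) / c - M * sqrt ((exp (L n) - 1) / c\<^sup>2 - v)
        \<le> (\<integral>x. Y n x * Z n x \<partial>P_n n)"
      by simp
    have YZ2: "integrable (P_n n) (\<lambda>x. (Y n x - Z n x)\<^sup>2)"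
      by (rule integrable_diff_L2[OF Y_borel Z_borel Y2 Z2(1)])
    have "(\<integral>x. (Y n x - Z n x)\<^sup>2 \<partial>P_n n)
        = (\<integral>x. (Y n x)\<^sup>2 - 2 * (Y n x * Z n x) + (Z n x)\<^sup>2 \<partial>P_n n)"
      by (simp add: power2_diff algebra_simps)
    also have "\<dots> = M\<^sup>2 / 2 * (1 - q n) - 2 * (\<integral>x. Y n x * Z n x \<partial>P_n n) + v"
      using Y2 Z2 YZ by (simp add: Y2_eq)
    also have "\<dots> \<le> B n"
    proof -
      have "a - s \<le> y \<Longrightarrow> q - 2 * y + v \<le> q + v - 2 * a + 2 * s" for a s y q :: real by simp
      from this[OF cov] show ?thesis unfolding B_def .
    qed
    finally have close: "(\<integral>x. (Y n x - Z n x)\<^sup>2 \<partial>P_n n) < \<beta>" using elim(4) by simp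

    have "measure (P_n n) ?C
        \<le> (\<integral>x. (Y n x - Z n x)\<^sup>2 \<partial>P_n n) / (\<epsilon> / 2)\<^sup>2"
      using assms(2) by (intro LR.Chebyshev_L2 YZ2) auto
    also have "\<dots> < \<beta> / (\<epsilon> / 2)\<^sup>2"
      using close assms(2) by (intro divide_strict_right_mono) auto
    also have "\<dots> = \<eta> / 2" using assms by (simp add: \<beta>_def)
    finally have far: "measure (P_n n) ?C < \<eta> / 2" .
    have large: "measure (P_n n) ?B < \<eta> / 2"
    proof -
      have "measure (distr (P_n n) borel (U n)) {x. K < \<bar>x\<bar>}
          = measure (P_n n) (U n -` {x. K < \<bar>x\<bar>} \<inter> space (P_n n))"
        by (rule measure_distr) auto
      also have "U n -` {x. K < \<bar>x\<bar>} \<inter> space (P_n n) = ?B"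
        by auto
      finally show ?thesis using elim(5) by simp
    qed
    have "?A
        \<subseteq> ?B
          \<union> ?C"
    proof (intro subsetI)
      fix x assume x: "x \<in> ?A"
      have near: "\<bar>U n x - Y n x\<bar> \<le> \<epsilon> / 2" if "\<bar>U n x\<bar> \<le> K"
      proof -
        have "\<bar>U n x - Y n x\<bar> \<le> (U n x)\<^sup>2 / (2 * M)"
          using abs_sub_scaled_sin_le[of M "U n x"] M(1) by (simp add: Y_def)
        also have "\<dots> \<le> K\<^sup>2 / (2 * M)"
          using that M(1) power_mono[OF that, of 2] by (intro divide_right_mono) auto
        also have "\<dots> \<le> \<epsilon> / 2"
          using M(1,2) assms(2) by (simp add: field_simps)
        finally show ?thesis .
      qed
      have eq: "sqrt n * (T n x - tail_freq n x) = U n x - Z n x"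
        by (simp add: U_def Z_def algebra_simps)
      show "x \<in> ?B
          \<union> ?C"
      proof (cases "K < \<bar>U n x\<bar>")
        case False
        have "\<epsilon> < \<bar>sqrt n * (T n x - tail_freq n x)\<bar>" using x by blast
        then have "\<epsilon> < \<bar>U n x - Z n x\<bar>" unfolding eq .
        also have "\<dots> \<le> \<bar>U n x - Y n x\<bar> + \<bar>Y n x - Z n x\<bar>"
          using abs_triangle_ineq[of "U n x - Y n x" "Y n x - Z n x"] by simp
        finally have "\<epsilon> / 2 < \<bar>Y n x - Z n x\<bar>" using near False by linarith
        then show ?thesis using x by simp
      qed (use x in simp)
    qed
    then have "measure (P_n n) ?A
        \<le> measure (P_n n) (?B
          \<union> ?C)"
      by (rule LR.finite_measure_mono) measurable
    also have "\<dots> \<le> measure (P_n n) ?B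
        + measure (P_n n) ?C"
      by (rule measure_Un_le) measurable
    finally show ?case using far large by simp
  qed
qed

end

text \<open>The definition leaves open which influence function is used, but all of them have
  variance \<open>opt_var\<close>, so the normal limit is determined.\<close>

lemma efficient_imp_oP:
  assumes T: "estimator_seq T" and eff: "asymptotically_efficient \<delta> \<theta> f T"
  shows "equal_up_to_oP P (\<lambda>n. real n powr (-1/2)) T tail_freq"
proof -
  from eff have regular: "regular_with_limit \<delta> \<theta> f T (density lborel (normal_density 0 (sqrt opt_var)))"
    unfolding asymptotically_efficient_def using efficient_influence_variance[OF delta_pos] by auto
  show ?thesis
    unfolding equal_up_to_oP_def
  proof (intro allI impI)
    fix \<epsilon> :: real assume \<epsilon>: "0 < \<epsilon>"
    let ?A = "\<lambda>n. {x \<in> space (P_n n). \<epsilon> * real n powr (-1/2) < \<bar>T n x - tail_freq n x\<bar>}"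
    show "(\<lambda>n. measure (P_n n) (?A n)) \<longlonglongrightarrow> 0"
      unfolding tendsto_iff
    proof (intro allI impI)
      fix \<eta> :: real assume "0 < \<eta>"
      from oP_of_truncation[OF T regular this \<epsilon>] eventually_ge_at_top[of 1]
      show "\<forall>\<^sub>F n in sequentially. dist (measure (P_n n) (?A n)) 0 < \<eta>"
      proof eventually_elim
        case (elim n)
        have "real n powr (-1/2) = 1 / sqrt n"
          using elim(2) by (simp add: powr_minus_divide powr_half_sqrt)
        then have "?A n = {x \<in> space (P_n n). \<epsilon> < \<bar>sqrt n * (T n x - tail_freq n x)\<bar>}"
          using elim(2) by (simp add: abs_mult pos_divide_less_eq mult.commute)
        then show ?case using elim(1) by simp
      qed
    qed
  qed
qed

end

end

theorem corollary1:
  fixes \<delta> \<theta> :: real and f :: "real \<Rightarrow> real"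
  assumes "\<delta> \<in> {0..<1}" and "\<theta> \<in> {0<..<1}" and "f \<in> dens_class \<delta>"
  shows "(\<delta> = 0 \<longrightarrow> (\<forall>T. estimator_seq T \<longrightarrow> local_minimax_risk 0 \<theta> f T = \<infinity>)) \<and>
    (\<delta> > 0 \<longrightarrow>
      (\<forall>T. estimator_seq T \<longrightarrow> local_minimax_risk \<delta> \<theta> f T \<ge> ennreal (\<theta> * (1 / \<delta> - \<theta>))) \<and>
      (\<forall>T. estimator_seq T \<longrightarrow>
        (asymptotically_efficient \<delta> \<theta> f T \<longleftrightarrow>
         equal_up_to_oP (mix \<theta> f) (\<lambda>n. real n powr (-1/2)) T
           (\<lambda>n X. 1 / real n * (\<Sum>i<n. 1 / \<delta> * indicator {1-\<delta>..1} (X i))))))"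
proof -
  interpret mixture_model \<delta> \<theta> f by unfold_locales (use assms in auto)
  show ?thesis
    using minimax_delta_zero minimax_delta_pos efficient_imp_oP oP_imp_efficient by blast
qed

end
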